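(* Let $E\subseteq G_\delta$ and let $f:E\to\mathbb{C}$ be a function. The following conditions are equivalent. (a) $f\in H^\infty_{\delta,\mathrm{gen}}(E)$ and $\|f\|_{\delta,\mathrm{gen}}\le 1$. (b) The function $(\lambda,\mu)\mapsto 1-\overline{f(\mu)}f(\lambda)$ on $E\times E$ belongs to $\mathcal{C}_\delta(E)$. (c) $f$ has a $(\delta,E)$-realization. (d) There exists $F\in H^\infty_{\mathbf m}$ with $\|F\|_m\le 1$ such that $f(\lambda)=F(\delta(\lambda))$ for all $\lambda\in E$.
   Context: Setting. $U\subseteq\mathbb{C}^d$ is a domain of holomorphy, $O(\Omega)$ denotes the algebra of holomorphic functions on $\Omega$, and $\delta=(\delta_1,\dots,\delta_m)\in O(U)^m$ is an $m$-tuple of non-constant holomorphic functions. $\mathbb{D}$ is the open unit disk. $G_\delta=\{\lambda\in U: |\delta_l(\lambda)|<1,\ 1\le l\le m\}$ and $K_\delta=\{\lambda\in U: |\delta_l(\lambda)|\le 1,\ 1\le l\le m\}$; $K_\delta$ is assumed compact. Generic tuples. For a set $\Lambda=\{\lambda_1,\dots,\lambda_N\}$ of exactly $N$ distinct points of $\mathbb{C}^d$, $\mathcal{G}_\Lambda$ is the set of $d$-tuples $T=(T^1,\dots,T^d)$ of pairwise commuting operators on the Hilbert space $\mathbb{C}^N$ for which there is a basis $k_1,\dots,k_N$ of $\mathbb{C}^N$ with $T^rk_j=\lambda_j^r k_j$ for all $r,j$ (where $\lambda_j=(\lambda_j^1,\dots,\lambda_j^d)$); then $\sigma(T)=\Lambda$.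 For a function $g$ defined on $\Lambda$, $g(T)$ is the operator with $g(T)k_j=g(\lambda_j)k_j$ for all $j$. For finite $\Lambda\subset G_\delta$ let $\mathcal{F}_{\delta,\Lambda}=\{T\in\mathcal{G}_\Lambda:\|\delta_l(T)\|\le 1,\ 1\le l\le m\}$, and let $\mathcal{F}_{\delta,\mathrm{gen}}$ be the union of all $\mathcal{F}_{\delta,\Lambda}$, $\Lambda\subset G_\delta$ finite. For $E\subseteq G_\delta$ and $f:E\to\mathbb{C}$, $\|f\|_{\delta,\mathrm{gen}}=\sup\{\|f(T)\|: T\in\mathcal{F}_{\delta,\mathrm{gen}},\ \sigma(T)\subseteq E\}$, and $H^\infty_{\delta,\mathrm{gen}}(E)$ is the set of $f:E\to\mathbb{C}$ with $\|f\|_{\delta,\mathrm{gen}}<\infty$. $\mathcal{C}_\delta(E)$ is the set of functions $h$ on $E\times E$ of the form $h(\lambda,\mu)=\sum_{l=1}^m(1-\overline{\delta_l(\mu)}\delta_l(\lambda))a_l(\lambda,\mu)$ where each $a_l$ is positive definite on $E$ (i.e. a positive semidefinite kernel: $\sum_{i,j}a_l(\lambda_i,\lambda_j)c_i\overline{c_j}\ge0$ for all finite families of points of $E$ and complex scalars). A $(\delta,E)$-realization of $f$ is a 4-tuple $(a,\beta,\gamma,D)$ with $a\in\mathbb{C}$ for which there is a decomposed Hilbert space $\mathcal{M}=\bigoplus_{l=1}^m\mathcal{M}_l$, with $\beta,\gamma\in\mathcal{M}$ and $D$ a bounded operator on $\mathcal{M}$, such that: (i) the operator $V=\begin{bmatrix}a&1\otimes\beta\\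 \gamma\otimes1&D\end{bmatrix}$ on $\mathbb{C}\oplus\mathcal{M}$, i.e. $V(c\oplus x)=(ac+\langle x,\beta\rangle)\oplus(c\gamma+Dx)$, is an isometry; (ii) for $\lambda\in E$, $\delta(\lambda)$ acts on $\mathcal{M}$ by $\delta(\lambda)(\oplus_l x_l)=\oplus_l\delta_l(\lambda)x_l$; (iii) $f(\lambda)=a+\langle\delta(\lambda)(1-D\delta(\lambda))^{-1}\gamma,\beta\rangle$ for all $\lambda\in E$. $\mathcal{F}_m$ is the set of pairwise commuting $m$-tuples of contractions on a fixed separable infinite-dimensional Hilbert space. For $F\in O(\mathbb{D}^m)$, $\|F\|_m=\sup\{\|F(T)\|:T\in\mathcal{F}_m,\ \sigma(T)\subset\mathbb{D}^m\}$, where $\sigma(T)$ is the Taylor joint spectrum and $F(T)$ is given by the holomorphic functional calculus. $H^\infty_{\mathbf m}$ is the set of $F\in O(\mathbb{D}^m)$ with $\|F\|_m<\infty$. *)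

theory Defs
  imports
    "HOL-Analysis.Analysis"
    "HOL-Library.Extended_Nonnegative_Real"
    "HOL-Library.Nonpos_Ints"
    "Jordan_Normal_Form.VS_Connect"
begin

text \<open>Both libraries use \<open>$\<close> for component access; here it is \<^term>\<open>vec_nth\<close> only.\<close>
no_notation Matrix.vec_index (infixl "$" 100)

section \<open>Complex Hilbert spaces\<close>

text \<open>Inner products are linear in the first argument.\<close>

class complex_hilbert = banach +
  fixes scaleC :: "complex \<Rightarrow> 'a \<Rightarrow> 'a"
    and cinner :: "'a \<Rightarrow> 'a \<Rightarrow> complex"
  assumes scaleC_add_right: "scaleC c (x + y) = scaleC c x + scaleC c y"
    and scaleC_add_left: "scaleC (b + c) x = scaleC b x + scaleC c x"
    and scaleC_scaleC: "scaleC b (scaleC c x) = scaleC (b * c) x"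
    and scaleC_complex_of_real: "scaleC (complex_of_real r) x = scaleR r x"
    and cinner_commute: "cinner y x = cnj (cinner x y)"
    and cinner_add_left: "cinner (x + y) z = cinner x z + cinner y z"
    and cinner_scaleC_left: "cinner (scaleC c x) y = c * cinner x y"
    and cinner_self: "cinner x x = complex_of_real ((norm x)\<^sup>2)"

text \<open>The type \<open>'h ^ 'm\<close> is the Hilbert space direct sum of \<open>'m\<close>-many copies of \<open>'h\<close>; the
  library norm is already the right one.\<close>

instantiation Finite_Cartesian_Product.vec :: (complex_hilbert, finite) complex_hilbert
begin

definition scaleC_vec :: "complex \<Rightarrow> 'a ^ 'b \<Rightarrow> 'a ^ 'b"
  where "scaleC_vec c x = (\<chi> l. scaleC c (x $ l))"

definition cinner_vec :: "'a ^ 'b \<Rightarrow> 'a ^ 'b \<Rightarrow> complex"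
  where "cinner_vec x y = (\<Sum>l\<in>UNIV. cinner (x $ l) (y $ l))"

instance
proof
  fix b c :: complex and r :: real and x y z :: "'a ^ 'b"
  show "scaleC c (x + y) = scaleC c x + scaleC c y"
    by (simp add: scaleC_vec_def Finite_Cartesian_Product.vec_eq_iff scaleC_add_right)
  show "scaleC (b + c) x = scaleC b x + scaleC c x"
    by (simp add: scaleC_vec_def Finite_Cartesian_Product.vec_eq_iff scaleC_add_left)
  show "scaleC b (scaleC c x) = scaleC (b * c) x"
    by (simp add: scaleC_vec_def Finite_Cartesian_Product.vec_eq_iff scaleC_scaleC)
  show "scaleC (complex_of_real r) x = scaleR r x"
    by (simp add: scaleC_vec_def Finite_Cartesian_Product.vec_eq_iff scaleC_complex_of_real)
  show "cinner y x = cnj (cinner x y)"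
    unfolding cinner_vec_def cnj_sum by (rule sum.cong[OF refl]) (rule cinner_commute)
  show "cinner (x + y) z = cinner x z + cinner y z"
    by (simp add: cinner_vec_def cinner_add_left sum.distrib)
  show "cinner (scaleC c x) y = c * cinner x y"
    by (simp add: cinner_vec_def scaleC_vec_def cinner_scaleC_left sum_distrib_left)
  have "(norm x)\<^sup>2 = (\<Sum>l\<in>UNIV. (norm (x $ l))\<^sup>2)"
    by (simp add: norm_vec_def L2_set_def sum_nonneg)
  then show "cinner x x = complex_of_real ((norm x)\<^sup>2)"
    by (simp add: cinner_vec_def cinner_self)
qed

end

definition infinite_dimensional :: "'h::real_vector itself \<Rightarrow> bool"
  where "infinite_dimensional _ \<longleftrightarrow> \<not> (\<exists>B :: 'h set. finite B \<and> Real_Vector_Spaces.span B = UNIV)"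

definition closed_csubspace :: "'h::complex_hilbert set \<Rightarrow> bool"
  where "closed_csubspace S \<longleftrightarrow> closed S \<and> Real_Vector_Spaces.subspace S \<and> (\<forall>c. \<forall>x\<in>S. scaleC c x \<in> S)"

text \<open>Bounded complex-linear operators are the complex-linear elements of the real
  bounded-operator type.\<close>

definition clinear_op :: "('h::complex_hilbert \<Rightarrow>\<^sub>L 'h) \<Rightarrow> bool"
  where "clinear_op A \<longleftrightarrow> (\<forall>c x. blinfun_apply A (scaleC c x) = scaleC c (blinfun_apply A x))"

section \<open>Holomorphic functions of several variables\<close>

definition holo :: "(complex ^ 'd) set \<Rightarrow> (complex ^ 'd \<Rightarrow> complex) set"
  where "holo \<Omega> = {f. \<forall>z\<in>\<Omega>. \<exists>f'. (f has_derivative f') (at z) \<and> (\<forall>c v. f' (c *s v) = c * f' v)}"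

text \<open>No holomorphic function ring extends simultaneously across a part of the boundary
  (Hoermander, An Introduction to Complex Analysis in Several Variables, Definition 2.5.1).
  As there, connectedness is not required.\<close>

definition domain_of_holomorphy :: "(complex ^ 'd) set \<Rightarrow> bool"
  where "domain_of_holomorphy \<Omega> \<longleftrightarrow> open \<Omega> \<and>
    \<not> (\<exists>\<Omega>1 \<Omega>2. open \<Omega>1 \<and> open \<Omega>2 \<and> \<Omega>1 \<noteq> {} \<and> \<Omega>1 \<subseteq> \<Omega>2 \<inter> \<Omega> \<and> connected \<Omega>2 \<and> \<not> \<Omega>2 \<subseteq> \<Omega> \<and>
         (\<forall>u\<in>holo \<Omega>. \<exists>v\<in>holo \<Omega>2. \<forall>z\<in>\<Omega>1. v z = u z))"

definition polydisc :: "(complex ^ 'm) set"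
  where "polydisc = {z. \<forall>l. cmod (z $ l) < 1}"

section \<open>The polyhedron\<close>

definition G_poly :: "(complex ^ 'd) set \<Rightarrow> ('m \<Rightarrow> complex ^ 'd \<Rightarrow> complex) \<Rightarrow> (complex ^ 'd) set"
  where "G_poly U \<delta> = {p\<in>U. \<forall>l. cmod (\<delta> l p) < 1}"

definition K_poly :: "(complex ^ 'd) set \<Rightarrow> ('m \<Rightarrow> complex ^ 'd \<Rightarrow> complex) \<Rightarrow> (complex ^ 'd) set"
  where "K_poly U \<delta> = {p\<in>U. \<forall>l. cmod (\<delta> l p) \<le> 1}"

section \<open>Generic tuples of matrices\<close>

definition vec_norm2 :: "complex Matrix.vec \<Rightarrow> real"
  where "vec_norm2 v = L2_set (\<lambda>i. cmod (Matrix.vec_index v i)) {..<dim_vec v}"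

definition op_norm :: "nat \<Rightarrow> complex mat \<Rightarrow> real"
  where "op_norm N A = (SUP v\<in>{v \<in> carrier_vec N. vec_norm2 v \<le> 1}. vec_norm2 (A *\<^sub>v v))"

text \<open>The basis of joint eigenvectors is indexed by the points of \<open>\<Lambda>\<close> themselves, which avoids an
  enumeration of \<open>\<Lambda>\<close>.\<close>

definition joint_eigenbasis ::
  "(complex ^ 'd) set \<Rightarrow> ('d \<Rightarrow> complex mat) \<Rightarrow> (complex ^ 'd \<Rightarrow> complex Matrix.vec) \<Rightarrow> bool"
  where "joint_eigenbasis \<Lambda> T k \<longleftrightarrow>
    inj_on k \<Lambda> \<and>
    vectorspace.basis class_ring (module_vec TYPE(complex) (card \<Lambda>)) (k ` \<Lambda>) \<and>
    (\<forall>p\<in>\<Lambda>. \<forall>r. T r *\<^sub>v k p = (p $ r) \<cdot>\<^sub>v k p)"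

definition generic_tuples :: "(complex ^ 'd) set \<Rightarrow> ('d \<Rightarrow> complex mat) set"
  where "generic_tuples \<Lambda> = {T.
    (\<forall>r. T r \<in> carrier_mat (card \<Lambda>) (card \<Lambda>)) \<and>
    (\<forall>r s. T r * T s = T s * T r) \<and>
    (\<exists>k. joint_eigenbasis \<Lambda> T k)}"

text \<open>\<open>g(T)\<close> for \<open>T\<close> in \<^term>\<open>generic_tuples \<Lambda>\<close>. The joint eigenspaces are one-dimensional, so all
  eigenbases give the same operator.\<close>

definition generic_apply ::
  "(complex ^ 'd) set \<Rightarrow> (complex ^ 'd \<Rightarrow> complex) \<Rightarrow> ('d \<Rightarrow> complex mat) \<Rightarrow> complex mat"
  where "generic_apply \<Lambda> g T = (THE A. A \<in> carrier_mat (card \<Lambda>) (card \<Lambda>) \<and>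
    (\<forall>k. joint_eigenbasis \<Lambda> T k \<longrightarrow> (\<forall>p\<in>\<Lambda>. A *\<^sub>v k p = g p \<cdot>\<^sub>v k p)))"

definition F_generic ::
  "('m \<Rightarrow> complex ^ 'd \<Rightarrow> complex) \<Rightarrow> (complex ^ 'd) set \<Rightarrow> ('d \<Rightarrow> complex mat) set"
  where "F_generic \<delta> \<Lambda> =
    {T \<in> generic_tuples \<Lambda>. \<forall>l. op_norm (card \<Lambda>) (generic_apply \<Lambda> (\<delta> l) T) \<le> 1}"

text \<open>A generic tuple \<open>T\<close> in \<^term>\<open>generic_tuples \<Lambda>\<close> has joint spectrum \<open>\<Lambda>\<close>, so the condition
  \<open>\<sigma>(T) \<subseteq> E\<close> reads \<open>\<Lambda> \<subseteq> E\<close>.\<close>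

definition generic_norm ::
  "(complex ^ 'd) set \<Rightarrow> ('m \<Rightarrow> complex ^ 'd \<Rightarrow> complex) \<Rightarrow> (complex ^ 'd) set \<Rightarrow>
   (complex ^ 'd \<Rightarrow> complex) \<Rightarrow> ennreal"
  where "generic_norm U \<delta> E f =
    (SUP (\<Lambda>, T) \<in> {(\<Lambda>, T). finite \<Lambda> \<and> \<Lambda> \<subseteq> G_poly U \<delta> \<and> T \<in> F_generic \<delta> \<Lambda> \<and> \<Lambda> \<subseteq> E}.
       ennreal (op_norm (card \<Lambda>) (generic_apply \<Lambda> f T)))"

definition Hinf_generic ::
  "(complex ^ 'd) set \<Rightarrow> ('m \<Rightarrow> complex ^ 'd \<Rightarrow> complex) \<Rightarrow> (complex ^ 'd) set \<Rightarrow>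
   (complex ^ 'd \<Rightarrow> complex) set"
  where "Hinf_generic U \<delta> E = {f. generic_norm U \<delta> E f < \<infinity>}"

section \<open>The cone of kernels\<close>

definition psd_kernel_on :: "'x set \<Rightarrow> ('x \<Rightarrow> 'x \<Rightarrow> complex) \<Rightarrow> bool"
  where "psd_kernel_on E a \<longleftrightarrow>
    (\<forall>(n::nat) (x :: nat \<Rightarrow> 'x) (c :: nat \<Rightarrow> complex). (\<forall>i<n. x i \<in> E) \<longrightarrow>
       (\<Sum>i<n. \<Sum>j<n. a (x i) (x j) * c i * cnj (c j)) \<in> \<real>\<^sub>\<ge>\<^sub>0)"

definition C_cone ::
  "('m::finite \<Rightarrow> complex ^ 'd \<Rightarrow> complex) \<Rightarrow> (complex ^ 'd) set \<Rightarrow>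
   (complex ^ 'd \<Rightarrow> complex ^ 'd \<Rightarrow> complex) set"
  where "C_cone \<delta> E = {h. \<exists>a. (\<forall>l. psd_kernel_on E (a l)) \<and>
    (\<forall>p\<in>E. \<forall>q\<in>E. h p q = (\<Sum>l\<in>UNIV. (1 - cnj (\<delta> l q) * \<delta> l p) * a l p q))}"

section \<open>Realizations\<close>

text \<open>The direct sum of the summands \<open>Ms l\<close>, each of which is a closed subspace of an ambient
  Hilbert space \<open>'h\<close>. Working with closed subspaces covers, up to isomorphism, all Hilbert
  spaces of dimension at most that of \<open>'h\<close>, including the finite-dimensional ones; the type
  variable \<open>'h\<close> thus plays the role of a universe and can be taken arbitrarily large.\<close>

definition direct_sum :: "('m::finite \<Rightarrow> 'h::complex_hilbert set) \<Rightarrow> ('h ^ 'm) set"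
  where "direct_sum Ms = {x. \<forall>l. x $ l \<in> Ms l}"

text \<open>\<open>D\<close> is a function on the ambient space that is only used on \<open>M\<close>.\<close>

definition bounded_operator_on :: "'h::complex_hilbert set \<Rightarrow> ('h \<Rightarrow> 'h) \<Rightarrow> bool"
  where "bounded_operator_on M D \<longleftrightarrow>
    (\<forall>x\<in>M. D x \<in> M) \<and>
    (\<forall>x\<in>M. \<forall>y\<in>M. D (x + y) = D x + D y) \<and>
    (\<forall>c. \<forall>x\<in>M. D (scaleC c x) = scaleC c (D x)) \<and>
    (\<exists>K. \<forall>x\<in>M. norm (D x) \<le> K * norm x)"

text \<open>\<open>V(c \<oplus> x) = (ac + \<langle>x, \<beta>\<rangle>) \<oplus> (c\<gamma> + Dx)\<close>; the library norm of a product type is the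
  Hilbert space norm of the direct sum.\<close>

definition colligation ::
  "complex \<Rightarrow> 'h::complex_hilbert \<Rightarrow> 'h \<Rightarrow> ('h \<Rightarrow> 'h) \<Rightarrow> complex \<times> 'h \<Rightarrow> complex \<times> 'h"
  where "colligation a \<beta> \<gamma> D = (\<lambda>(c, x). (a * c + cinner x \<beta>, scaleC c \<gamma> + D x))"

definition delta_op ::
  "('m::finite \<Rightarrow> complex ^ 'd \<Rightarrow> complex) \<Rightarrow> complex ^ 'd \<Rightarrow> 'h::complex_hilbert ^ 'm \<Rightarrow> 'h ^ 'm"
  where "delta_op \<delta> p x = (\<chi> l. scaleC (\<delta> l p) (x $ l))"

text \<open>Bijectivity on \<open>M\<close> makes \<open>(1 - D\<delta>(p))\<inverse>\<close> meaningful; boundedness of the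
  inverse is then automatic.\<close>

definition realization ::
  "('m::finite \<Rightarrow> complex ^ 'd \<Rightarrow> complex) \<Rightarrow> (complex ^ 'd) set \<Rightarrow> (complex ^ 'd \<Rightarrow> complex) \<Rightarrow>
   ('m \<Rightarrow> 'h::complex_hilbert set) \<Rightarrow> complex \<Rightarrow> 'h ^ 'm \<Rightarrow> 'h ^ 'm \<Rightarrow> ('h ^ 'm \<Rightarrow> 'h ^ 'm) \<Rightarrow> bool"
  where "realization \<delta> E f Ms a \<beta> \<gamma> D \<longleftrightarrow>
    (\<forall>l. closed_csubspace (Ms l)) \<and>
    (let M = direct_sum Ms in
       \<beta> \<in> M \<and> \<gamma> \<in> M \<and> bounded_operator_on M D \<and>
       (\<forall>c. \<forall>x\<in>M. norm (colligation a \<beta> \<gamma> D (c, x)) = norm (c, x)) \<and>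
       (\<forall>p\<in>E. let R = (\<lambda>x. x - D (delta_op \<delta> p x)) in
          bij_betw R M M \<and>
          f p = a + cinner (delta_op \<delta> p (inv_into M R \<gamma>)) \<beta>))"

definition has_realization ::
  "'h::complex_hilbert itself \<Rightarrow> ('m::finite \<Rightarrow> complex ^ 'd \<Rightarrow> complex) \<Rightarrow> (complex ^ 'd) set \<Rightarrow>
   (complex ^ 'd \<Rightarrow> complex) \<Rightarrow> bool"
  where "has_realization _ \<delta> E f \<longleftrightarrow>
    (\<exists>(Ms :: 'm \<Rightarrow> 'h set) a \<beta> \<gamma> D. realization \<delta> E f Ms a \<beta> \<gamma> D)"

section \<open>Taylor spectrum and holomorphic functional calculus\<close>

text \<open>The Koszul differential \<open>e_S \<otimes> x \<mapsto> (\<Sum>i. e_i \<and> e_S \<otimes> A_i x)\<close> on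
  \<open>\<Lambda>(\<complex>\<^sup>m) \<otimes> H\<close>. An element is represented by its coefficients with respect to the
  basis vectors \<open>e_S\<close>, \<open>S \<subseteq> 'm\<close>; the order on \<open>'m\<close> fixes the signs.\<close>

definition koszul ::
  "('m::{finite,linorder} \<Rightarrow> 'h \<Rightarrow> 'h) \<Rightarrow> ('m set \<Rightarrow> 'h) \<Rightarrow> 'm set \<Rightarrow> 'h::real_vector"
  where "koszul A \<phi> S = (\<Sum>i\<in>S. (-1) ^ card {j\<in>S. j < i} *\<^sub>R A i (\<phi> (S - {i})))"

definition taylor_spectrum ::
  "('m::{finite,linorder} \<Rightarrow> 'h::complex_hilbert \<Rightarrow>\<^sub>L 'h) \<Rightarrow>
   (complex ^ 'm::{finite,linorder}) set"
  where "taylor_spectrum T = {p.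
    let d = koszul (\<lambda>i x. blinfun_apply (T i) x - scaleC (p $ i) x)
    in {\<phi>. d \<phi> = (\<lambda>_. 0)} \<noteq> range d}"

text \<open>\<open>\<Phi>\<close> is the holomorphic functional calculus \<open>F \<mapsto> F(T)\<close> on the polydisc: the continuous
  unital algebra homomorphism from \<^term>\<open>holo polydisc\<close> (with the topology of locally uniform
  convergence, which is metrizable) to the bounded operators that sends the coordinate functions
  to \<open>T\<close>. It exists by Taylor's theorem if the Taylor spectrum of \<open>T\<close> is contained in
  the polydisc, and is unique since polynomials are dense. The continuity clause also shows that
  \<open>\<Phi> F\<close> depends only on the values of \<open>F\<close> on the polydisc.\<close>

definition functional_calculus ::
  "('m::finite \<Rightarrow> 'h::complex_hilbert \<Rightarrow>\<^sub>L 'h) \<Rightarrow> ((complex ^ 'm \<Rightarrow> complex) \<Rightarrow> 'h \<Rightarrow>\<^sub>L 'h) \<Rightarrow> bool"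
  where "functional_calculus T \<Phi> \<longleftrightarrow>
    (\<forall>F\<in>holo polydisc. clinear_op (\<Phi> F)) \<and>
    (\<forall>F\<in>holo polydisc. \<forall>G\<in>holo polydisc. \<Phi> (\<lambda>z. F z + G z) = \<Phi> F + \<Phi> G) \<and>
    (\<forall>F\<in>holo polydisc. \<forall>G\<in>holo polydisc. \<Phi> (\<lambda>z. F z * G z) = \<Phi> F o\<^sub>L \<Phi> G) \<and>
    (\<forall>c x. blinfun_apply (\<Phi> (\<lambda>_. c)) x = scaleC c x) \<and>
    (\<forall>l. \<Phi> (\<lambda>z. z $ l) = T l) \<and>
    (\<forall>F\<in>holo polydisc. \<forall>Fs. (\<forall>n. Fs n \<in> holo polydisc) \<longrightarrow>
       (\<forall>K\<subseteq>polydisc. compact K \<longrightarrow> uniform_limit K Fs F sequentially) \<longrightarrow>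
       (\<lambda>n. \<Phi> (Fs n)) \<longlonglongrightarrow> \<Phi> F)"

definition commuting_contractions :: "('m \<Rightarrow> 'h::complex_hilbert \<Rightarrow>\<^sub>L 'h) set"
  where "commuting_contractions = {T. (\<forall>l. clinear_op (T l)) \<and> (\<forall>l. norm (T l) \<le> 1) \<and>
    (\<forall>l k. T l o\<^sub>L T k = T k o\<^sub>L T l)}"

text \<open>\<open>\<parallel>F\<parallel>\<^sub>m\<close>; the operators act on the Hilbert space \<open>'h\<close>, and \<open>\<Phi>\<close> ranges over
  the (unique) functional calculus of \<open>T\<close>.\<close>

definition polydisc_norm ::
  "'h::complex_hilbert itself \<Rightarrow> (complex ^ 'm::{finite,linorder} \<Rightarrow> complex) \<Rightarrow> ennreal"
  where "polydisc_norm _ F =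
    (SUP (T, \<Phi>) \<in> {(T :: 'm \<Rightarrow> 'h \<Rightarrow>\<^sub>L 'h, \<Phi>). T \<in> commuting_contractions \<and>
                      taylor_spectrum T \<subseteq> polydisc \<and> functional_calculus T \<Phi>}.
       ennreal (norm (\<Phi> F)))"

definition Hinf_m ::
  "'h::complex_hilbert itself \<Rightarrow> (complex ^ 'm::{finite,linorder} \<Rightarrow> complex) set"
  where "Hinf_m h = {F \<in> holo polydisc. polydisc_norm h F < \<infinity>}"

end

theory Submission
  imports Defs
begin

text \<open>Call \<open>G\<close> admissible if it is a positive definite kernel on a finite subset of \<open>E\<close> for which
  all \<open>(1 - \<delta>\<^sub>l(\<lambda>) cnj \<delta>\<^sub>l(\<mu>)) G(\<lambda>, \<mu>)\<close> are positive semidefinite. Everything is compared with the condition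
  that \<open>(1 - f(\<lambda>) cnj f(\<mu>)) G(\<lambda>, \<mu>)\<close> is positive semidefinite for all admissible \<open>G\<close>. For the Gram matrix
  \<open>G\<close> of an eigenbasis of a generic tuple \<open>T\<close>, this says that \<open>\<parallel>f(T)\<parallel> \<le> 1\<close>, whence (a). It follows
  from (b) by the Schur product theorem. Conversely, on a finite set the residual of the best
  approximation of \<open>1 - f cnj f\<close> from the cone would be a separating functional and thus,
  after a small perturbation, a forbidden admissible kernel; Tychonoff's theorem passes to \<open>E\<close>.

  For (c), factor the kernels on a countable set whose image under \<open>\<delta>\<close> is dense in \<open>\<delta>(E)\<close>
  and extend the resulting lurking isometry; continuity of transfer functions reaches all of
  \<open>E\<close>. The converse is polarization. The transfer function \<open>F\<close> of the isometry serves in (d): it is a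
  locally uniform limit of transfer functions \<open>F\<^sub>n\<close> of finite truncations, and \<open>F\<^sub>n(T)\<close> is part of
  a scalar matrix contraction acting on vectors, so \<open>\<parallel>F\<^sub>n(T)\<parallel> \<le> 1\<close>. Finally, given (d), realize an
  admissible \<open>G\<close> by vectors in the Hilbert space and apply \<open>\<parallel>F\<parallel>\<^sub>m \<le> 1\<close> to the
  commuting operators that are diagonal in these vectors and vanish on their complement. A
  contracting homotopy of the Koszul complex locates their Taylor spectrum in the polydisc.\<close>

section \<open>Elementary Hilbert space facts\<close>

text \<open>\<open>'h\<close> is an arbitrary given infinite-dimensional Hilbert space, so a
  realization cannot be built on a kernel space whose size depends on \<open>E\<close>. The model
  space is a finite direct sum of copies of the closed span of one orthonormal sequence. This limits
  direct interpolation to countably many points, and it is the reason for the dense subset. A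
  partial isometry of that space extends to an isometry only if the complement of its range is large
  enough; keeping half of the sequence free guarantees this. The functional calculus accepts scalar
  functions only, whereas the state \<open>(1 - D z)^(-1) \<gamma>\<close> is a vector. Truncation
  replaces it by finitely many scalar coordinates, to which the homomorphism property applies.
  Admissible kernels are strictly positive because the eigenvectors of a generic tuple form a basis;
  hence the perturbation in the separation argument. In the step from (d), the operators may vanish
  on the complement of the eigenvectors because the origin lies in the polydisc: \<open>F(T)\<close>
  acts there as the scalar \<open>F 0\<close>.\<close>

lemma cinner_add_right: "cinner x (y + z) = cinner x y + cinner x (z::'a::complex_hilbert)"
  by (metis cinner_add_left cinner_commute complex_cnj_add)

lemma cinner_scaleC_right: "cinner x (scaleC c y) = cnj c * cinner x (y::'a::complex_hilbert)"
  by (metis cinner_scaleC_left cinner_commute complex_cnj_mult)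

lemma scaleC_one [simp]: "scaleC 1 x = (x::'a::complex_hilbert)"
  using scaleC_complex_of_real[of 1 x] by simp

lemma scaleC_zero_left [simp]: "scaleC 0 x = (0::'a::complex_hilbert)"
  using scaleC_complex_of_real[of 0 x] by simp

lemma scaleC_zero_right [simp]: "scaleC c (0::'a::complex_hilbert) = 0"
  using scaleC_add_right[of c 0 0] by simp

lemma scaleC_minus_left [simp]: "scaleC (- c) (x::'a::complex_hilbert) = - scaleC c x"
  using scaleC_add_left[of c "- c" x] by (simp add: add_eq_0_iff)

lemma scaleC_minus_right [simp]: "scaleC c (- x::'a::complex_hilbert) = - scaleC c x"
  using scaleC_add_right[of c x "- x"] by (simp add: add_eq_0_iff)

lemma scaleC_diff_right: "scaleC c (x - y::'a::complex_hilbert) = scaleC c x - scaleC c y"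
  using scaleC_add_right[of c x "- y"] by simp

lemma scaleC_diff_left: "scaleC (b - c) (x::'a::complex_hilbert) = scaleC b x - scaleC c x"
  using scaleC_add_left[of b "- c" x] by simp

lemma scaleC_sum_right: "scaleC c (\<Sum>i\<in>I. f i) = (\<Sum>i\<in>I. scaleC c (f i :: 'a::complex_hilbert))"
  by (induction I rule: infinite_finite_induct) (auto simp: scaleC_add_right)

lemma scaleC_scaleR: "scaleC c (scaleR r x) = scaleR r (scaleC c (x::'a::complex_hilbert))"
  by (metis mult.commute scaleC_complex_of_real scaleC_scaleC)

lemma cinner_zero_left [simp]: "cinner 0 (x::'a::complex_hilbert) = 0"
  using cinner_add_left[of 0 0 x] by simp

lemma cinner_zero_right [simp]: "cinner x (0::'a::complex_hilbert) = 0"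
  using cinner_add_right[of x 0 0] by simp

lemma cinner_minus_left [simp]: "cinner (- x) (y::'a::complex_hilbert) = - cinner x y"
  using cinner_add_left[of x "- x" y] by (simp add: add_eq_0_iff)

lemma cinner_minus_right [simp]: "cinner x (- y::'a::complex_hilbert) = - cinner x y"
  using cinner_add_right[of x y "- y"] by (simp add: add_eq_0_iff)

lemma cinner_diff_left: "cinner (x - y) (z::'a::complex_hilbert) = cinner x z - cinner y z"
  using cinner_add_left[of x "- y" z] by simp

lemma cinner_diff_right: "cinner z (x - y::'a::complex_hilbert) = cinner z x - cinner z y"
  using cinner_add_right[of z x "- y"] by simp

lemma cinner_sum_left: "cinner (\<Sum>i\<in>I. f i) (y::'a::complex_hilbert) = (\<Sum>i\<in>I. cinner (f i) y)"
  by (induction I rule: infinite_finite_induct) (auto simp: cinner_add_left)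

lemma cinner_sum_right: "cinner y (\<Sum>i\<in>I. f i :: 'a::complex_hilbert) = (\<Sum>i\<in>I. cinner y (f i))"
  by (induction I rule: infinite_finite_induct) (auto simp: cinner_add_right)

lemma cinner_scaleR_left: "cinner (scaleR r x) (y::'a::complex_hilbert) = of_real r * cinner x y"
  by (metis cinner_scaleC_left scaleC_complex_of_real)

lemmas cinner_linear =
  cinner_add_left cinner_add_right cinner_diff_left cinner_diff_right
  cinner_scaleC_left cinner_scaleC_right

lemma cinner_self_zero [simp]: "cinner x x = 0 \<longleftrightarrow> x = (0::'a::complex_hilbert)"
  by (simp add: cinner_self)

lemma norm_power2_cinner: "(norm (x::'a::complex_hilbert))\<^sup>2 = Re (cinner x x)"
  by (simp add: cinner_self)

lemma norm_scaleC [simp]: "norm (scaleC c (x::'a::complex_hilbert)) = cmod c * norm x"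
proof -
  have "of_real ((norm (scaleC c x))\<^sup>2) = c * cnj c * cinner x x"
    unfolding cinner_self[symmetric] by (simp add: cinner_linear)
  also have "\<dots> = of_real ((cmod c * norm x)\<^sup>2)"
    by (simp add: cinner_self power_mult_distrib complex_norm_square del: of_real_power)
  finally have "(norm (scaleC c x))\<^sup>2 = (cmod c * norm x)\<^sup>2"
    using of_real_eq_iff by blast
  then show ?thesis
    by (simp add: power2_eq_iff_nonneg)
qed

lemma norm_add_power2:
  "(norm (x + y::'a::complex_hilbert))\<^sup>2 = (norm x)\<^sup>2 + (norm y)\<^sup>2 + 2 * Re (cinner x y)"
  by (simp add: norm_power2_cinner cinner_linear cinner_commute[of y x])

lemma norm_add_orthogonal:
  "cinner x y = 0 \<Longrightarrow> (norm (x + y::'a::complex_hilbert))\<^sup>2 = (norm x)\<^sup>2 + (norm y)\<^sup>2"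
  by (simp add: norm_add_power2)

lemma norm_sum_orthogonal:
  fixes v :: "'i \<Rightarrow> 'a::complex_hilbert"
  assumes "finite I" "\<And>i j. i \<in> I \<Longrightarrow> j \<in> I \<Longrightarrow> i \<noteq> j \<Longrightarrow> cinner (v i) (v j) = 0"
  shows "(norm (\<Sum>i\<in>I. v i))\<^sup>2 = (\<Sum>i\<in>I. (norm (v i))\<^sup>2)"
  using assms
proof (induction I)
  case (insert i I)
  have "cinner (v i) (\<Sum>j\<in>I. v j) = (\<Sum>j\<in>I. 0)"
    unfolding cinner_sum_right using insert by (intro sum.cong) auto
  then have "(norm (v i + (\<Sum>j\<in>I. v j)))\<^sup>2 = (norm (v i))\<^sup>2 + (norm (\<Sum>j\<in>I. v j))\<^sup>2"
    by (intro norm_add_orthogonal) simp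
  then show ?case
    using insert by simp
qed auto

text \<open>Pythagoras: \<open>scaleC ?t y\<close> is the orthogonal projection of \<open>x\<close>
  onto the line through \<open>y\<close>, so its norm is at most that of \<open>x\<close>.\<close>

lemma cinner_norm_le: "cmod (cinner x y) \<le> norm x * norm (y::'a::complex_hilbert)"
proof (cases "y = 0")
  case False
  let ?t = "cinner x y / cinner y y"
  have "cinner (x - scaleC ?t y) (scaleC ?t y) = 0"
    using False cinner_commute[of y x] by (simp add: cinner_linear field_simps)
  then have "(norm ((x - scaleC ?t y) + scaleC ?t y))\<^sup>2 = (norm (x - scaleC ?t y))\<^sup>2 +
      (norm (scaleC ?t y))\<^sup>2"
    by (rule norm_add_orthogonal)
  then have "(norm (scaleC ?t y))\<^sup>2 \<le> (norm x)\<^sup>2"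
    by simp
  then have "norm (scaleC ?t y) \<le> norm x"
    by (rule power2_le_imp_le) simp
  moreover have "norm (scaleC ?t y) = cmod (cinner x y) / norm y"
    using False by (simp add: norm_divide cinner_self norm_mult power2_eq_square)
  ultimately have "cmod (cinner x y) / norm y \<le> norm x"
    by simp
  then show ?thesis
    using False by (simp add: divide_le_eq)
qed simp

lemma bounded_linear_cinner_left: "bounded_linear (\<lambda>x. cinner x (y::'a::complex_hilbert))"
  by (rule bounded_linear_intro[where K = "norm y"])
    (auto simp: cinner_add_left cinner_scaleR_left scaleR_conv_of_real cinner_norm_le)

lemma bounded_linear_scaleC: "bounded_linear (\<lambda>x. scaleC c (x::'a::complex_hilbert))"
  by (rule bounded_linear_intro[where K = "cmod c"])
    (auto simp: scaleC_add_right scaleC_scaleR mult.commute)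

lemma clinear_sum_scaleC:
  assumes "\<And>x y. A (x + y) = A x + A (y::'a::complex_hilbert)"
      "\<And>c x. A (scaleC c x) = scaleC c (A x)"
  shows "A (\<Sum>i\<in>I. scaleC (c i) (v i)) = (\<Sum>i\<in>I. scaleC (c i) (A (v i)) :: 'b::complex_hilbert)"
proof -
  have "A 0 = 0"
    using assms(2)[of 0 0] by simp
  then show ?thesis
    by (induction I rule: infinite_finite_induct) (auto simp: assms)
qed

text \<open>Polarization: \<open>c = 0\<close> equates the norms of \<open>x\<close> and
  \<open>x'\<close>, then \<open>c = 1\<close> and \<open>c = \<i>\<close> determine the real and
  imaginary part. It turns the isometry of a colligation into equality of Gram matrices.\<close>

lemma cinner_eq_of_norm_eq:
  fixes x y :: "'a::complex_hilbert" and x' y' :: "'b::complex_hilbert"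
  assumes "\<And>c. norm (x + scaleC c y) = norm (x' + scaleC c y')" "norm y = norm y'"
  shows "cinner x y = cinner x' y'"
proof -
  have "Re (cinner x (scaleC c y)) = Re (cinner x' (scaleC c y'))" for c
    using norm_add_power2[of x "scaleC c y"] norm_add_power2[of x' "scaleC c y'"]
      assms(1)[of c] assms(1)[of 0] assms(2) by simp
  from this[of 1] this[of \<i>] show ?thesis
    by (simp add: cinner_scaleC_right complex_eq_iff)
qed

section \<open>The scalars and products of two spaces as Hilbert spaces\<close>

instantiation complex :: complex_hilbert
begin

definition scaleC_complex :: "complex \<Rightarrow> complex \<Rightarrow> complex"
  where "scaleC_complex c x = c * x"

definition cinner_complex :: "complex \<Rightarrow> complex \<Rightarrow> complex"
  where "cinner_complex x y = x * cnj y"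

instance
  by standard (simp_all add: scaleC_complex_def cinner_complex_def algebra_simps scaleR_conv_of_real
      complex_norm_square del: of_real_power)

end

instantiation prod :: (complex_hilbert, complex_hilbert) complex_hilbert
begin

definition scaleC_prod :: "complex \<Rightarrow> 'a \<times> 'b \<Rightarrow> 'a \<times> 'b"
  where "scaleC_prod c x = (scaleC c (fst x), scaleC c (snd x))"

definition cinner_prod :: "'a \<times> 'b \<Rightarrow> 'a \<times> 'b \<Rightarrow> complex"
  where "cinner_prod x y = cinner (fst x) (fst y) + cinner (snd x) (snd y)"

instance
proof
  fix x y :: "'a \<times> 'b"
  show "cinner y x = cnj (cinner x y)"
    by (simp add: cinner_prod_def cinner_commute[of "fst y"] cinner_commute[of "snd y"])
qed (auto simp: scaleC_prod_def cinner_prod_def cinner_linear scaleC_add_right scaleC_add_left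
      scaleC_scaleC scaleC_complex_of_real algebra_simps cinner_self norm_prod_def simp flip:
          of_real_power of_real_add)

end

section \<open>Positive semidefinite kernels\<close>

lemma psd_kernel_onD:
  assumes "psd_kernel_on E a" "finite F" "x ` F \<subseteq> E"
  shows "(\<Sum>i\<in>F. \<Sum>j\<in>F. a (x i) (x j) * c i * cnj (c j)) \<in> \<real>\<^sub>\<ge>\<^sub>0"
proof -
  obtain g where g: "bij_betw g {..<card F} F"
    using assms(2) by (metis bij_betw_from_nat_into_finite)
  have "(\<Sum>i<card F. \<Sum>j<card F. a (x (g i)) (x (g j)) * c (g i) * cnj (c (g j))) \<in> \<real>\<^sub>\<ge>\<^sub>0"
    using assms g bij_betwE unfolding psd_kernel_on_def
    by (elim allE[of _ "card F"] allE[of _ "\<lambda>i. x (g i)"] allE[of _ "\<lambda>i. c (g i)"]) fastforce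
  also have "(\<Sum>i<card F. \<Sum>j<card F. a (x (g i)) (x (g j)) * c (g i) * cnj (c (g j)))
      = (\<Sum>i\<in>F. \<Sum>j\<in>F. a (x i) (x j) * c i * cnj (c j))"
    by (simp add: sum.reindex_bij_betw[OF g, where g = "\<lambda>j. a (x (g i)) (x j) * c (g i) * cnj (c j)"
        for i]
        sum.reindex_bij_betw[OF g, where g = "\<lambda>i. \<Sum>j\<in>F. a (x i) (x j) * c i * cnj (c j)"])
  finally show ?thesis .
qed

text \<open>The definition runs over families that may repeat points. Coefficients belonging to the
  same point can be added up, so finite sets of distinct points suffice.\<close>

lemma psd_kernel_on_iff:
  "psd_kernel_on E a \<longleftrightarrow>
    (\<forall>F c. finite F \<longrightarrow> F \<subseteq> E \<longrightarrow> (\<Sum>p\<in>F. \<Sum>q\<in>F. a p q * c p * cnj (c q)) \<in> \<real>\<^sub>\<ge>\<^sub>0)"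
proof
  assume "psd_kernel_on E a"
  then show "\<forall>F c. finite F \<longrightarrow> F \<subseteq> E \<longrightarrow> (\<Sum>p\<in>F. \<Sum>q\<in>F. a p q * c p * cnj (c q)) \<in> \<real>\<^sub>\<ge>\<^sub>0"
    using psd_kernel_onD[of E a _ "\<lambda>p. p"] by simp
next
  assume *: "\<forall>F c. finite F \<longrightarrow> F \<subseteq> E \<longrightarrow> (\<Sum>p\<in>F. \<Sum>q\<in>F. a p q * c p * cnj (c q)) \<in> \<real>\<^sub>\<ge>\<^sub>0"
  show "psd_kernel_on E a"
    unfolding psd_kernel_on_def
  proof (intro allI impI)
    fix n and x :: "nat \<Rightarrow> 'a" and c :: "nat \<Rightarrow> complex"
    assume x: "\<forall>i<n. x i \<in> E"
    let ?F = "x ` {..<n}" and ?c = "\<lambda>p. \<Sum>i\<in>{i\<in>{..<n}. x i = p}. c i"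
    have split: "(\<Sum>i<n. h (x i) * d i) = (\<Sum>p\<in>?F. h p * (\<Sum>i\<in>{i\<in>{..<n}. x i = p}. d i))"
      for h d :: "_ \<Rightarrow> complex"
      by (subst sum.image_gen[where g = x]) (auto simp: sum_distrib_left intro!: sum.cong)
    have "(\<Sum>i<n. \<Sum>j<n. a (x i) (x j) * c i * cnj (c j))
        = (\<Sum>i<n. (\<Sum>j<n. a (x i) (x j) * cnj (c j)) * c i)"
      by (simp add: sum_distrib_left sum_distrib_right mult_ac)
    also have "\<dots> = (\<Sum>p\<in>?F. (\<Sum>j<n. a p (x j) * cnj (c j)) * ?c p)"
      by (rule split)
    also have "\<dots> = (\<Sum>p\<in>?F. (\<Sum>q\<in>?F. a p q * cnj (?c q)) * ?c p)"
      using split[of "a _" "\<lambda>j. cnj (c j)"] by simp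
    also have "\<dots> = (\<Sum>p\<in>?F. \<Sum>q\<in>?F. a p q * ?c p * cnj (?c q))"
      by (subst sum_distrib_right) (simp add: mult_ac)
    also have "\<dots> \<in> \<real>\<^sub>\<ge>\<^sub>0"
      using * x by (auto simp del: cnj_sum)
    finally show "(\<Sum>i<n. \<Sum>j<n. a (x i) (x j) * c i * cnj (c j)) \<in> \<real>\<^sub>\<ge>\<^sub>0" .
  qed
qed

lemma psd_kernel_on_subset: "psd_kernel_on E a \<Longrightarrow> F \<subseteq> E \<Longrightarrow> psd_kernel_on F a"
  unfolding psd_kernel_on_def by blast

lemma psd_kernel_on_compose:
  assumes "psd_kernel_on E a" "g ` X \<subseteq> E"
  shows "psd_kernel_on X (\<lambda>i j. a (g i) (g j))"
  unfolding psd_kernel_on_def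
proof (intro allI impI)
  fix n and x :: "nat \<Rightarrow> 'b" and c :: "nat \<Rightarrow> complex"
  assume "\<forall>i<n. x i \<in> X"
  then have "\<forall>i<n. g (x i) \<in> E"
    using assms(2) by blast
  then show "(\<Sum>i<n. \<Sum>j<n. a (g (x i)) (g (x j)) * c i * cnj (c j)) \<in> \<real>\<^sub>\<ge>\<^sub>0"
    using assms(1)[unfolded psd_kernel_on_def, rule_format, of n "\<lambda>i. g (x i)" c] by simp
qed

lemma psd_kernel_on_cong:
  assumes "\<And>p q. p \<in> E \<Longrightarrow> q \<in> E \<Longrightarrow> a p q = b p q"
  shows "psd_kernel_on E a = psd_kernel_on E b"
proof -
  have "(\<Sum>i<n. \<Sum>j<n. a (x i) (x j) * c i * cnj (c j)) =
      (\<Sum>i<n. \<Sum>j<n. b (x i) (x j) * c i * cnj (c j))"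
    if "\<forall>i<n. x i \<in> E" for n and x :: "nat \<Rightarrow> 'a" and c :: "nat \<Rightarrow> complex"
    using that assms by (intro sum.cong) auto
  then show ?thesis
    unfolding psd_kernel_on_def by auto
qed

text \<open>Coefficients on a subset extend by zero, so the form over the whole finite set
  decides.\<close>

lemma psd_kernel_on_finite:
  assumes "finite E"
  shows "psd_kernel_on E a \<longleftrightarrow> (\<forall>c. (\<Sum>p\<in>E. \<Sum>q\<in>E. a p q * c p * cnj (c q)) \<in> \<real>\<^sub>\<ge>\<^sub>0)"
proof
  assume *: "\<forall>c. (\<Sum>p\<in>E. \<Sum>q\<in>E. a p q * c p * cnj (c q)) \<in> \<real>\<^sub>\<ge>\<^sub>0"
  have "(\<Sum>p\<in>F. \<Sum>q\<in>F. a p q * c p * cnj (c q)) \<in> \<real>\<^sub>\<ge>\<^sub>0" if "F \<subseteq> E" for F c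
  proof -
    define d where "d = (\<lambda>p. if p \<in> F then c p else 0)"
    have d: "d p = c p" if "p \<in> F" for p
      using that by (simp add: d_def)
    have d0: "d p = 0" if "p \<in> E - F" for p
      using that by (simp add: d_def)
    have "(\<Sum>p\<in>F. \<Sum>q\<in>F. a p q * c p * cnj (c q)) = (\<Sum>p\<in>F. \<Sum>q\<in>F. a p q * d p * cnj (d q))"
      by (intro sum.cong refl) (simp add: d)
    also have "\<dots> = (\<Sum>p\<in>F. \<Sum>q\<in>E. a p q * d p * cnj (d q))"
      using that assms by (intro sum.cong[OF refl] sum.mono_neutral_left) (simp_all add: d0)
    also have "\<dots> = (\<Sum>p\<in>E. \<Sum>q\<in>E. a p q * d p * cnj (d q))"
      using that assms by (intro sum.mono_neutral_left) (simp_all add: d0)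
    also have "\<dots> \<in> \<real>\<^sub>\<ge>\<^sub>0"
      by (rule *[rule_format])
    finally show ?thesis .
  qed
  then show "psd_kernel_on E a"
    unfolding psd_kernel_on_iff by blast
qed (use assms in \<open>auto simp: psd_kernel_on_iff\<close>)

lemma psd_kernel_on_add:
  assumes "psd_kernel_on E a" "psd_kernel_on E b"
  shows "psd_kernel_on E (\<lambda>p q. a p q + b p q)"
  using assms unfolding psd_kernel_on_def
  by (simp add: distrib_right sum.distrib nonneg_Reals_add_I)

lemma psd_kernel_on_scale:
  assumes "psd_kernel_on E a" "t \<in> \<real>\<^sub>\<ge>\<^sub>0"
  shows "psd_kernel_on E (\<lambda>p q. t * a p q)"
  using assms unfolding psd_kernel_on_def
  by (simp add: mult.assoc sum_distrib_left[symmetric] nonneg_Reals_mult_I)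

lemma psd_kernel_on_zero: "psd_kernel_on E (\<lambda>_ _. 0)"
  by (simp add: psd_kernel_on_def)

lemma sum_cinner_gram:
  fixes v :: "'i \<Rightarrow> 'a::complex_hilbert"
  shows "(\<Sum>i\<in>F. \<Sum>j\<in>F. cinner (v i) (v j) * c i * cnj (c j)) =
    of_real ((norm (\<Sum>i\<in>F. scaleC (c i) (v i)))\<^sup>2)"
  unfolding cinner_self[symmetric] cinner_sum_left
  by (simp add: cinner_sum_right cinner_linear mult_ac sum_distrib_left)

lemma psd_kernel_on_cinner: "psd_kernel_on E (\<lambda>p q. cinner (v p) (v q :: 'a::complex_hilbert))"
  unfolding psd_kernel_on_def sum_cinner_gram by simp

lemma psd_kernel_on_rank_one: "psd_kernel_on E (\<lambda>p q. v p * cnj (v q))"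
  using psd_kernel_on_cinner[of E v] by (simp add: cinner_complex_def)

section \<open>Consequences of positivity on one and two points\<close>

lemma psd_kernel_diag: "psd_kernel_on E a \<Longrightarrow> p \<in> E \<Longrightarrow> a p p \<in> \<real>\<^sub>\<ge>\<^sub>0"
  using psd_kernel_onD[of E a "{p}" "\<lambda>p. p" "\<lambda>_. 1"] by simp

lemma psd_kernel_form2:
  assumes "psd_kernel_on E a" "p \<in> E" "q \<in> E"
  shows "a p p * s * cnj s + a p q * s * cnj t + a q p * t * cnj s + a q q * t * cnj t \<in> \<real>\<^sub>\<ge>\<^sub>0"
  using psd_kernel_onD[OF assms(1), of "{0, 1::nat}" "\<lambda>i. if i = 0 then p else q"
      "\<lambda>i. if i = 0 then s else t"]
    assms(2,3) by (simp add: algebra_simps)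

text \<open>The two-point form is real at the coefficients \<open>(1, 1)\<close> and
  \<open>(1, \<i>)\<close>. As the diagonal is real, the first fact compares the imaginary parts of
  \<open>a p q\<close> and \<open>a q p\<close>, the second their real parts.\<close>

lemma psd_kernel_hermitian:
  assumes "psd_kernel_on E a" "p \<in> E" "q \<in> E"
  shows "a q p = cnj (a p q)"
  using psd_kernel_form2[OF assms, of 1 1] psd_kernel_form2[OF assms, of 1 \<i>]
    psd_kernel_diag[OF assms(1,2)] psd_kernel_diag[OF assms(1,3)]
  by (auto simp: complex_nonneg_Reals_iff complex_eq_iff)

lemma psd_kernel_cauchy_schwarz:
  assumes "psd_kernel_on E a" "p \<in> E" "q \<in> E"
  shows "(cmod (a p q))\<^sup>2 \<le> Re (a p p) * Re (a q q)"
proof -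
  let ?p = "Re (a p p)" and ?q = "Re (a q q)"
  have diag: "a p p = of_real ?p" "a q q = of_real ?q" "?p \<ge> 0" "?q \<ge> 0"
    using psd_kernel_diag[OF assms(1,2)] psd_kernel_diag[OF assms(1,3)]
    by (auto simp: complex_nonneg_Reals_iff complex_eq_iff)
  have qp: "a q p = cnj (a p q)"
    by (rule psd_kernel_hermitian[OF assms])
  have key: "0 \<le> ?p * (r * cmod (a p q))\<^sup>2 - 2 * r * (cmod (a p q))\<^sup>2 + ?q" for r
  proof -
    have "Re (a p p * s * cnj s + a p q * s * cnj 1 + cnj (a p q) * 1 * cnj s + a q q * 1 * cnj 1) \<ge>
        0" for s
      using psd_kernel_form2[OF assms, of s 1] unfolding qp complex_nonneg_Reals_iff by blast
    \<comment> \<open>This choice of \<open>s\<close> turns both cross terms into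
      \<open>- r * (cmod (a p q))\<^sup>2\<close> and leaves a real quadratic polynomial in
      \<open>r\<close>.\<close>
    from this[of "- of_real r * cnj (a p q)"]
    have *: "Re (of_real ?p * (- of_real r * cnj (a p q)) * cnj (- of_real r * cnj (a p q)) 
        + a p q * (- of_real r * cnj (a p q)) + cnj (a p q) * cnj (- of_real r * cnj (a p q))
            + of_real ?q) \<ge> 0"
      using diag(1,2) by simp
    have "(of_real ?p * (- of_real r * cnj (a p q)) * cnj (- of_real r * cnj (a p q)) 
        + a p q * (- of_real r * cnj (a p q)) + cnj (a p q) * cnj (- of_real r * cnj (a p q))
            + of_real ?q)
        = of_real ?p * of_real r ^2 * (a p q * cnj (a p q)) - 2 * of_real r * (a p q * cnj (a p q))
            + of_real ?q"
      by (simp add: algebra_simps power2_eq_square)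
    also have "\<dots> = of_real (?p * (r * cmod (a p q))\<^sup>2 - 2 * r * (cmod (a p q))\<^sup>2 + ?q)"
      unfolding complex_norm_square[symmetric] by (simp add: power_mult_distrib)
    finally show ?thesis
      using * by (metis Re_complex_of_real)
  qed
  show ?thesis
  proof (cases "?p = 0")
    case True
    have "cmod (a p q) = 0"
    proof (rule ccontr)
      assume "cmod (a p q) \<noteq> 0"
      \<comment> \<open>For \<open>?p = 0\<close> the polynomial is linear in \<open>r\<close>; the
        chosen value makes it equal to \<open>-1\<close>.\<close>
      then show False
        using key[of "(?q + 1) / (2 * (cmod (a p q))\<^sup>2)"] True by (simp add: field_simps)
    qed
    then show ?thesis
      using True by simp
  next
    case False
    \<comment> \<open>The value \<open>r = 1 / ?p\<close> minimizes the polynomial.\<close>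
    have "0 \<le> ?q - (cmod (a p q))\<^sup>2 / ?p"
      using key[of "1 / ?p"] False by (simp add: power2_eq_square)
    then show ?thesis
      using False diag(3) by (simp add: field_simps)
  qed
qed

text \<open>Bounds on the diagonal control the whole kernel. The sum is cruder than the geometric
  mean but avoids square roots; it defines the boxes that are compact by Tychonoff's
  theorem.\<close>

lemma psd_kernel_bound:
  assumes "psd_kernel_on E a" "p \<in> E" "q \<in> E" "Re (a p p) \<le> B p" "Re (a q q) \<le> B q"
  shows "cmod (a p q) \<le> B p + B q"
proof -
  have nonneg: "Re (a p p) \<ge> 0" "Re (a q q) \<ge> 0"
    using psd_kernel_diag[OF assms(1)] assms(2,3) by (auto simp: complex_nonneg_Reals_iff)
  have "(cmod (a p q))\<^sup>2 \<le> Re (a p p) * Re (a q q)"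
    by (rule psd_kernel_cauchy_schwarz[OF assms(1-3)])
  also have "\<dots> \<le> (Re (a p p) + Re (a q q))\<^sup>2"
    using mult_nonneg_nonneg[OF nonneg] by (simp add: power2_sum)
  finally have "cmod (a p q) \<le> Re (a p p) + Re (a q q)"
    by (rule power2_le_imp_le) (use nonneg in simp)
  then show ?thesis
    using assms(4,5) by linarith
qed

text \<open>Cholesky decomposition by iterated Schur complements. When a pivot vanishes, so does its row, and
  division by zero yields the correct zero column of the factor.\<close>

definition schur_step :: "nat \<Rightarrow> (nat \<Rightarrow> nat \<Rightarrow> complex) \<Rightarrow> nat \<Rightarrow> nat \<Rightarrow> complex" where
  "schur_step k a i j = a i j - a i k * a k j / a k k"

primrec schur_iter :: "(nat \<Rightarrow> nat \<Rightarrow> complex) \<Rightarrow> nat \<Rightarrow> nat \<Rightarrow> nat \<Rightarrow> complex" where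
  "schur_iter a 0 = a"
| "schur_iter a (Suc k) = schur_step k (schur_iter a k)"

definition cholesky :: "(nat \<Rightarrow> nat \<Rightarrow> complex) \<Rightarrow> nat \<Rightarrow> nat \<Rightarrow> complex" where
  "cholesky a i k = schur_iter a k i k / of_real (sqrt (Re (schur_iter a k k k)))"

text \<open>The form of the Schur complement at \<open>c\<close> is the form of \<open>a\<close> at
  \<open>c\<close> augmented by the minimizing coefficient at \<open>k\<close>, which is
  \<open>- s / a k k\<close>.\<close>

lemma psd_kernel_schur_step:
  assumes "psd_kernel_on UNIV a"
  shows "psd_kernel_on UNIV (schur_step k a)"
proof (cases "a k k = 0")
  case True
  then have "schur_step k a = a"
    by (simp add: schur_step_def fun_eq_iff)
  then show ?thesis using assms by simp
next
  case False
  have herm: "a j i = cnj (a i j)" for i j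
    using psd_kernel_hermitian[OF assms] by blast
  have nonneg: "(\<Sum>i\<in>F. \<Sum>j\<in>F. (a i j - a i k * a k j / a k k) * c i * cnj (c j)) \<in> \<real>\<^sub>\<ge>\<^sub>0"
    if F: "finite F" for F and c :: "nat \<Rightarrow> complex"
  proof -
    define s where "s = (\<Sum>i\<in>F. a i k * c i)"
    \<comment> \<open>\<open>None\<close> is an extra copy of \<open>k\<close>. It keeps the new
      coefficient apart from \<open>c k\<close> when \<open>k\<close> already lies in
      \<open>F\<close>; positivity permits repeated points.\<close>
    define x where "x = (\<lambda>i. case i of None \<Rightarrow> k | Some i \<Rightarrow> i)"
    define d where "d = (\<lambda>i. case i of None \<Rightarrow> - s / a k k | Some i \<Rightarrow> c i)"
    have cnj_s: "(\<Sum>j\<in>F. a k j * cnj (c j)) = cnj s"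
      unfolding s_def cnj_sum by (intro sum.cong refl) (metis complex_cnj_mult herm)
    have ins: "(\<Sum>i\<in>insert None (Some ` F). g i) = g None + (\<Sum>i\<in>F. g (Some i))"
      for g :: "nat option \<Rightarrow> complex"
      using F by (simp add: sum.reindex)
    have "(\<Sum>i\<in>insert None (Some ` F). \<Sum>j\<in>insert None (Some ` F). a (x i) (x j) * d i * cnj (d j)) \<in>
        \<real>\<^sub>\<ge>\<^sub>0"
      using F by (intro psd_kernel_onD[OF assms]) auto
    also have "(\<Sum>i\<in>insert None (Some ` F). \<Sum>j\<in>insert None (Some ` F). a (x i) (x j) * d i * cnj
        (d j))
       = a k k * d None * cnj (d None) + (\<Sum>j\<in>F. a k j * d None * cnj (c j))
         + ((\<Sum>i\<in>F. a i k * c i * cnj (d None)) + (\<Sum>i\<in>F. \<Sum>j\<in>F. a i j * c i * cnj (c j)))"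
      unfolding ins sum.distrib by (simp only: x_def d_def option.case add.assoc add.left_commute)
    also have "(\<Sum>j\<in>F. a k j * d None * cnj (c j)) = d None * (\<Sum>j\<in>F. a k j * cnj (c j))"
      by (simp only: sum_distrib_left mult.assoc mult.left_commute)
    also have "\<dots> = d None * cnj s"
      by (simp only: cnj_s)
    also have "(\<Sum>i\<in>F. a i k * c i * cnj (d None)) = s * cnj (d None)"
      by (simp only: s_def sum_distrib_right)
    also have "cnj (d None) = - cnj s / a k k"
      using herm[of k k] by (simp add: d_def)
    also have "d None = - s / a k k"
      by (simp add: d_def)
    also have "a k k * (- s / a k k) * (- cnj s / a k k) + - s / a k k * cnj s
        + (s * (- cnj s / a k k) + (\<Sum>i\<in>F. \<Sum>j\<in>F. a i j * c i * cnj (c j)))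
      = (\<Sum>i\<in>F. \<Sum>j\<in>F. a i j * c i * cnj (c j)) - s * cnj s / a k k"
      using False by (simp add: add_divide_distrib)
    also have "s * cnj s / a k k = (\<Sum>i\<in>F. \<Sum>j\<in>F. a i k * a k j / a k k * c i * cnj (c j))"
      unfolding cnj_s[symmetric] unfolding s_def sum_product sum_divide_distrib
      by (intro sum.cong refl) simp
    also have "(\<Sum>i\<in>F. \<Sum>j\<in>F. a i j * c i * cnj (c j)) - \<dots>
        = (\<Sum>i\<in>F. \<Sum>j\<in>F. (a i j - a i k * a k j / a k k) * c i * cnj (c j))"
      unfolding sum_subtractf[symmetric] left_diff_distrib ..
    finally show ?thesis .
  qed
  show ?thesis
    unfolding psd_kernel_on_iff schur_step_def by (intro allI impI) (rule nonneg)
qed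

lemma psd_schur_iter:
  "psd_kernel_on UNIV a \<Longrightarrow> psd_kernel_on UNIV (schur_iter a k)"
  by (induction k) (simp_all add: psd_kernel_schur_step)

text \<open>Step \<open>k\<close> clears row and column \<open>k\<close> and preserves those cleared
  before. For a vanishing pivot nothing is subtracted, but then Cauchy-Schwarz shows that its row
  and column are zero already.\<close>

lemma schur_iter_zero:
  assumes "psd_kernel_on UNIV a" "i < k \<or> j < k"
  shows "schur_iter a k i j = 0"
  using assms(2)
proof (induction k arbitrary: i j)
  case (Suc k)
  let ?b = "schur_iter a k"
  have psd: "psd_kernel_on UNIV ?b"
    using psd_schur_iter[OF assms(1)] .
  have herm: "?b j i = cnj (?b i j)" for i j
    using psd_kernel_hermitian[OF psd] by blast
  show ?case
  proof (cases "i < k \<or> j < k")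
    case True
    then show ?thesis using Suc.IH by (auto simp: schur_step_def)
  next
    case False
    then have ij: "i = k \<or> j = k"
      using Suc.prems by auto
    show ?thesis
    proof (cases "?b k k = 0")
      case True
      then have "?b i k = 0" "?b k j = 0"
        using psd_kernel_cauchy_schwarz[OF psd, of i k] psd_kernel_cauchy_schwarz[OF psd, of k j]
            by auto
      then show ?thesis
        using ij by (elim disjE) (simp_all add: schur_step_def)
    next
      case False
      then show ?thesis
        using ij by (elim disjE) (simp_all add: schur_step_def)
    qed
  qed
qed simp

lemma cholesky_upper: "psd_kernel_on UNIV a \<Longrightarrow> i < k \<Longrightarrow> cholesky a i k = 0"
  using schur_iter_zero[of a i k k] by (simp add: cholesky_def)

lemma cholesky_mult:
  assumes "psd_kernel_on UNIV a"
  shows "cholesky a i k * cnj (cholesky a j k)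
      = schur_iter a k i k * schur_iter a k k j / schur_iter a k k k"
proof -
  let ?b = "schur_iter a k"
  have psd: "psd_kernel_on UNIV ?b"
    using psd_schur_iter[OF assms(1)] .
  have kk: "?b k k = of_real (Re (?b k k))" "Re (?b k k) \<ge> 0"
    using psd_kernel_diag[OF psd, of k] by (auto simp: complex_nonneg_Reals_iff complex_eq_iff)
  define s where "s = complex_of_real (sqrt (Re (?b k k)))"
  have "s * s = ?b k k"
    unfolding s_def of_real_mult[symmetric] real_sqrt_mult_self abs_of_nonneg[OF kk(2)] by
        (rule kk(1)[symmetric])
  moreover have "cnj s = s"
    by (simp add: s_def)
  moreover have "cnj (?b j k) = ?b k j"
    using psd_kernel_hermitian[OF psd, of j k] by simp
  ultimately show ?thesis
    unfolding cholesky_def s_def[symmetric] by (metis complex_cnj_divide times_divide_times_eq)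
qed

text \<open>Each step subtracts the rank-one kernel of one column of the factor, so the sum
  telescopes up to the remainder \<open>schur_iter a n i j\<close>. This vanishes as soon as one of
  the two indices is below \<open>n\<close>.\<close>

theorem cholesky_decomposition:
  assumes "psd_kernel_on UNIV a" "min i j < n"
  shows "a i j = (\<Sum>k<n. cholesky a i k * cnj (cholesky a j k))"
proof -
  have "a i j = (\<Sum>k<n. cholesky a i k * cnj (cholesky a j k)) + schur_iter a n i j" for n
    by (induction n) (auto simp: cholesky_mult[OF assms(1)] schur_step_def)
  moreover have "schur_iter a n i j = 0"
    using assms by (intro schur_iter_zero) auto
  ultimately show ?thesis
    by (metis add.right_neutral)
qed

lemma psd_kernel_finite_factorization:
  assumes "finite F" "psd_kernel_on F a"
  obtains v :: "'x \<Rightarrow> nat \<Rightarrow> complex"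
  where "\<And>p q. p \<in> F \<Longrightarrow> q \<in> F \<Longrightarrow> a p q = (\<Sum>k<card F. v p k * cnj (v q k))"
proof (cases "F = {}")
  case False
  obtain g where g: "bij_betw g F {..<card F}"
    using ex_bij_betw_finite_nat[OF assms(1)] by (auto simp: atLeast0LessThan)
  \<comment> \<open>The enumeration is continued by an arbitrary point of \<open>F\<close>, so that
    the pulled-back kernel is positive semidefinite on all natural numbers.\<close>
  define h where "h = (\<lambda>i. if i < card F then inv_into F g i else (SOME p. p \<in> F))"
  have h: "h ` UNIV \<subseteq> F"
    using bij_betwE[OF bij_betw_inv_into[OF g]] False by (auto simp: h_def some_in_eq)
  have gl: "g p < card F" if "p \<in> F" for p
    using bij_betwE[OF g] that by auto
  have hg: "h (g p) = p" if "p \<in> F" for p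
    using g gl[OF that] that by (simp add: h_def bij_betw_inv_into_left)
  let ?b = "\<lambda>i j. a (h i) (h j)"
  have "psd_kernel_on UNIV ?b"
    using psd_kernel_on_compose[OF assms(2) h] .
  then have "?b (g p) (g q) = (\<Sum>k<card F. cholesky ?b (g p) k * cnj (cholesky ?b (g q) k))"
    if "p \<in> F" "q \<in> F" for p q
    using gl[OF that(1)] that by (intro cholesky_decomposition) (auto simp: min_less_iff_disj)
  then show thesis
    using that[of "\<lambda>p. cholesky ?b (g p)"] hg by simp
qed (use that in simp)

section \<open>The Schur product theorem\<close>

lemma sum_nonneg_Reals: "(\<And>i. i \<in> I \<Longrightarrow> f i \<in> \<real>\<^sub>\<ge>\<^sub>0) \<Longrightarrow> sum f I \<in> \<real>\<^sub>\<ge>\<^sub>0"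
  by (induction I rule: infinite_finite_induct) (auto intro: nonneg_Reals_add_I)

text \<open>On a finite set \<open>a\<close> is a sum of rank-one kernels
  \<open>v p k * cnj (v q k)\<close>, and multiplying \<open>b\<close> by one of these merely
  rescales the coefficients in the form of \<open>b\<close>.\<close>

theorem psd_kernel_on_mult:
  assumes "psd_kernel_on E a" "psd_kernel_on E b"
  shows "psd_kernel_on E (\<lambda>p q. a p q * b p q)"
proof -
  have "(\<Sum>p\<in>F. \<Sum>q\<in>F. a p q * b p q * c p * cnj (c q)) \<in> \<real>\<^sub>\<ge>\<^sub>0" if F: "finite F" "F \<subseteq> E" for F c
  proof -
    obtain v :: "_ \<Rightarrow> nat \<Rightarrow> complex"
      where v: "\<And>p q. p \<in> F \<Longrightarrow> q \<in> F \<Longrightarrow> a p q = (\<Sum>k<card F. v p k * cnj (v q k))"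
      using psd_kernel_finite_factorization[OF F(1) psd_kernel_on_subset[OF assms(1) F(2)]] by blast
    have "(\<Sum>p\<in>F. \<Sum>q\<in>F. a p q * b p q * c p * cnj (c q))
        = (\<Sum>p\<in>F. \<Sum>q\<in>F. \<Sum>k<card F. b p q * (v p k * c p) * cnj (v q k * c q))"
      by (intro sum.cong refl) (simp add: v sum_distrib_left sum_distrib_right mult_ac)
    also have "\<dots> = (\<Sum>p\<in>F. \<Sum>k<card F. \<Sum>q\<in>F. b p q * (v p k * c p) * cnj (v q k * c q))"
      by (intro sum.cong refl sum.swap)
    also have "\<dots> = (\<Sum>k<card F. \<Sum>p\<in>F. \<Sum>q\<in>F. b p q * (v p k * c p) * cnj (v q k * c q))"
      by (rule sum.swap)
    also have "\<dots> \<in> \<real>\<^sub>\<ge>\<^sub>0"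
      using F(2) by (intro sum_nonneg_Reals[of "{..<card F}"]
          psd_kernel_onD[OF assms(2) F(1), of "\<lambda>p. p"]) simp
    finally show ?thesis .
  qed
  then show ?thesis
    unfolding psd_kernel_on_iff by blast
qed

section \<open>Orthogonal expansions\<close>

lemma cinner_zero_sym: "cinner x y = 0 \<Longrightarrow> cinner y (x::'a::complex_hilbert) = 0"
  by (metis cinner_commute complex_cnj_zero)

definition orthonormal_or_zero :: "(nat \<Rightarrow> 'a::complex_hilbert) \<Rightarrow> bool" where
  "orthonormal_or_zero q \<longleftrightarrow>
    (\<forall>i j. i \<noteq> j \<longrightarrow> cinner (q i) (q j) = 0) \<and> (\<forall>i. norm (q i) = 1 \<or> q i = 0)"

text \<open>If corresponding norms agree, this is the partial isometry taking \<open>q k\<close> to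
  \<open>q' k\<close>; for \<open>q' = q\<close> it is the orthogonal projection onto the closed
  span of \<open>q\<close>.\<close>

definition osum :: "(nat \<Rightarrow> 'a::complex_hilbert) \<Rightarrow> (nat \<Rightarrow> 'b::complex_hilbert) \<Rightarrow> 'a \<Rightarrow> 'b" where
  "osum q q' b = (\<Sum>k. scaleC (cinner b (q k)) (q' k))"

lemma orthonormal_or_zeroD:
  assumes "orthonormal_or_zero q"
  shows "i \<noteq> j \<Longrightarrow> cinner (q i) (q j) = 0" "norm (q i) = 1 \<or> q i = 0"
  using assms unfolding orthonormal_or_zero_def by blast+

lemma orthonormal_or_zero_mult_self:
  assumes "orthonormal_or_zero q"
  shows "cinner b (q k) * cinner (q k) (q k) = cinner b (q k)"
    and "(cmod (cinner b (q k)))\<^sup>2 * (norm (q k))\<^sup>2 = (cmod (cinner b (q k)))\<^sup>2"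
  using orthonormal_or_zeroD(2)[OF assms, of k] by (auto simp: cinner_self)

lemma norm_sum_orthonormal:
  assumes "orthonormal_or_zero q" "finite I"
  shows "(norm (\<Sum>k\<in>I. scaleC (c k) (q k)))\<^sup>2 = (\<Sum>k\<in>I. (cmod (c k))\<^sup>2 * (norm (q k))\<^sup>2)"
  using assms orthonormal_or_zeroD(1)[OF assms(1)]
  by (subst norm_sum_orthogonal) (auto simp: cinner_linear power_mult_distrib)

lemma bessel_finite:
  assumes "orthonormal_or_zero q"
  shows "(\<Sum>k<n. (cmod (cinner b (q k)))\<^sup>2) \<le> (norm b)\<^sup>2"
proof -
  define p where "p = (\<Sum>k<n. scaleC (cinner b (q k)) (q k))"
  have "cinner (b - p) (q j) = 0" if "j < n" for j
  proof -
    have "cinner p (q j) = (\<Sum>k<n. if k = j then cinner b (q j) else 0)"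
      unfolding p_def cinner_sum_left cinner_scaleC_left
      using orthonormal_or_zeroD(1)[OF assms] orthonormal_or_zero_mult_self(1)[OF assms]
      by (intro sum.cong) auto
    then show ?thesis
      using that by (simp add: cinner_diff_left)
  qed
  then have "cinner (b - p) p = 0"
    by (subst (2) p_def) (simp add: cinner_sum_right cinner_scaleC_right)
  then have "(norm b)\<^sup>2 = (norm (b - p))\<^sup>2 + (norm p)\<^sup>2"
    using norm_add_orthogonal[of "b - p" p] by simp
  moreover have "(norm p)\<^sup>2 = (\<Sum>k<n. (cmod (cinner b (q k)))\<^sup>2)"
    unfolding p_def norm_sum_orthonormal[OF assms finite_lessThan]
    by (simp add: orthonormal_or_zero_mult_self(2)[OF assms])
  ultimately show ?thesis
    by simp
qed

lemma bessel_summable: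
  assumes "orthonormal_or_zero q"
  shows "summable (\<lambda>k. (cmod (cinner b (q k)))\<^sup>2)"
  using bessel_finite[OF assms] by (intro bounded_imp_summable[where B = "(norm b)\<^sup>2"])
    (auto simp: lessThan_Suc_atMost[symmetric] simp del: sum.lessThan_Suc)

lemma summable_orthonormal:
  assumes "orthonormal_or_zero q" "summable (\<lambda>k. (cmod (c k))\<^sup>2)"
  shows "summable (\<lambda>k. scaleC (c k) (q k))"
  unfolding summable_Cauchy
proof (intro allI impI)
  fix e :: real assume "0 < e"
  then obtain N where N: "\<And>m n. m \<ge> N \<Longrightarrow> norm (\<Sum>k\<in>{m..<n}. (cmod (c k))\<^sup>2) < e\<^sup>2"
    using assms(2)[unfolded summable_Cauchy, rule_format, of "e\<^sup>2"] by auto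
  have "norm (\<Sum>k\<in>{m..<n}. scaleC (c k) (q k)) < e" if "m \<ge> N" for m n
  proof -
    have "(norm (\<Sum>k\<in>{m..<n}. scaleC (c k) (q k)))\<^sup>2 \<le> (\<Sum>k\<in>{m..<n}. (cmod (c k))\<^sup>2)"
      unfolding norm_sum_orthonormal[OF assms(1) finite_atLeastLessThan]
    proof (intro sum_mono)
      fix k
      show "(cmod (c k))\<^sup>2 * (norm (q k))\<^sup>2 \<le> (cmod (c k))\<^sup>2"
        using orthonormal_or_zeroD(2)[OF assms(1), of k] by (elim disjE) simp_all
    qed
    also have "\<dots> < e\<^sup>2"
      using N[OF that, of n] by simp
    finally show ?thesis
      using \<open>0 < e\<close> by (simp add: power2_less_imp_less)
  qed
  then show "\<exists>N. \<forall>m\<ge>N. \<forall>n. norm (\<Sum>k\<in>{m..<n}. scaleC (c k) (q k)) < e"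
    by blast
qed

lemma summable_osum:
  "orthonormal_or_zero q \<Longrightarrow> orthonormal_or_zero q' \<Longrightarrow> summable (\<lambda>k. scaleC (cinner b (q k)) (q' k))"
  by (intro summable_orthonormal bessel_summable)

lemma osum_sums:
  "orthonormal_or_zero q \<Longrightarrow> orthonormal_or_zero q' \<Longrightarrow>
    (\<lambda>n. \<Sum>k<n. scaleC (cinner b (q k)) (q' k)) \<longlonglongrightarrow> osum q q' b"
  unfolding osum_def by (intro summable_LIMSEQ summable_osum)

lemma osum_add:
  assumes "orthonormal_or_zero q" "orthonormal_or_zero q'"
  shows "osum q q' (b + c) = osum q q' b + osum q q' c"
  unfolding osum_def by (subst suminf_add)
      (auto intro!: summable_osum assms simp: cinner_linear scaleC_add_left)

lemma osum_scaleC: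
  assumes "orthonormal_or_zero q" "orthonormal_or_zero q'"
  shows "osum q q' (scaleC t b) = scaleC t (osum q q' b)"
  unfolding osum_def by (subst bounded_linear.suminf[OF bounded_linear_scaleC
      summable_osum[OF assms]])
    (simp add: cinner_scaleC_left scaleC_scaleC)

lemma cinner_osum:
  assumes "orthonormal_or_zero q" "orthonormal_or_zero q'"
  shows "cinner (osum q q' b) v = (\<Sum>k. cinner b (q k) * cinner (q' k) v)"
  unfolding osum_def
  by (subst bounded_linear.suminf[OF bounded_linear_cinner_left summable_osum[OF assms]])
    (simp add: cinner_scaleC_left)

lemma summable_cinner_osum:
  assumes "orthonormal_or_zero q" "orthonormal_or_zero q'"
  shows "summable (\<lambda>k. cinner b (q k) * cinner (q' k) v)"
  using bounded_linear.summable[OF bounded_linear_cinner_left summable_osum[OF assms]]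
  by (simp add: cinner_scaleC_left)

lemma osum_adjoint:
  assumes "orthonormal_or_zero q" "orthonormal_or_zero q'"
  shows "cinner (osum q q' b) v = cinner b (osum q' q v)"
proof -
  have "cinner b (osum q' q v) = cnj (\<Sum>k. cinner v (q' k) * cinner (q k) b)"
    by (subst cinner_commute) (simp add: cinner_osum[OF assms(2,1)])
  also have "\<dots> = (\<Sum>k. cnj (cinner v (q' k) * cinner (q k) b))"
    by (rule bounded_linear.suminf[OF bounded_linear_cnj summable_cinner_osum[OF assms(2,1)]])
  also have "\<dots> = (\<Sum>k. cinner b (q k) * cinner (q' k) v)"
    by (simp add: cinner_commute[symmetric] mult.commute)
  finally show ?thesis
    by (simp add: cinner_osum[OF assms])
qed

lemma cinner_osum_orthogonal:
  assumes "orthonormal_or_zero q" "orthonormal_or_zero q'" "\<And>k. cinner (q' k) v = 0"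
  shows "cinner (osum q q' b) v = 0"
  unfolding cinner_osum[OF assms(1,2)] by (simp add: assms(3))

lemma cinner_osum_basis:
  assumes "orthonormal_or_zero q" "orthonormal_or_zero q'" "\<And>k. norm (q k) = norm (q' k)"
  shows "cinner (osum q q' b) (q' j) = cinner b (q j)"
proof -
  have "cinner (osum q q' b) (q' j) = (\<Sum>k\<in>{j}. cinner b (q k) * cinner (q' k) (q' j))"
    unfolding cinner_osum[OF assms(1,2)]
    using orthonormal_or_zeroD(1)[OF assms(2)] by (intro suminf_finite) auto
  also have "\<dots> = cinner b (q j) * cinner (q j) (q j)"
    using assms(3)[of j] by (simp add: cinner_self)
  finally show ?thesis
    by (simp add: orthonormal_or_zero_mult_self[OF assms(1)])
qed

lemma osum_idem:
  assumes "orthonormal_or_zero q"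
  shows "osum q q (osum q q b) = osum q q b"
  unfolding osum_def[of q q "osum q q b"] cinner_osum_basis[OF assms(1,1) refl] 
  unfolding osum_def ..

text \<open>\<open>osum q' q\<close> is the adjoint of \<open>osum q q'\<close>, and their composite
  is the projection \<open>osum q q\<close>.\<close>

lemma norm_osum:
  assumes "orthonormal_or_zero q" "orthonormal_or_zero q'" "\<And>k. norm (q k) = norm (q' k)"
  shows "norm (osum q q' b) = norm (osum q q b)"
proof -
  have "osum q' q (osum q q' b) = osum q q b"
    unfolding osum_def[of q' q] osum_def[of q q] cinner_osum_basis[OF assms] ..
  then have "cinner (osum q q' b) (osum q q' b) = cinner b (osum q q b)"
    using osum_adjoint[OF assms(1,2)] by simp
  moreover have "cinner (osum q q b) (osum q q b) = cinner b (osum q q b)"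
    using osum_adjoint[OF assms(1,1)] by (simp add: osum_idem[OF assms(1)])
  ultimately have "(norm (osum q q' b))\<^sup>2 = (norm (osum q q b))\<^sup>2"
    by (simp add: norm_power2_cinner)
  then show ?thesis
    by simp
qed

lemma osum_pythagoras:
  assumes "orthonormal_or_zero q"
  shows "(norm b)\<^sup>2 = (norm (osum q q b))\<^sup>2 + (norm (b - osum q q b))\<^sup>2"
proof -
  have "cinner (osum q q b) (b - osum q q b) = 0"
    using osum_adjoint[OF assms assms, of b "osum q q b"] osum_adjoint[OF assms assms, of b b]
    by (simp add: cinner_diff_right osum_idem[OF assms])
  from norm_add_orthogonal[OF this] show ?thesis
    by simp
qed

lemma norm_osum_le:
  assumes "orthonormal_or_zero q" "orthonormal_or_zero q'" "\<And>k. norm (q k) = norm (q' k)"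
  shows "norm (osum q q' b) \<le> norm b"
  unfolding norm_osum[OF assms] using osum_pythagoras[OF assms(1), of b]
  by (intro power2_le_imp_le[of "norm (osum q q b)" "norm b"]) auto

section \<open>Closed complex subspaces\<close>

lemma closed_csubspace_csum:
  assumes "closed_csubspace S" "\<And>i. i \<in> I \<Longrightarrow> v i \<in> S"
  shows "(\<Sum>i\<in>I. scaleC (c i) (v i)) \<in> S"
  using assms unfolding closed_csubspace_def by (intro real_vector.subspace_sum) auto

lemma closed_csubspaceD:
  assumes "closed_csubspace S"
  shows "closed S" "0 \<in> S" "x \<in> S \<Longrightarrow> y \<in> S \<Longrightarrow> x + y \<in> S" "x \<in> S \<Longrightarrow> scaleC c x \<in> S"
    "x \<in> S \<Longrightarrow> y \<in> S \<Longrightarrow> x - y \<in> S"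
  using assms unfolding closed_csubspace_def
  by (auto intro: real_vector.subspace_0 real_vector.subspace_add real_vector.subspace_diff)

lemma closed_csubspaceI:
  assumes "closed S" "0 \<in> S" "\<And>x y. x \<in> S \<Longrightarrow> y \<in> S \<Longrightarrow> x + y \<in> S" "\<And>c x. x \<in> S \<Longrightarrow> scaleC c x \<in> S"
  shows "closed_csubspace S"
  using assms assms(4)[of _ "of_real _"] unfolding closed_csubspace_def
  by (auto simp: scaleC_complex_of_real intro!: real_vector.subspaceI)

lemma osum_in_closed_csubspace:
  assumes "orthonormal_or_zero q" "orthonormal_or_zero q'" "closed_csubspace S" "\<And>k. q' k \<in> S"
  shows "osum q q' b \<in> S"
proof (rule closed_sequentially[OF closed_csubspaceD(1)[OF assms(3)]])
  show "(\<Sum>k<n. scaleC (cinner b (q k)) (q' k)) \<in> S" for n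
    by (rule closed_csubspace_csum[OF assms(3)]) (rule assms(4))
qed (rule osum_sums[OF assms(1,2)])

lemma closed_csubspace_orthogonal: "closed_csubspace {v. cinner v w = 0}"
proof (rule closed_csubspaceI)
  show "closed {v. cinner v w = 0}"
    by (intro closed_Collect_eq continuous_intros linear_continuous_on bounded_linear_cinner_left)
qed (auto simp: cinner_linear)

lemma bounded_linear_osum:
  assumes "orthonormal_or_zero q" "orthonormal_or_zero q'" "\<And>k. norm (q k) = norm (q' k)"
  shows "bounded_linear (osum q q')"
proof (rule bounded_linear_intro[where K = 1])
  show "osum q q' (r *\<^sub>R x) = r *\<^sub>R osum q q' x" for r x
    using osum_scaleC[OF assms(1,2), of "of_real r"] by (simp add: scaleC_complex_of_real)
qed (use norm_osum_le[OF assms] osum_add[OF assms(1,2)] in auto)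

lemma closed_csubspace_osum_fixed:
  assumes "orthonormal_or_zero q"
  shows "closed_csubspace {v. osum q q v = v}"
proof (rule closed_csubspaceI)
  show "closed {v. osum q q v = v}"
    by (intro closed_Collect_eq continuous_intros linear_continuous_on bounded_linear_osum assms
        refl)
  show "0 \<in> {v. osum q q v = v}"
    by (simp add: osum_def)
qed (auto simp: osum_add[OF assms assms] osum_scaleC[OF assms assms])

section \<open>Gram-Schmidt orthogonalization of two sequences with the same Gram matrix\<close>

text \<open>For a zero vector, division by zero makes the direction zero, so linear dependence needs
  no separate treatment.\<close>

definition gs_dir :: "nat \<Rightarrow> (nat \<Rightarrow> 'a::complex_hilbert) \<Rightarrow> 'a" where
  "gs_dir k x = scaleC (of_real (1 / norm (x k))) (x k)"

definition gs_step :: "nat \<Rightarrow> (nat \<Rightarrow> 'a::complex_hilbert) \<Rightarrow> nat \<Rightarrow> 'a" where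
  "gs_step k x i = x i - scaleC (cinner (x i) (gs_dir k x)) (gs_dir k x)"

text \<open>Each direction is removed from all vectors at once and not only from the next one; in
  this way the whole Gram matrix evolves by a recursion in itself.\<close>

primrec gs :: "(nat \<Rightarrow> 'a::complex_hilbert) \<Rightarrow> nat \<Rightarrow> nat \<Rightarrow> 'a" where
  "gs x 0 = x"
| "gs x (Suc k) = gs_step k (gs x k)"

definition gs_basis :: "(nat \<Rightarrow> 'a::complex_hilbert) \<Rightarrow> nat \<Rightarrow> 'a" where
  "gs_basis x k = gs_dir k (gs x k)"

lemma norm_gs_dir: "norm (gs_dir k x) = 1 \<or> gs_dir k x = 0"
  by (cases "x k = 0") (auto simp: gs_dir_def norm_divide)

lemma gs_dir_scale: "scaleC (cinner (x k) (gs_dir k x)) (gs_dir k x) = x k"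
proof (cases "x k = 0")
  case False
  have "(1 / complex_of_real (norm (x k))) * cinner (x k) (x k) * (1 / complex_of_real (norm (x k)))
      = 1"
    using False by (simp add: cinner_self power2_eq_square)
  then show ?thesis
    by (simp add: gs_dir_def cinner_scaleC_right scaleC_scaleC)
qed (simp add: gs_dir_def)

lemma gs_step_self: "gs_step k x k = 0"
  by (simp add: gs_step_def gs_dir_scale)

lemma gs_zero: "i < k \<Longrightarrow> gs x k i = 0"
proof (induction k)
  case (Suc k)
  then show ?case
    by (cases "i = k") (auto simp: gs_step_self, auto simp: gs_step_def)
qed simp

lemma gs_orthogonal: "j < k \<Longrightarrow> cinner (gs x k i) (gs_basis x j) = 0"
proof (induction k arbitrary: i)
  case (Suc k)
  let ?d = "gs_basis x k"
  have step: "gs x (Suc k) i = gs x k i - scaleC (cinner (gs x k i) ?d) ?d"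
    by (simp add: gs_step_def gs_basis_def)
  show ?case
  proof (cases "j = k")
    case True
    have "cinner ?d ?d = 1 \<or> ?d = 0"
      using norm_gs_dir[of k "gs x k"] by (auto simp: gs_basis_def cinner_self)
    then show ?thesis
      unfolding step True by (auto simp: cinner_linear)
  next
    case False
    then have "cinner (gs x k i) (gs_basis x j) = 0" for i
      using Suc by auto
    then show ?thesis
      unfolding step by (simp add: cinner_linear gs_basis_def[of x k] gs_dir_def)
  qed
qed simp

lemma orthonormal_gs_basis: "orthonormal_or_zero (gs_basis x)"
proof -
  have less: "cinner (gs_basis x i) (gs_basis x j) = 0" if "j < i" for i j
    using gs_orthogonal[OF that, of x i] by
        (simp add: gs_basis_def[of x i] gs_dir_def cinner_scaleC_left)
  have "cinner (gs_basis x i) (gs_basis x j) = 0" if "i \<noteq> j" for i j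
    using less that by (cases i j rule: linorder_cases) (auto intro: cinner_zero_sym)
  then show ?thesis
    using norm_gs_dir unfolding orthonormal_or_zero_def gs_basis_def by blast
qed

lemma gs_expansion: "x i = (\<Sum>k<n. scaleC (cinner (gs x k i) (gs_basis x k)) (gs_basis x k))
    + gs x n i"
  by (induction n) (auto simp: gs_step_def gs_basis_def)

lemma cinner_gs_basis: "cinner (x i) (gs_basis x k) = cinner (gs x k i) (gs_basis x k)"
  by (subst gs_expansion[of x i k])
    (simp add: cinner_add_left cinner_sum_left cinner_scaleC_left
      orthonormal_or_zeroD(1)[OF orthonormal_gs_basis])

lemma gs_basis_in_closed_csubspace:
  assumes "closed_csubspace S" "\<And>i. x i \<in> S"
  shows "gs_basis x k \<in> S"
proof -
  have "gs x k i \<in> S" for i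
    by (induction k arbitrary: i)
      (auto simp: gs_step_def gs_dir_def intro!: closed_csubspaceD[OF assms(1)] assms(2))
  then show ?thesis
    by (simp add: gs_basis_def gs_dir_def closed_csubspaceD[OF assms(1)])
qed

context
  fixes x :: "nat \<Rightarrow> 'a::complex_hilbert" and y :: "nat \<Rightarrow> 'b::complex_hilbert"
  assumes gram: "\<And>i j. cinner (x i) (x j) = cinner (y i) (y j)"
begin

text \<open>All norms and inner products that enter a step are determined by the current Gram
  matrix, so equality of the Gram matrices persists.\<close>

lemma gram_gs: "cinner (gs x k i) (gs x k j) = cinner (gs y k i) (gs y k j)"
proof (induction k arbitrary: i j)
  case (Suc k)
  have n: "norm (gs x k k) = norm (gs y k k)"
    using Suc[of k k] by (simp add: cinner_self del: of_real_power)
  show ?case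
    by (simp add: gs_step_def gs_dir_def cinner_linear Suc n)
qed (simp add: gram)

lemma norm_gs_basis_eq: "norm (gs_basis x k) = norm (gs_basis y k)"
proof -
  have "norm (gs x k k) = norm (gs y k k)"
    using gram_gs[of k k k] by (simp add: cinner_self del: of_real_power)
  then show ?thesis
    by (simp add: gs_basis_def gs_dir_def)
qed

lemma gs_coefficient_eq: "cinner (gs x k i) (gs_basis x k) = cinner (gs y k i) (gs_basis y k)"
  using norm_gs_basis_eq gram_gs[of k k k]
  by (simp add: gs_basis_def gs_dir_def cinner_linear gram_gs cinner_self del: of_real_power)

text \<open>By \<open>gs_coefficient_eq\<close>, \<open>x i\<close> and \<open>y i\<close> have the
  same coordinates in their orthonormalized sequences. Only the first \<open>Suc i\<close> of them
  can be nonzero, because step \<open>i\<close> uses up the vector with index \<open>i\<close>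
  completely.\<close>

lemma osum_gs: "osum (gs_basis x) (gs_basis y) (x i) = y i"
proof -
  have "osum (gs_basis x) (gs_basis y) (x i)
      = (\<Sum>k<Suc i. scaleC (cinner (x i) (gs_basis x k)) (gs_basis y k))"
    unfolding osum_def by (intro suminf_finite) (auto simp: cinner_gs_basis gs_zero)
  also have "\<dots> = (\<Sum>k<Suc i. scaleC (cinner (gs y k i) (gs_basis y k)) (gs_basis y k))"
    by (simp only: cinner_gs_basis gs_coefficient_eq)
  also have "\<dots> = y i"
    using gs_expansion[of y i "Suc i"] by (simp only: gs_zero[OF lessI] add_0_right)
  finally show ?thesis .
qed

end

lemma exists_orthonormal_sequence:
  assumes "infinite_dimensional TYPE('h::complex_hilbert)"
  obtains e :: "nat \<Rightarrow> 'h::complex_hilbert" where "orthonormal_or_zero e" "\<And>k. norm (e k) = 1"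
proof -
  let ?P = "\<lambda>f n v. norm v = 1 \<and> (\<forall>k<n. cinner v (f k) = 0)"
  have "\<exists>f :: nat \<Rightarrow> 'h. \<forall>n. ?P f n (f n)"
  proof (rule dependent_wellorder_choice)
    fix n and f :: "nat \<Rightarrow> 'h"
    assume f: "\<And>k. k < n \<Longrightarrow> ?P f k (f k)"
    have orth: "cinner (f i) (f j) = (if i = j then 1 else 0)" if "i < n" "j < n" for i j
      using f[OF that(1)] f[OF that(2)]
      by (cases i j rule: linorder_cases) (auto simp: cinner_self intro: cinner_zero_sym)
    \<comment> \<open>The span is taken over the reals, so the multiples by \<open>\<i>\<close> are
      needed to reach all complex combinations.\<close>
    let ?B = "f ` {..<n} \<union> scaleC \<i> ` f ` {..<n}"
    have "finite ?B"
      by simp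
    then have "Real_Vector_Spaces.span ?B \<noteq> UNIV"
      using assms unfolding infinite_dimensional_def by blast
    then obtain x where x: "x \<notin> Real_Vector_Spaces.span ?B"
      by blast
    define r where "r = x - (\<Sum>k<n. scaleC (cinner x (f k)) (f k))"
    have split: "scaleC c v = Re c *\<^sub>R v + Im c *\<^sub>R scaleC \<i> v" for c and v :: 'h
    proof -
      have "c = of_real (Re c) + of_real (Im c) * \<i>"
        by (simp add: complex_eq_iff)
      then have "scaleC c v = scaleC (of_real (Re c) + of_real (Im c) * \<i>) v"
        by (rule arg_cong)
      then show ?thesis
        by (simp only: scaleC_add_left scaleC_scaleC[symmetric] scaleC_complex_of_real)
    qed
    have "scaleC c (f k) \<in> Real_Vector_Spaces.span ?B" if "k < n" for c k
      unfolding split[of c "f k"] using that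
      by (intro real_vector.span_add real_vector.span_scale) (auto intro: real_vector.span_base)
    then have "(\<Sum>k<n. scaleC (cinner x (f k)) (f k)) \<in> Real_Vector_Spaces.span ?B"
      by (intro real_vector.span_sum) simp
    then have "r \<noteq> 0"
      using x unfolding r_def right_minus_eq by metis
    moreover have "cinner r (f j) = 0" if "j < n" for j
    proof -
      have "cinner (\<Sum>k<n. scaleC (cinner x (f k)) (f k)) (f j) =
          (\<Sum>k<n. if k = j then cinner x (f j) else 0)"
        unfolding cinner_sum_left using that by (intro sum.cong refl)
            (auto simp: cinner_scaleC_left orth)
      then show ?thesis
        using that by (simp add: r_def cinner_diff_left)
    qed
    ultimately have "?P f n (scaleC (of_real (1 / norm r)) r)"
      by (simp add: cinner_scaleC_left norm_divide)
    then show "\<exists>v. ?P f n v" ..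
  qed simp
  then obtain e :: "nat \<Rightarrow> 'h" where e: "\<And>n. ?P e n (e n)"
    by blast
  have "cinner (e i) (e j) = 0" if "i \<noteq> j" for i j
    using e[of i] e[of j] that by (cases i j rule: linorder_cases) (auto intro: cinner_zero_sym)
  then have "orthonormal_or_zero e"
    using e unfolding orthonormal_or_zero_def by blast
  then show thesis
    using that e by blast
qed

section \<open>Contractive colligations and their transfer functions\<close>

lemma norm_vec_power2: "(norm (x :: 'h::complex_hilbert ^ 'm))\<^sup>2 = (\<Sum>l\<in>UNIV. (norm (x $ l))\<^sup>2)"
  by (simp add: norm_vec_def L2_set_def sum_nonneg)

lemma norm_prod_power2: "(norm b)\<^sup>2 = (norm (fst b))\<^sup>2 + (norm (snd b))\<^sup>2"
  by (simp add: norm_prod_def)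

lemma norm_vec_mono:
  assumes "\<And>l. norm ((x :: 'h::complex_hilbert ^ 'm) $ l) \<le> norm
      ((y :: 'k::complex_hilbert ^ 'm) $ l)"
  shows "norm x \<le> norm y"
  using assms unfolding norm_vec_def by (intro L2_set_mono) auto

definition zop :: "complex ^ 'm \<Rightarrow> 'h::complex_hilbert ^ 'm \<Rightarrow> 'h ^ 'm" where
  "zop z x = (\<chi> l. scaleC (z $ l) (x $ l))"

lemma delta_op_eq_zop: "delta_op \<delta> p = zop (\<chi> l. \<delta> l p)"
  by (simp add: delta_op_def zop_def fun_eq_iff)

lemma zop_nth [simp]: "zop z x $ l = scaleC (z $ l) (x $ l)"
  by (simp add: zop_def)

lemma scaleC_vec_nth [simp]: "scaleC c x $ l = scaleC c (x $ l)"
  by (simp add: scaleC_vec_def)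

lemma zop_add_right: "zop z (x + y) = zop z x + zop z y"
  by (simp add: Finite_Cartesian_Product.vec_eq_iff scaleC_add_right)

lemma zop_add_left: "zop (z + w) x = zop z x + zop w x"
  by (simp add: Finite_Cartesian_Product.vec_eq_iff scaleC_add_left)

lemma zop_diff_right: "zop z (x - y) = zop z x - zop z y"
  by (simp add: Finite_Cartesian_Product.vec_eq_iff scaleC_diff_right)

lemma zop_diff_left: "zop (z - w) x = zop z x - zop w x"
  by (simp add: Finite_Cartesian_Product.vec_eq_iff scaleC_diff_left)

lemma zop_scaleC_right: "zop z (scaleC c x) = scaleC c (zop z x)"
  by (simp add: Finite_Cartesian_Product.vec_eq_iff scaleC_scaleC mult.commute)

lemma zop_scaleC_left: "zop (c *s z) x = scaleC c (zop z x)"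
  by (simp add: Finite_Cartesian_Product.vec_eq_iff scaleC_scaleC)

lemma zop_scaleR_left: "zop (r *\<^sub>R z) x = r *\<^sub>R zop z x"
  by (simp add: Finite_Cartesian_Product.vec_eq_iff scaleC_complex_of_real[symmetric] scaleC_scaleC
      scaleC_complex_def)

lemma zop_scaleR_right: "zop z (r *\<^sub>R x) = r *\<^sub>R zop z x"
  by (simp add: Finite_Cartesian_Product.vec_eq_iff scaleC_scaleR)

lemma norm_zop_le:
  assumes "\<And>l. cmod (z $ l) \<le> r"
  shows "norm (zop z x) \<le> r * norm x"
proof -
  have "0 \<le> r"
    using assms[of undefined] norm_ge_zero order_trans by blast
  then have "norm (zop z x) \<le> norm (r *\<^sub>R x)"
    by (intro norm_vec_mono) (simp add: assms mult_right_mono)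
  then show ?thesis
    using \<open>0 \<le> r\<close> by simp
qed

lemma norm_zop_le': "norm (zop z x) \<le> norm z * norm x"
  by (rule norm_zop_le) (rule Finite_Cartesian_Product.norm_nth_le)

lemma bounded_bilinear_zop: "bounded_bilinear zop"
  by standard (auto simp: zop_add_left zop_add_right zop_scaleR_left zop_scaleR_right
      intro!: exI[of _ 1] norm_zop_le')

lemma cinner_zop_zop:
  "cinner (zop z x) (zop w y) = (\<Sum>l\<in>UNIV. z $ l * cnj (w $ l) * cinner (x $ l) (y $ l))"
  by (simp add: cinner_vec_def cinner_linear mult_ac)

lemma polydisc_radius:
  assumes "z \<in> (polydisc :: (complex ^ 'm) set)"
  obtains r where "0 \<le> r" "r < 1" "\<And>l. cmod (z $ l) \<le> r"
proof
  let ?r = "Max (range (\<lambda>l. cmod (z $ l)))"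
  show le: "cmod (z $ l) \<le> ?r" for l
    by (rule Max_ge) auto
  show "0 \<le> ?r"
    using le[of undefined] norm_ge_zero order_trans by blast
  show "?r < 1"
    using assms by (subst Max_less_iff) (auto simp: polydisc_def)
qed

lemma closed_csubspace_direct_sum:
  assumes "\<And>l. closed_csubspace (Ms l)"
  shows "closed_csubspace (direct_sum Ms)"
proof (rule closed_csubspaceI)
  have "direct_sum Ms = (\<Inter>l. (\<lambda>x. x $ l) -` Ms l)"
    by (auto simp: direct_sum_def)
  then show "closed (direct_sum Ms)"
    using closed_csubspaceD(1)[OF assms] by
        (auto intro!: closed_INT closed_vimage continuous_intros)
qed (auto simp: direct_sum_def closed_csubspaceD[OF assms])

text \<open>\<open>D\<close> is linear on the whole ambient space with values in \<open>M\<close>,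
  and the colligation is contractive everywhere, so algebraic identities hold without membership
  conditions. Asking for contractivity instead of isometry makes the truncations instances of the
  same locale.\<close>

locale contractive_colligation =
  fixes M :: "('h::complex_hilbert ^ 'm::finite) set" and a \<beta> \<gamma> and D
  assumes closed_M: "closed_csubspace M"
    and zop_M: "x \<in> M \<Longrightarrow> zop z x \<in> M"
    and \<gamma>_M: "\<gamma> \<in> M"
    and D_M: "D x \<in> M"
    and D_add: "D (x + y) = D x + D y"
    and D_scaleC: "D (scaleC c x) = scaleC c (D x)"
    and contraction: "norm (colligation a \<beta> \<gamma> D (c, x)) \<le> norm (c, x)"
begin

lemma D_diff: "D (x - y) = D x - D y"
  using D_add[of "x - y" y] by simp

lemma norm_D_le: "norm (D x) \<le> norm x"
proof -
  have "norm (D x) \<le> norm (cinner x \<beta>, D x)"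
    by (simp add: norm_prod_def)
  also have "\<dots> \<le> norm x"
    using contraction[of 0 x] by (simp add: colligation_def norm_prod_def)
  finally show ?thesis .
qed

text \<open>This is the Neumann series bound for \<open>(1 - D z)^(-1)\<close>, as \<open>D\<close>
  is contractive and \<open>zop z\<close> shrinks by the factor \<open>r\<close>. The perturbation
  estimates below apply it with suitable \<open>y\<close>.\<close>

lemma norm_solution_le:
  assumes "u = y + D (zop z u)" "r < 1" "\<And>l. cmod (z $ l) \<le> r"
  shows "norm u \<le> norm y / (1 - r)"
proof -
  have "norm u \<le> norm y + norm (D (zop z u))"
    by (subst assms(1)) (rule norm_triangle_ineq)
  also have "norm (D (zop z u)) \<le> r * norm u"
    using norm_D_le norm_zop_le[OF assms(3)] order_trans by blast
  finally show ?thesis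
    using assms(2) by (simp add: field_simps)
qed

text \<open>Banach's fixed point theorem on the complete set \<open>M\<close>, with contraction
  constant the largest modulus of a coordinate of \<open>z\<close>.\<close>

lemma ex1_solution:
  assumes "z \<in> polydisc" "y \<in> M"
  shows "\<exists>!u. u \<in> M \<and> u = y + D (zop z u)"
proof -
  obtain r where r: "0 \<le> r" "r < 1" "\<And>l. cmod (z $ l) \<le> r"
    using polydisc_radius[OF assms(1)] by blast
  have "\<exists>!u\<in>M. y + D (zop z u) = u"
  proof (rule Banach_fix[OF _ _ r(1,2)])
    show "complete M"
      using closed_csubspaceD(1)[OF closed_M] by (simp add: complete_eq_closed)
    show "M \<noteq> {}"
      using assms(2) by blast
    show "(\<lambda>u. y + D (zop z u)) ` M \<subseteq> M"
      by (auto intro!: closed_csubspaceD(3)[OF closed_M] assms(2) D_M)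
    show "dist (y + D (zop z u)) (y + D (zop z v)) \<le> r * dist u v" for u v
      using norm_D_le[of "zop z (u - v)"] norm_zop_le[of z r "u - v", OF r(3)]
      by (simp add: dist_norm D_diff[symmetric] zop_diff_right[symmetric])
  qed
  then show ?thesis
    by metis
qed

text \<open>For \<open>z\<close> in the polydisc and \<open>y\<close> in \<open>M\<close> this is
  the resolvent \<open>(1 - D z)^(-1)\<close> applied to \<open>y\<close>.\<close>

definition solution :: "'h ^ 'm \<Rightarrow> complex ^ 'm \<Rightarrow> 'h ^ 'm" where
  "solution y z = (THE u. u \<in> M \<and> u = y + D (zop z u))"

lemma solution:
  assumes "z \<in> polydisc" "y \<in> M"
  shows "solution y z \<in> M" "solution y z = y + D (zop z (solution y z))"
  using theI'[OF ex1_solution[OF assms]] by (auto simp: solution_def)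

lemma solution_unique:
  assumes "z \<in> polydisc" "y \<in> M" "u \<in> M" "u = y + D (zop z u)"
  shows "u = solution y z"
  using ex1_solution[OF assms(1,2)] solution[OF assms(1,2)] assms(3,4) by blast

abbreviation state :: "complex ^ 'm \<Rightarrow> 'h ^ 'm" where
  "state \<equiv> solution \<gamma>"

definition transfer :: "complex ^ 'm \<Rightarrow> complex" where
  "transfer z = a + cinner (zop z (state z)) \<beta>"

text \<open>Differentiating \<open>u = \<gamma> + D (z u)\<close> in direction \<open>h\<close>
  suggests \<open>L h = D (h u) + D (z (L h))\<close>, so the derivative is a solution as well. The
  remainder solves an equation of the same kind whose right-hand side is of second order.\<close>

lemma state_has_derivative:
  assumes z: "z \<in> polydisc"
  defines "L \<equiv> \<lambda>h. solution (D (zop h (state z))) z"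
  shows "(state has_derivative L) (at z)" "L (c *s h) = scaleC c (L h)"
proof -
  obtain r where r: "0 \<le> r" "r < 1" "\<And>l. cmod (z $ l) \<le> r"
    using polydisc_radius[OF z] by blast
  \<comment> \<open>The midpoint between \<open>r\<close> and \<open>1\<close> leaves a ball of
    radius \<open>s - r\<close> around \<open>z\<close> in which all coordinates are bounded by
    \<open>s < 1\<close>.\<close>
  define s where "s = (1 + r) / 2"
  have s: "s < 1" "r \<le> s"
    using r by (auto simp: s_def)
  have sz: "state z \<in> M" "state z = \<gamma> + D (zop z (state z))"
    using solution[OF z \<gamma>_M] by blast+
  have L: "L h \<in> M" "L h = D (zop h (state z)) + D (zop z (L h))" for h
    unfolding L_def using solution[OF z D_M] by blast+
  have L_unique: "u = L h" if "u \<in> M" "u = D (zop h (state z)) + D (zop z u)" for u h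
    unfolding L_def using that by (intro solution_unique[OF z D_M])
  have L_add: "L (h + k) = L h + L k" for h k
  proof (rule L_unique[symmetric])
    show "L h + L k \<in> M"
      by (rule closed_csubspaceD(3)[OF closed_M L(1) L(1)])
    have "L h + L k = (D (zop h (state z)) + D (zop z (L h))) +
        (D (zop k (state z)) + D (zop z (L k)))"
      by (intro arg_cong2[where f = "(+)"] L(2))
    also have "\<dots> = D (zop (h + k) (state z)) + D (zop z (L h + L k))"
      by (simp add: zop_add_left zop_add_right D_add)
    finally show "L h + L k = D (zop (h + k) (state z)) + D (zop z (L h + L k))" .
  qed
  show L_scaleC: "L (c *s h) = scaleC c (L h)" for c h
  proof (rule L_unique[symmetric])
    show "scaleC c (L h) \<in> M"
      by (rule closed_csubspaceD(4)[OF closed_M L(1)])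
    show "scaleC c (L h) = D (zop (c *s h) (state z)) + D (zop z (scaleC c (L h)))"
      unfolding zop_scaleC_left zop_scaleC_right D_scaleC scaleC_add_right[symmetric]
      by (rule arg_cong[OF L(2)])
  qed
  have "bounded_linear L"
  proof (rule bounded_linear_intro[where K = "norm (state z) / (1 - r)"])
    show "L (t *\<^sub>R h) = t *\<^sub>R L h" for t h
    proof -
      have "t *\<^sub>R h = of_real t *s h"
        by (simp add: Finite_Cartesian_Product.vec_eq_iff scaleR_conv_of_real[where 'a=complex])
      then show ?thesis
        by (simp add: L_scaleC scaleC_complex_of_real)
    qed
    show "norm (L h) \<le> norm h * (norm (state z) / (1 - r))" for h
    proof -
      have "norm (L h) \<le> norm (D (zop h (state z))) / (1 - r)"
        by (rule norm_solution_le[OF L(2) r(2,3)])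
      also have "\<dots> \<le> norm h * norm (state z) / (1 - r)"
        using norm_D_le norm_zop_le' order_trans r(2) by (intro divide_right_mono) (blast, simp)
      finally show ?thesis
        by simp
    qed
  qed (rule L_add)
  show "(state has_derivative L) (at z)"
  proof (rule has_derivativeI_sandwich[where e = "s - r"])
    show "0 < s - r"
      using r by (simp add: s_def field_simps)
    show "((\<lambda>w. norm (w - z) * (norm (state z) / (1 - s) / (1 - r))) \<longlongrightarrow> 0) (at z)"
      by (rule tendsto_mult_left_zero[OF tendsto_norm_zero[OF LIM_zero[OF tendsto_ident_at]]])
    fix w assume "w \<noteq> z" and w: "dist w z < s - r"
    have wl: "cmod (w $ l) \<le> s" for l
    proof -
      have "cmod (w $ l) \<le> cmod (z $ l) + cmod ((w - z) $ l)"
        using norm_triangle_ineq[of "z $ l" "(w - z) $ l"] by simp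
      also have "\<dots> \<le> r + norm (w - z)"
        by (intro add_mono r(3) Finite_Cartesian_Product.norm_nth_le)
      finally show ?thesis
        using w by (simp add: dist_norm)
    qed
    then have wp: "w \<in> polydisc"
      using s(1) by (auto simp: polydisc_def intro: le_less_trans)
    define \<Delta> where "\<Delta> = state w - state z"
    have sw: "state w = \<gamma> + D (zop w (state w))"
      using solution[OF wp \<gamma>_M] by blast
    have diff: "\<Delta> = D (zop w (state w)) - D (zop z (state z))"
      unfolding \<Delta>_def by (metis add_diff_cancel_left sw sz(2))
    \<comment> \<open>The same difference is rewritten twice. With \<open>w\<close> in the feedback
      term, the right-hand side involves only \<open>state z\<close> and \<open>\<Delta>\<close> is
      seen to be of first order. With \<open>z\<close> in the feedback term (\<open>eq2\<close>),
      the right-hand side is \<open>D (zop (w - z) \<Delta>)\<close>, hence of second order.\<close>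
    have eq1: "\<Delta> = D (zop (w - z) (state z)) + D (zop w \<Delta>)"
      by (subst diff) (simp add: \<Delta>_def zop_diff_left zop_diff_right D_diff)
    have eq2: "\<Delta> - L (w - z) = D (zop (w - z) \<Delta>) + D (zop z (\<Delta> - L (w - z)))"
    proof -
      have "\<Delta> = D (zop (w - z) (state w)) + D (zop z \<Delta>)"
        by (subst diff) (simp add: \<Delta>_def zop_diff_left zop_diff_right D_diff)
      then have "\<Delta> - L (w - z) = (D (zop (w - z) (state w)) + D (zop z \<Delta>))
          - (D (zop (w - z) (state z)) + D (zop z (L (w - z))))"
        using L(2)[of "w - z"] by simp
      also have "\<dots> = D (zop (w - z) \<Delta>) + D (zop z (\<Delta> - L (w - z)))"
        by (simp add: \<Delta>_def zop_diff_right D_diff)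
      finally show ?thesis .
    qed
    have D_zop_le: "norm (D (zop h v)) \<le> norm h * norm v" for h v
      using norm_D_le norm_zop_le' order_trans by blast
    have "norm \<Delta> \<le> norm (w - z) * norm (state z) / (1 - s)"
      using norm_solution_le[OF eq1 s(1) wl] D_zop_le[of "w - z" "state z"] s(1)
      by (meson diff_ge_0_iff_ge divide_right_mono less_imp_le order_trans)
    then have "norm (w - z) * norm \<Delta> / (1 - r)
        \<le> norm (w - z) * (norm (w - z) * norm (state z) / (1 - s)) / (1 - r)"
      using r(2) by (intro divide_right_mono mult_left_mono) auto
    moreover have "norm (\<Delta> - L (w - z)) \<le> norm (w - z) * norm \<Delta> / (1 - r)"
      using norm_solution_le[OF eq2 r(2,3)] D_zop_le[of "w - z" \<Delta>] r(2)
      by (meson diff_ge_0_iff_ge divide_right_mono less_imp_le order_trans)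
    ultimately have "norm (\<Delta> - L (w - z)) \<le> norm (w - z) *
        (norm (w - z) * norm (state z) / (1 - s)) / (1 - r)"
      by linarith
    then show "norm (state w - state z - L (w - z)) / norm (w - z)
        \<le> norm (w - z) * (norm (state z) / (1 - s) / (1 - r))"
      using \<open>w \<noteq> z\<close> s(1) r(2) unfolding \<Delta>_def[symmetric] by (simp add: divide_le_eq mult_ac)
  qed fact
qed

text \<open>Only scalar functions can be inserted into the functional calculus, so the state enters
  there through its coordinates.\<close>

lemma state_component_holo: "(\<lambda>z. cinner (state z) b) \<in> holo polydisc"
  unfolding holo_def
proof safe
  fix z :: "complex ^ 'm" assume z: "z \<in> polydisc"
  note d = state_has_derivative[OF z]
  show "\<exists>f'. ((\<lambda>z. cinner (state z) b) has_derivative f') (at z) \<and> (\<forall>c v. f' (c *s v) = c * f' v)"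
    by (rule exI, rule conjI, rule bounded_linear.has_derivative[OF bounded_linear_cinner_left
        d(1)])
      (simp add: d(2) cinner_scaleC_left)
qed

lemma transfer_holo: "transfer \<in> holo polydisc"
  unfolding holo_def
proof safe
  fix z :: "complex ^ 'm" assume z: "z \<in> polydisc"
  note d = state_has_derivative[OF z]
  have "((\<lambda>z. a + cinner (zop z (state z)) \<beta>) has_derivative
      (\<lambda>h. 0 + cinner (zop z (solution (D (zop h (state z))) z) + zop h (state z)) \<beta>)) (at z)"
    by (intro has_derivative_add has_derivative_const
        bounded_linear.has_derivative[OF bounded_linear_cinner_left]
        bounded_bilinear.FDERIV[OF bounded_bilinear_zop] d(1) has_derivative_ident)
  then show "\<exists>f'. (transfer has_derivative f') (at z) \<and> (\<forall>c v. f' (c *s v) = c * f' v)"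
    unfolding transfer_def[abs_def]
    by (intro exI conjI) (assumption, simp only: d(2), simp add: zop_scaleC_left zop_scaleC_right
        cinner_linear algebra_simps)
qed

end

lemma holo_continuous_on: "f \<in> holo \<Omega> \<Longrightarrow> continuous_on \<Omega> f"
  unfolding holo_def by (blast intro: continuous_at_imp_continuous_on has_derivative_continuous)

section \<open>The lurking isometry\<close>

text \<open>For orthonormal \<open>e\<close> this is the closed complex span, described as the fixed
  space of the orthogonal projection.\<close>

definition sequence_span :: "(nat \<Rightarrow> 'h::complex_hilbert) \<Rightarrow> 'h set" where
  "sequence_span e = {v. osum e e v = v}"

context
  fixes e :: "nat \<Rightarrow> 'h::complex_hilbert"
  assumes e: "orthonormal_or_zero e" and norm_e: "\<And>k. norm (e k) = 1"
begin

lemma closed_sequence_span: "closed_csubspace (sequence_span e)"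
  unfolding sequence_span_def by (rule closed_csubspace_osum_fixed[OF e])

lemma e_in_sequence_span: "e k \<in> sequence_span e"
proof -
  have "osum e e (e k) = (\<Sum>j\<in>{k}. scaleC (cinner (e k) (e j)) (e j))"
    unfolding osum_def using orthonormal_or_zeroD(1)[OF e] by (intro suminf_finite) auto
  then show ?thesis
    by (simp add: sequence_span_def cinner_self norm_e)
qed

text \<open>An isometry into the closed span of the odd-indexed vectors. The kernel vectors below use only
  even indices, which leaves the room needed to extend their partial isometry.\<close>

definition odd_shift :: "complex \<times> ('h ^ 'm) \<Rightarrow> complex \<times> ('h ^ 'm)" where
  "odd_shift b = (0, \<chi> l. osum e (\<lambda>k. e (2 * k + 3)) (snd b $ l) +
      (if l = undefined then scaleC (fst b) (e 1) else 0))"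

lemma orthonormal_odd: "orthonormal_or_zero (\<lambda>k. e (2 * k + 3))"
  using e by (auto simp: orthonormal_or_zero_def)

lemma odd_shift_add: "odd_shift (b + c) = odd_shift b + odd_shift c"
  by (auto simp: odd_shift_def Finite_Cartesian_Product.vec_eq_iff osum_add[OF e orthonormal_odd]
      scaleC_add_left)

lemma odd_shift_scaleC: "odd_shift (scaleC t b) = scaleC t (odd_shift b)"
  by (auto simp: odd_shift_def Finite_Cartesian_Product.vec_eq_iff osum_scaleC[OF e orthonormal_odd]
      scaleC_prod_def scaleC_add_right scaleC_scaleC scaleC_complex_def)

text \<open>The scalar part is sent to \<open>e 1\<close> in the one arbitrary component
  \<open>undefined\<close>, orthogonally to the vectors \<open>e (2 * k + 3)\<close> that receive
  the rest. The projection \<open>osum e e\<close> appears because the shift annihilates whatever is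
  orthogonal to the closed span.\<close>

lemma norm_odd_shift_power2:
  "(norm (odd_shift b))\<^sup>2 = (cmod (fst b))\<^sup>2 + (\<Sum>l\<in>UNIV. (norm (osum e e (snd b $ l)))\<^sup>2)"
proof -
  let ?o = "osum e (\<lambda>k. e (2 * k + 3))"
  have orth: "cinner (?o v) (scaleC c (e 1)) = 0" for v c
    using orthonormal_or_zeroD(1)[OF e]
    by (intro cinner_osum_orthogonal[OF e orthonormal_odd]) (simp add: cinner_scaleC_right)
  have "(norm (odd_shift b))\<^sup>2
      = (\<Sum>l\<in>UNIV. (norm (?o (snd b $ l) + (if l = undefined then scaleC (fst b) (e 1) else 0)))\<^sup>2)"
    by (simp add: odd_shift_def norm_prod_def norm_vec_power2 sum_nonneg)
  also have "\<dots> = (\<Sum>l\<in>UNIV. (norm (osum e e (snd b $ l)))\<^sup>2 +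
      (if l = undefined then (cmod (fst b))\<^sup>2 else 0))"
    by (intro sum.cong refl)
      (simp add: norm_add_orthogonal[OF orth] norm_e norm_osum[OF e orthonormal_odd] del:
          One_nat_def)
  finally show ?thesis
    by (simp add: sum.distrib)
qed

lemma norm_odd_shift_le: "norm (odd_shift b) \<le> norm b"
proof -
  have "(norm (odd_shift b))\<^sup>2 \<le> (cmod (fst b))\<^sup>2 + (\<Sum>l\<in>UNIV. (norm (snd b $ l))\<^sup>2)"
    unfolding norm_odd_shift_power2
    by (intro add_left_mono sum_mono power_mono norm_osum_le e) auto
  also have "\<dots> = (norm b)\<^sup>2"
    by (simp add: norm_prod_power2 norm_vec_power2)
  finally show ?thesis
    by (rule power2_le_imp_le) simp
qed

lemma norm_odd_shift_eq:
  assumes "snd b \<in> direct_sum (\<lambda>_. sequence_span e)"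
  shows "norm (odd_shift b) = norm b"
proof -
  have "(norm (odd_shift b))\<^sup>2 = (norm b)\<^sup>2"
    using assms unfolding norm_odd_shift_power2
    by (simp add: direct_sum_def sequence_span_def norm_prod_power2 norm_vec_power2)
  then show ?thesis
    by simp
qed

lemma odd_shift_in: "snd (odd_shift b) \<in> direct_sum (\<lambda>_. sequence_span e)"
  by (auto simp: direct_sum_def odd_shift_def e_in_sequence_span
      closed_csubspaceD[OF closed_sequence_span]
      osum_in_closed_csubspace[OF e orthonormal_odd closed_sequence_span])

lemma odd_shift_orthogonal:
  assumes "\<And>l k. cinner (v $ l) (e (2 * k + 1)) = 0"
  shows "cinner (odd_shift b) (c, v) = 0"
proof -
  have v: "cinner (e (2 * k + 1)) (v $ l) = 0" for k l
    using assms[of l k] cinner_zero_sym by blast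
  have "cinner (osum e (\<lambda>k. e (2 * k + 3)) w) (v $ l) = 0" for w l
    using v[of "Suc _" l] by (intro cinner_osum_orthogonal[OF e orthonormal_odd])
        (simp add: numeral_3_eq_3)
  moreover have "cinner (e 1) (v $ l) = 0" for l
    using v[of 0 l] by simp
  ultimately show ?thesis
    by (simp add: odd_shift_def cinner_prod_def cinner_vec_def cinner_linear
        if_distrib[of "\<lambda>x. cinner x _"]
        cong: if_cong)
qed

text \<open>Once vectors \<open>u i\<close> realize the kernels, moving the negative terms of
  \<open>id\<close> across says that \<open>x i = (1, zop (z i) (u i))\<close> and
  \<open>y i = (w i, u i)\<close> have the same Gram matrix. The map taking \<open>x i\<close> to
  \<open>y i\<close> is therefore isometric, and the block entries of an extension are the data
  sought.\<close>

theorem lurking_isometry: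
  fixes z :: "nat \<Rightarrow> complex ^ 'm" and w :: "nat \<Rightarrow> complex" and \<kappa> :: "'m \<Rightarrow> nat \<Rightarrow> nat \<Rightarrow> complex"
  assumes psd: "\<And>l. psd_kernel_on UNIV (\<kappa> l)"
    and id: "\<And>i j. 1 - w i * cnj (w j) = (\<Sum>l\<in>UNIV. (1 - z i $ l * cnj (z j $ l)) * \<kappa> l i j)"
  defines "M \<equiv> direct_sum (\<lambda>_ :: 'm. sequence_span e)"
  obtains a \<beta> \<gamma> D u where
    "contractive_colligation M a \<beta> \<gamma> D" "\<beta> \<in> M"
    "\<And>c x. x \<in> M \<Longrightarrow> norm (colligation a \<beta> \<gamma> D (c, x)) = norm (c, x)"
    "\<And>i. u i \<in> M" "\<And>i. u i = \<gamma> + D (zop (z i) (u i))" "\<And>i. w i = a + cinner (zop (z i) (u i)) \<beta>"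
proof -
  \<comment> \<open>The Cholesky factor is lower triangular, so each \<open>u i\<close> is a finite
    combination. Doubling the index leaves the odd vectors free.\<close>
  define u :: "nat \<Rightarrow> 'h ^ 'm" where "u i = (\<chi> l. \<Sum>k<Suc i. scaleC (cholesky (\<kappa> l) i k) (e (2 * k)))"
      for i
  have closed_M: "closed_csubspace M"
    unfolding M_def by (rule closed_csubspace_direct_sum[OF closed_sequence_span])
  have zop_M: "zop \<zeta> x \<in> M" if "x \<in> M" for \<zeta> x
    using that by (auto simp: M_def direct_sum_def closed_csubspaceD[OF closed_sequence_span])
  have u_M: "u i \<in> M" for i
    unfolding M_def direct_sum_def u_def
    by (auto intro!: closed_csubspace_csum[OF closed_sequence_span] e_in_sequence_span simp del:
        sum.lessThan_Suc)
  have u_gram: "cinner (u i $ l) (u j $ l) = \<kappa> l i j" for i j l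
  proof -
    have ext: "u i $ l = (\<Sum>k<Suc (max i j). scaleC (cholesky (\<kappa> l) i k) (e (2 * k)))" for i j
      unfolding u_def vec_lambda_beta
      by (intro sum.mono_neutral_left) (auto simp: cholesky_upper[OF psd])
    have orth: "cinner (e (2 * k)) (e (2 * k')) = (if k = k' then 1 else 0)" for k k'
      using orthonormal_or_zeroD(1)[OF e] by (simp add: cinner_self norm_e)
    have "cinner (u i $ l) (u j $ l) = (\<Sum>k<Suc (max i j). cholesky (\<kappa> l) i k * cnj
        (cholesky (\<kappa> l) j k))"
      unfolding ext[of i j] ext[of j i, unfolded max.commute[of j i]]
      unfolding cinner_sum_left cinner_sum_right cinner_scaleC_left cinner_scaleC_right orth
      by (intro sum.cong refl) (simp add: if_distrib[of "\<lambda>x. _ * x"] cong: if_cong del: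
          sum.lessThan_Suc)
    then show ?thesis
      using cholesky_decomposition[OF psd, of i j "Suc (max i j)" l] by
          (simp add: less_Suc_eq_le min_le_iff_disj del: sum.lessThan_Suc)
  qed
  define x where "x i = (1 :: complex, zop (z i) (u i))" for i
  define y where "y i = (w i, u i)" for i
  have gram: "cinner (x i) (x j) = cinner (y i) (y j)" for i j
  proof -
    have "1 - w i * cnj (w j) = cinner (u i) (u j) - cinner (zop (z i) (u i)) (zop (z j) (u j))"
      unfolding id cinner_zop_zop cinner_vec_def[of "u i"] u_gram
      by (simp add: left_diff_distrib sum_subtractf)
    then show ?thesis
      by (simp add: x_def y_def cinner_prod_def cinner_complex_def algebra_simps)
  qed
  define q where "q = gs_basis x"
  define q' where "q' = gs_basis y"
  have q: "orthonormal_or_zero q" and q': "orthonormal_or_zero q'"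
      and qq': "\<And>k. norm (q k) = norm (q' k)"
    unfolding q_def q'_def by (rule orthonormal_gs_basis orthonormal_gs_basis
        norm_gs_basis_eq[OF gram])+
  define N where "N = (UNIV :: complex set) \<times> M"
  have closed_N: "closed_csubspace N"
    unfolding N_def using closed_csubspaceD[OF closed_M]
    by (intro closed_csubspaceI closed_Times) (auto simp: scaleC_prod_def zero_prod_def)
  have q_N: "q k \<in> N" and q'_N: "q' k \<in> N" for k
    unfolding q_def q'_def
    by (rule gs_basis_in_closed_csubspace[OF closed_N], simp add: x_def y_def N_def zop_M u_M)+
  have q'_odd: "cinner (odd_shift b) (q' k) = 0" for b k
  proof -
    have "closed_csubspace {v. cinner v (odd_shift b) = 0}"
      by (rule closed_csubspace_orthogonal)
    moreover have "y i \<in> {v. cinner v (odd_shift b) = 0}" for i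
    proof -
      have "cinner (u i $ l) (e (2 * k + 1)) = 0" for l k
      proof -
        have "cinner (e (2 * j)) (e (2 * k + 1)) = 0" for j
          by (rule orthonormal_or_zeroD(1)[OF e]) presburger
        then show ?thesis
          unfolding u_def by (simp add: cinner_sum_left cinner_scaleC_left del: sum.lessThan_Suc)
      qed
      then show ?thesis
        using odd_shift_orthogonal[of "u i" b "w i"] cinner_zero_sym by (auto simp: y_def)
    qed
    ultimately have "q' k \<in> {v. cinner v (odd_shift b) = 0}"
      unfolding q'_def by (rule gs_basis_in_closed_csubspace)
    then show ?thesis
      using cinner_zero_sym by blast
  qed
  \<comment> \<open>The partial isometry acts on the closed span of the \<open>x i\<close>, the odd
    shift on its orthogonal complement. By \<open>q'_odd\<close> the two ranges are orthogonal, so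
    the squared norms add up.\<close>
  define V where "V b = osum q q' b + odd_shift (b - osum q q b)" for b
  have V_add: "V (b + c) = V b + V c" for b c
  proof -
    have eq: "b + c - osum q q (b + c) = (b - osum q q b) + (c - osum q q c)"
      by (simp add: osum_add[OF q q])
    show ?thesis
      unfolding V_def eq odd_shift_add osum_add[OF q q'] by simp
  qed
  have V_scaleC: "V (scaleC t b) = scaleC t (V b)" for t b
  proof -
    have eq: "scaleC t b - osum q q (scaleC t b) = scaleC t (b - osum q q b)"
      by (simp add: osum_scaleC[OF q q] scaleC_diff_right)
    show ?thesis
      unfolding V_def eq odd_shift_scaleC osum_scaleC[OF q q'] scaleC_add_right ..
  qed
  have V_norm: "(norm (V b))\<^sup>2 = (norm (osum q q b))\<^sup>2 + (norm (odd_shift (b - osum q q b)))\<^sup>2"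
      for b
  proof -
    have "cinner (osum q q' b) (odd_shift (b - osum q q b)) = 0"
      using q'_odd cinner_zero_sym by (intro cinner_osum_orthogonal[OF q q']) blast
    then show ?thesis
      unfolding V_def by (simp add: norm_add_orthogonal norm_osum[OF q q' qq'])
  qed
  have V_le: "norm (V b) \<le> norm b" for b
  proof -
    have "(norm (V b))\<^sup>2 \<le> (norm b)\<^sup>2"
      unfolding V_norm osum_pythagoras[OF q, of b]
      by (intro add_left_mono power_mono norm_odd_shift_le) simp
    then show ?thesis
      by (rule power2_le_imp_le) simp
  qed
  have V_eq: "norm (V b) = norm b" if "b \<in> N" for b
  proof -
    have "b - osum q q b \<in> N"
      using that by (intro closed_csubspaceD(5)[OF closed_N]
          osum_in_closed_csubspace[OF q q closed_N] q_N)
    then have "norm (odd_shift (b - osum q q b)) = norm (b - osum q q b)"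
      unfolding N_def M_def mem_Times_iff by (intro norm_odd_shift_eq) blast
    then have "(norm (V b))\<^sup>2 = (norm b)\<^sup>2"
      unfolding V_norm osum_pythagoras[OF q, of b] by simp
    then show ?thesis
      by simp
  qed
  have V_N: "V b \<in> N" for b
    unfolding V_def
    using odd_shift_in[of "b - osum q q b"]
    by (intro closed_csubspaceD(3)[OF closed_N] osum_in_closed_csubspace[OF q q' closed_N] q'_N)
      (auto simp: N_def M_def mem_Times_iff)
  have V_x: "V (x i) = y i" for i
  proof -
    have "osum q q (x i) = x i"
      unfolding q_def by (rule osum_gs) simp
    moreover have "osum q q' (x i) = y i"
      unfolding q_def q'_def by (rule osum_gs[OF gram])
    moreover have "odd_shift 0 = (0 :: complex \<times> ('h ^ 'm))"
      using odd_shift_scaleC[of 0 0] by simp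
    ultimately show ?thesis
      by (simp add: V_def)
  qed
  define a where "a = fst (V (1, 0))"
  define \<gamma> where "\<gamma> = snd (V (1, 0))"
  define D where "D v = snd (V (0, v))" for v
  \<comment> \<open>The odd shift has scalar part zero, so the scalar part of \<open>V\<close> is
    that of \<open>osum q q'\<close>. The adjoint applied to \<open>(1, 0)\<close> supplies the
    vector representing it.\<close>
  define \<beta> where "\<beta> = snd (osum q' q (1, 0))"
  have fst_V: "fst (V (0, v)) = cinner v \<beta>" for v
  proof -
    have "fst (V (0, v)) = cinner (osum q q' (0, v)) (1, 0)"
      by (simp add: V_def odd_shift_def cinner_prod_def cinner_complex_def)
    also have "\<dots> = cinner (0, v) (osum q' q (1, 0))"
      by (rule osum_adjoint[OF q q'])
    finally show ?thesis
      by (simp add: cinner_prod_def \<beta>_def)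
  qed
  have V_split: "V (c, v) = colligation a \<beta> \<gamma> D (c, v)" for c v
  proof -
    have "V (c, v) = V (scaleC c (1, 0) + (0, v))"
      by (simp add: scaleC_prod_def scaleC_complex_def)
    also have "\<dots> = scaleC c (V (1, 0)) + V (0, v)"
      by (simp only: V_add V_scaleC)
    finally show ?thesis
      by (simp add: prod_eq_iff colligation_def a_def \<gamma>_def D_def fst_V scaleC_prod_def
          scaleC_complex_def mult.commute)
  qed
  show thesis
  proof
    show "contractive_colligation M a \<beta> \<gamma> D"
    proof
      show "D (v + v') = D v + D v'" for v v'
        using V_add[of "(0, v)" "(0, v')"] by (simp add: D_def)
      show "D (scaleC c v) = scaleC c (D v)" for c v
        using V_scaleC[of c "(0, v)"] by (simp add: D_def scaleC_prod_def)
      show "\<gamma> \<in> M" "D v \<in> M" for v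
        using V_N[of "(1, 0)"] V_N[of "(0, v)"] by (auto simp: \<gamma>_def D_def N_def mem_Times_iff)
      show "norm (colligation a \<beta> \<gamma> D (c, v)) \<le> norm (c, v)" for c v
        using V_le[of "(c, v)"] by (simp only: V_split)
    qed (rule closed_M zop_M; assumption)+
    show "\<beta> \<in> M"
      using osum_in_closed_csubspace[OF q' q closed_N q_N, of "(1, 0)"]
      by (simp add: \<beta>_def N_def mem_Times_iff)
    show "norm (colligation a \<beta> \<gamma> D (c, v)) = norm (c, v)" if "v \<in> M" for c v
      using V_eq[of "(c, v)"] that by (simp add: V_split[symmetric] N_def)
    have "colligation a \<beta> \<gamma> D (1, zop (z i) (u i)) = (w i, u i)" for i
      using V_x[of i] unfolding x_def y_def V_split .
    then show "u i = \<gamma> + D (zop (z i) (u i))" "w i = a + cinner (zop (z i) (u i)) \<beta>" for i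
      by (auto simp: colligation_def)
  qed (rule u_M)
qed

end

section \<open>The functional calculus applied to a transfer function\<close>

lemma holo_const: "(\<lambda>_. c) \<in> holo \<Omega>"
  unfolding holo_def by (auto intro!: exI[of _ "\<lambda>_. 0"])

lemma holo_coordinate: "(\<lambda>z. z $ l) \<in> holo \<Omega>"
  unfolding holo_def
  by (auto intro!: exI[of _ "\<lambda>h. h $ l"] bounded_linear_imp_has_derivative bounded_linear_vec_nth)

lemma holo_add: "f \<in> holo \<Omega> \<Longrightarrow> g \<in> holo \<Omega> \<Longrightarrow> (\<lambda>z. f z + g z) \<in> holo \<Omega>"
  unfolding holo_def mem_Collect_eq
proof
  fix z assume *: "\<forall>z\<in>\<Omega>. \<exists>f'. (f has_derivative f') (at z) \<and> (\<forall>c v. f' (c *s v) = c * f' v)"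
    "\<forall>z\<in>\<Omega>. \<exists>f'. (g has_derivative f') (at z) \<and> (\<forall>c v. f' (c *s v) = c * f' v)" "z \<in> \<Omega>"
  obtain f' where f': "(f has_derivative f') (at z)" "\<And>c v. f' (c *s v) = c * f' v"
    using * by blast
  obtain g' where g': "(g has_derivative g') (at z)" "\<And>c v. g' (c *s v) = c * g' v"
    using * by blast
  show "\<exists>f'. ((\<lambda>z. f z + g z) has_derivative f') (at z) \<and> (\<forall>c v. f' (c *s v) = c * f' v)"
    by (rule exI, rule conjI, rule has_derivative_add[OF f'(1) g'(1)])
        (simp add: f'(2) g'(2) distrib_left)
qed

lemma holo_mult: "f \<in> holo \<Omega> \<Longrightarrow> g \<in> holo \<Omega> \<Longrightarrow> (\<lambda>z. f z * g z) \<in> holo \<Omega>"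
  unfolding holo_def mem_Collect_eq
proof
  fix z assume *: "\<forall>z\<in>\<Omega>. \<exists>f'. (f has_derivative f') (at z) \<and> (\<forall>c v. f' (c *s v) = c * f' v)"
    "\<forall>z\<in>\<Omega>. \<exists>f'. (g has_derivative f') (at z) \<and> (\<forall>c v. f' (c *s v) = c * f' v)" "z \<in> \<Omega>"
  obtain f' where f': "(f has_derivative f') (at z)" "\<And>c v. f' (c *s v) = c * f' v"
    using * by blast
  obtain g' where g': "(g has_derivative g') (at z)" "\<And>c v. g' (c *s v) = c * g' v"
    using * by blast
  show "\<exists>f'. ((\<lambda>z. f z * g z) has_derivative f') (at z) \<and> (\<forall>c v. f' (c *s v) = c * f' v)"
    by (rule exI, rule conjI, rule has_derivative_mult[OF f'(1) g'(1)])
        (simp add: f'(2) g'(2) algebra_simps)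
qed

lemma holo_sum: "(\<And>i. i \<in> I \<Longrightarrow> f i \<in> holo \<Omega>) \<Longrightarrow> (\<lambda>z. \<Sum>i\<in>I. f i z) \<in> holo \<Omega>"
  by (induction I rule: infinite_finite_induct) (auto intro: holo_const holo_add)

context
  fixes T :: "'m::finite \<Rightarrow> 'h::complex_hilbert \<Rightarrow>\<^sub>L 'h" and \<Phi>
  assumes calculus: "functional_calculus T \<Phi>"
begin

lemma calculus_tendsto:
  assumes "F \<in> holo polydisc" "\<And>n. Fs n \<in> holo polydisc"
    "\<And>K. K \<subseteq> polydisc \<Longrightarrow> compact K \<Longrightarrow> uniform_limit K Fs F sequentially"
  shows "(\<lambda>n. \<Phi> (Fs n)) \<longlonglongrightarrow> \<Phi> F"
proof -
  have "\<forall>F\<in>holo polydisc. \<forall>Fs. (\<forall>n. Fs n \<in> holo polydisc) \<longrightarrow>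
       (\<forall>K\<subseteq>polydisc. compact K \<longrightarrow> uniform_limit K Fs F sequentially) \<longrightarrow>
       (\<lambda>n. \<Phi> (Fs n)) \<longlonglongrightarrow> \<Phi> F"
    using calculus unfolding functional_calculus_def by (elim conjE)
  from this[rule_format, OF assms] show ?thesis .
qed

text \<open>The constant sequence \<open>F\<close> converges to \<open>G\<close> uniformly on
  compact subsets of the polydisc, so the continuity clause forces equality.\<close>

lemma calculus_cong:
  assumes "F \<in> holo polydisc" "G \<in> holo polydisc" "\<And>z. z \<in> polydisc \<Longrightarrow> F z = G z"
  shows "\<Phi> F = \<Phi> G"
proof -
  have "(\<lambda>n :: nat. \<Phi> F) \<longlonglongrightarrow> \<Phi> G"
    using assms by (intro calculus_tendsto uniform_limitI) (auto simp: subset_iff)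
  then show ?thesis
    by (simp add: LIMSEQ_const_iff)
qed

lemma calculus_const: "blinfun_apply (\<Phi> (\<lambda>_. c)) x = scaleC c x"
  using calculus unfolding functional_calculus_def by blast

lemma calculus_add:
  "F \<in> holo polydisc \<Longrightarrow> G \<in> holo polydisc \<Longrightarrow>
    blinfun_apply (\<Phi> (\<lambda>z. F z + G z)) x = blinfun_apply (\<Phi> F) x + blinfun_apply (\<Phi> G) x"
  using calculus unfolding functional_calculus_def by (simp add: blinfun.add_left)

lemma calculus_mult:
  "F \<in> holo polydisc \<Longrightarrow> G \<in> holo polydisc \<Longrightarrow>
    blinfun_apply (\<Phi> (\<lambda>z. F z * G z)) x = blinfun_apply (\<Phi> F) (blinfun_apply (\<Phi> G) x)"
  using calculus unfolding functional_calculus_def by simp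

lemma calculus_coordinate: "\<Phi> (\<lambda>z. z $ l) = T l"
  using calculus unfolding functional_calculus_def by blast

lemma calculus_sum:
  assumes "finite I" "\<And>i. i \<in> I \<Longrightarrow> F i \<in> holo polydisc"
  shows "blinfun_apply (\<Phi> (\<lambda>z. \<Sum>i\<in>I. F i z)) x = (\<Sum>i\<in>I. blinfun_apply (\<Phi> (F i)) x)"
  using assms
proof (induction I)
  case empty
  then show ?case by (simp add: calculus_const)
next
  case (insert i I)
  then show ?case
    using calculus_add[of "F i" "\<lambda>z. \<Sum>i\<in>I. F i z" x] by (simp add: holo_sum)
qed

lemma calculus_limit:
  assumes "F \<in> holo polydisc" "\<And>n. Fs n \<in> holo polydisc"
    "\<And>K. K \<subseteq> polydisc \<Longrightarrow> compact K \<Longrightarrow> uniform_limit K Fs F sequentially"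
    "\<And>n. norm (\<Phi> (Fs n)) \<le> C"
  shows "norm (\<Phi> F) \<le> C"
proof -
  have "(\<lambda>n. \<Phi> (Fs n)) \<longlonglongrightarrow> \<Phi> F"
    by (rule calculus_tendsto[OF assms(1-3)])
  then show ?thesis
    by (rule Lim_bounded[OF tendsto_norm, of _ _ 0]) (intro allI impI assms(4))
qed

end

text \<open>One identity for two uses: with all \<open>v j\<close> equal to \<open>1\<close> it
  expresses that \<open>A\<close> is a contraction on scalar columns, with arbitrary vectors the
  same for columns of vectors.\<close>

lemma defect_form:
  fixes A :: "'i \<Rightarrow> 'i \<Rightarrow> complex" and v :: "'i \<Rightarrow> 'a::complex_hilbert"
  assumes "finite I"
  shows "(\<Sum>j\<in>I. \<Sum>k\<in>I. ((if j = k then 1 else 0) - (\<Sum>i\<in>I. A i j * cnj (A i k))) * cinner (v j)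
      (v k) * c j * cnj (c k))
      = of_real ((\<Sum>j\<in>I. (norm (scaleC (c j) (v j)))\<^sup>2) -
          (\<Sum>i\<in>I. (norm (\<Sum>j\<in>I. scaleC (A i j) (scaleC (c j) (v j))))\<^sup>2))"
proof -
  let ?w = "\<lambda>j. scaleC (c j) (v j)"
  have "(\<Sum>j\<in>I. \<Sum>k\<in>I. ((if j = k then 1 else 0) - (\<Sum>i\<in>I. A i j * cnj (A i k))) * cinner (v j)
      (v k) * c j * cnj (c k)) = (\<Sum>j\<in>I. \<Sum>k\<in>I.
          ((if j = k then 1 else 0) - (\<Sum>i\<in>I. A i j * cnj (A i k))) * cinner (?w j) (?w k))"
    by (intro sum.cong refl) (simp add: cinner_linear)
  also have "\<dots> = (\<Sum>j\<in>I. \<Sum>k\<in>I. (if j = k then 1 else 0) * cinner (?w j) (?w k))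
      - (\<Sum>j\<in>I. \<Sum>k\<in>I. \<Sum>i\<in>I. A i j * cnj (A i k) * cinner (?w j) (?w k))"
    unfolding left_diff_distrib sum_subtractf sum_distrib_right ..
  also have "(\<Sum>j\<in>I. \<Sum>k\<in>I. (if j = k then 1 else 0) * cinner (?w j) (?w k)) =
      (\<Sum>j\<in>I. cinner (?w j) (?w j))"
    using assms by (intro sum.cong refl) (simp add: if_distrib[of "\<lambda>x. x * _"] cong: if_cong)
  also have "(\<Sum>j\<in>I. \<Sum>k\<in>I. \<Sum>i\<in>I. A i j * cnj (A i k) * cinner (?w j) (?w k))
      = (\<Sum>j\<in>I. \<Sum>i\<in>I. \<Sum>k\<in>I. A i j * cnj (A i k) * cinner (?w j) (?w k))"
    by (intro sum.cong refl sum.swap)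
  also have "\<dots> = (\<Sum>i\<in>I. \<Sum>j\<in>I. \<Sum>k\<in>I. A i j * cnj (A i k) * cinner (?w j) (?w k))"
    by (rule sum.swap)
  also have "\<dots> = (\<Sum>i\<in>I. cinner (\<Sum>j\<in>I. scaleC (A i j) (?w j)) (\<Sum>j\<in>I. scaleC (A i j) (?w j)))"
  proof (rule sum.cong[OF refl])
    fix i
    show "(\<Sum>j\<in>I. \<Sum>k\<in>I. A i j * cnj (A i k) * cinner (?w j) (?w k))
        = cinner (\<Sum>j\<in>I. scaleC (A i j) (?w j)) (\<Sum>j\<in>I. scaleC (A i j) (?w j))"
      unfolding cinner_sum_left unfolding cinner_sum_right
      by (intro sum.cong refl) (simp only: cinner_scaleC_left[of "A i _"]
          cinner_scaleC_right[of _ "A i _"] mult.assoc mult.left_commute)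
  qed
  finally show ?thesis
    by (simp only: cinner_self of_real_diff of_real_sum)
qed

text \<open>Pair the defect matrix with the Gram matrix of the vectors and apply the Schur product theorem.\<close>

lemma matrix_contraction_vectors:
  fixes A :: "'i \<Rightarrow> 'i \<Rightarrow> complex" and y :: "'i \<Rightarrow> 'h::complex_hilbert"
  assumes "finite I"
    and "\<And>c. (\<Sum>i\<in>I. (cmod (\<Sum>j\<in>I. A i j * c j))\<^sup>2) \<le> (\<Sum>j\<in>I. (cmod (c j))\<^sup>2)"
  shows "(\<Sum>i\<in>I. (norm (\<Sum>j\<in>I. scaleC (A i j) (y j)))\<^sup>2) \<le> (\<Sum>j\<in>I. (norm (y j))\<^sup>2)"
proof -
  let ?P = "\<lambda>j k. (if j = k then 1 else 0) - (\<Sum>i\<in>I. A i j * cnj (A i k))"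
  have "psd_kernel_on I ?P"
  proof -
    have "(\<Sum>j\<in>I. \<Sum>k\<in>I. ?P j k * c j * cnj (c k)) \<in> \<real>\<^sub>\<ge>\<^sub>0" for c
      using defect_form[OF assms(1), where v = "\<lambda>_. 1 :: complex" and c = c and A = A]
          assms(2)[of c]
      by (simp add: cinner_complex_def scaleC_complex_def del: of_real_diff of_real_sum
          of_real_power)
    then show ?thesis
      unfolding psd_kernel_on_finite[OF assms(1)] by (rule allI)
  qed
  then have "psd_kernel_on I (\<lambda>j k. ?P j k * cinner (y j) (y k))"
    by (rule psd_kernel_on_mult) (rule psd_kernel_on_cinner)
  then have "(\<Sum>j\<in>I. \<Sum>k\<in>I. ?P j k * cinner (y j) (y k) * 1 * cnj 1) \<in> \<real>\<^sub>\<ge>\<^sub>0"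
    unfolding psd_kernel_on_finite[OF assms(1)] by (elim allE[of _ "\<lambda>_. 1"])
  then show ?thesis
    unfolding defect_form[OF assms(1)] by (simp del: of_real_diff of_real_sum of_real_power)
qed

text \<open>The maps share the Lipschitz constant \<open>1\<close>, so convergence at the centres of
  a finite cover by balls of radius \<open>\<epsilon> / 3\<close> spreads to the whole compact
  set.\<close>

lemma uniform_convergence_on_compact:
  fixes P :: "nat \<Rightarrow> 'a::real_normed_vector \<Rightarrow> 'a"
  assumes "compact C" and conv: "\<And>x. x \<in> C \<Longrightarrow> (\<lambda>n. P n x) \<longlonglongrightarrow> x"
    and lipschitz: "\<And>n x y. norm (P n x - P n y) \<le> norm (x - y)"
  shows "uniform_limit C P (\<lambda>x. x) sequentially"
proof (rule uniform_limitI)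
  fix \<epsilon> :: real assume "\<epsilon> > 0"
  then have "C \<subseteq> (\<Union>x\<in>C. ball x (\<epsilon> / 3))"
    by auto
  then obtain X where X: "X \<subseteq> C" "finite X" "C \<subseteq> (\<Union>x\<in>X. ball x (\<epsilon> / 3))"
    by (rule compactE_image[OF assms(1) open_ball])
  have "\<forall>\<^sub>F n in sequentially. \<forall>x\<in>X. dist (P n x) x < \<epsilon> / 3"
  proof (intro eventually_ball_finite ballI)
    fix x assume "x \<in> X"
    then have "(\<lambda>n. P n x) \<longlonglongrightarrow> x"
      using X(1) by (intro conv) blast
    then show "\<forall>\<^sub>F n in sequentially. dist (P n x) x < \<epsilon> / 3"
      by (rule tendstoD) (use \<open>\<epsilon> > 0\<close> in simp)
  qed (rule X(2))
  then show "\<forall>\<^sub>F n in sequentially. \<forall>x\<in>C. dist (P n x) x < \<epsilon>"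
  proof eventually_elim
    case (elim n)
    show ?case
    proof
      fix y assume "y \<in> C"
      then obtain x where x: "x \<in> X" "dist x y < \<epsilon> / 3"
        using X(3) by auto
      have "dist (P n y) y \<le> dist (P n y) (P n x) + dist (P n x) x + dist x y"
        using dist_triangle[of "P n y" y "P n x"] dist_triangle[of "P n x" y x] by linarith
      moreover have "dist (P n y) (P n x) \<le> dist x y"
        using lipschitz[of n y x] by (simp add: dist_norm norm_minus_commute)
      ultimately show "dist (P n y) y < \<epsilon>"
        using elim x by fastforce
    qed
  qed
qed

lemma compact_polydisc_radius:
  assumes "compact K" "K \<subseteq> (polydisc :: (complex ^ 'm::finite) set)"
  obtains r where "r < 1" "\<And>z l. z \<in> K \<Longrightarrow> cmod (z $ l) \<le> r"
proof (cases "K = {}")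
  case False
  have "\<exists>r<1. \<forall>z\<in>K. cmod (z $ l) \<le> r" for l
  proof -
    obtain w where "w \<in> K" "\<forall>z\<in>K. cmod (z $ l) \<le> cmod (w $ l)"
    proof -
      have "continuous_on K (\<lambda>z. cmod (z $ l))"
        by (intro continuous_intros)
      then show thesis
        using continuous_attains_sup[OF assms(1) False] that by blast
    qed
    then show ?thesis
      using assms(2) by (auto simp: polydisc_def)
  qed
  then obtain r where r: "\<And>l. r l < 1" "\<And>l z. z \<in> K \<Longrightarrow> cmod (z $ l) \<le> r l"
    by metis
  show thesis
  proof (rule that[of "Max (range r)"])
    show "Max (range r) < 1"
      using r(1) by (subst Max_less_iff) auto
    show "cmod (z $ l) \<le> Max (range r)" if "z \<in> K" for z l
      using r(2)[OF that, of l] by (rule order_trans) (rule Max_ge, auto)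
  qed
qed (use that[of 0] in simp)

section \<open>Truncation to finitely many coordinates\<close>

definition trunc :: "(nat \<Rightarrow> 'h::complex_hilbert) \<Rightarrow> nat \<Rightarrow> 'h ^ 'm \<Rightarrow> 'h ^ 'm" where
  "trunc e n v = (\<chi> l. \<Sum>k<n. scaleC (cinner (v $ l) (e k)) (e k))"

lemma trunc_add: "trunc e n (v + w) = trunc e n v + trunc e n w"
  by (simp add: trunc_def Finite_Cartesian_Product.vec_eq_iff cinner_add_left scaleC_add_left
      sum.distrib)

lemma trunc_scaleC: "trunc e n (scaleC c v) = scaleC c (trunc e n v)"
  by (simp add: trunc_def Finite_Cartesian_Product.vec_eq_iff cinner_scaleC_left
      scaleC_scaleC[symmetric] scaleC_sum_right)

lemma trunc_diff: "trunc e n (v - w) = trunc e n v - trunc e n w"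
  using trunc_add[of e n "v - w" w] by simp

context
  fixes e :: "nat \<Rightarrow> 'h::complex_hilbert"
  assumes e: "orthonormal_or_zero e"
begin

lemma norm_trunc_nth: "(norm (trunc e n v $ l))\<^sup>2 = (\<Sum>k<n. (cmod (cinner (v $ l) (e k)))\<^sup>2)"
  by (simp add: trunc_def norm_sum_orthonormal[OF e] orthonormal_or_zero_mult_self(2)[OF e])

lemma norm_trunc_le: "norm (trunc e n v) \<le> norm v"
proof (rule norm_vec_mono)
  fix l
  have "(norm (trunc e n v $ l))\<^sup>2 \<le> (norm (v $ l))\<^sup>2"
    unfolding norm_trunc_nth by (rule bessel_finite[OF e])
  then show "norm (trunc e n v $ l) \<le> norm (v $ l)"
    by (rule power2_le_imp_le) simp
qed

lemma trunc_tendsto: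
  assumes "v \<in> direct_sum (\<lambda>_. sequence_span e)"
  shows "(\<lambda>n. trunc e n v) \<longlonglongrightarrow> v"
proof (rule vec_tendstoI)
  fix l
  show "(\<lambda>n. trunc e n v $ l) \<longlonglongrightarrow> v $ l"
    using osum_sums[OF e e, of "v $ l"] assms by
        (simp add: trunc_def direct_sum_def sequence_span_def)
qed

lemma cinner_trunc:
  assumes "k < n"
  shows "cinner (trunc e n v $ l) (e k) = cinner (v $ l) (e k)"
proof -
  have "cinner (trunc e n v $ l) (e k) = (\<Sum>j<n. if j = k then cinner (v $ l) (e k) else 0)"
    unfolding trunc_def vec_lambda_beta cinner_sum_left cinner_scaleC_left
    using orthonormal_or_zeroD(1)[OF e] orthonormal_or_zero_mult_self(1)[OF e]
    by (intro sum.cong) auto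
  then show ?thesis
    using assms by simp
qed

lemma trunc_idem: "trunc e n (trunc e n v) = trunc e n v"
  by (subst (1 3) trunc_def) (simp add: Finite_Cartesian_Product.vec_eq_iff cinner_trunc)

end

lemma sum_insert_None: "finite J \<Longrightarrow> sum g (insert None (Some ` J)) = g None + (\<Sum>j\<in>J. g (Some j))"
  by (simp add: sum.reindex)

lemma sum_Times_fst_snd: "(\<Sum>j\<in>A \<times> B. g (fst j) (snd j)) = (\<Sum>l\<in>A. \<Sum>k\<in>B. g l k)"
  by (simp add: sum.cartesian_product case_prod_beta)

locale sequence_colligation = contractive_colligation M a \<beta> \<gamma> D
  for M :: "('h::complex_hilbert ^ 'm::finite) set" and a \<beta> \<gamma> D +
  fixes e :: "nat \<Rightarrow> 'h"
  assumes e: "orthonormal_or_zero e" and norm_e: "\<And>k. norm (e k) = 1"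
    and M_eq: "M = direct_sum (\<lambda>_. sequence_span e)"
begin

lemma trunc_in_M: "trunc e n v \<in> M"
  unfolding M_eq direct_sum_def trunc_def
  by (auto intro!: closed_csubspace_csum[OF closed_sequence_span[OF e norm_e]]
      e_in_sequence_span[OF e norm_e])

text \<open>Only the state output, that is \<open>\<gamma>\<close> and \<open>D\<close>, is
  truncated. The new states then lie in the range of the truncation automatically, so finitely many
  coordinates capture them completely.\<close>

lemma truncated: "contractive_colligation M a \<beta> (trunc e n \<gamma>) (\<lambda>v. trunc e n (D v))"
proof
  show "norm (colligation a \<beta> (trunc e n \<gamma>) (\<lambda>v. trunc e n (D v)) (c, x)) \<le> norm (c, x)" for c x
  proof -
    have "colligation a \<beta> (trunc e n \<gamma>) (\<lambda>v. trunc e n (D v)) (c, x)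
        = (a * c + cinner x \<beta>, trunc e n (scaleC c \<gamma> + D x))"
      by (simp add: colligation_def trunc_add trunc_scaleC)
    moreover have "norm (a * c + cinner x \<beta>, trunc e n (scaleC c \<gamma> + D x)) \<le> norm
        (colligation a \<beta> \<gamma> D (c, x))"
      unfolding colligation_def norm_prod_def using norm_trunc_le[OF e] by (auto intro!: power_mono)
    ultimately show ?thesis
      using contraction[of c x] by simp
  qed
qed (auto simp: closed_M zop_M trunc_in_M D_add D_scaleC trunc_add trunc_scaleC)

context
  fixes n :: nat
begin

interpretation tr: contractive_colligation M a \<beta> "trunc e n \<gamma>" "\<lambda>v. trunc e n (D v)"
  by (rule truncated)

text \<open>The difference of the two states solves the truncated equation with right-hand side
  \<open>trunc e n (state z) - state z\<close>. The error is thus governed by how well the exact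
  state is approximated.\<close>

lemma transfer_truncated_diff:
  assumes "z \<in> polydisc" "r < 1" "\<And>l. cmod (z $ l) \<le> r"
  shows "cmod (tr.transfer z - transfer z) \<le> norm (trunc e n (state z) - state z) *
      (norm \<beta> / (1 - r))"
proof -
  let ?d = "tr.state z - state z"
  have "trunc e n (D (zop z (tr.state z))) = tr.state z - trunc e n \<gamma>"
    using tr.solution(2)[OF assms(1) tr.\<gamma>_M] by (metis add_diff_cancel_left')
  moreover have "trunc e n (D (zop z (state z))) = trunc e n (state z) - trunc e n \<gamma>"
    using solution(2)[OF assms(1) \<gamma>_M] by (metis add_diff_cancel_left' trunc_diff)
  ultimately have "?d = (trunc e n (state z) - state z) + trunc e n (D (zop z ?d))"
    by (simp add: zop_diff_right D_diff trunc_diff)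
  then have "norm ?d \<le> norm (trunc e n (state z) - state z) / (1 - r)"
    by (rule tr.norm_solution_le[OF _ assms(2,3)])
  moreover have "tr.transfer z - transfer z = cinner (zop z ?d) \<beta>"
    by (simp add: tr.transfer_def transfer_def zop_diff_right cinner_diff_left)
  moreover have "cmod (cinner (zop z ?d) \<beta>) \<le> norm ?d * norm \<beta>"
  proof -
    have "norm (zop z ?d) \<le> 1 * norm ?d"
      using assms(2,3) by (intro norm_zop_le) (meson less_imp_le order_trans)
    then show ?thesis
      using cinner_norm_le[of "zop z ?d" \<beta>] mult_right_mono[of "norm (zop z ?d)" "norm ?d" "norm \<beta>"]
          by simp
  qed
  ultimately have "cmod (tr.transfer z - transfer z) \<le> norm (trunc e n (state z) - state z) /
      (1 - r) * norm \<beta>"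
    using mult_right_mono[of "norm ?d" _ "norm \<beta>"] by fastforce
  then show ?thesis
    by simp
qed

text \<open>On the polydisc the functions \<open>G i\<close> are obtained from the functions
  \<open>Y j\<close> by the constant contraction matrix \<open>A\<close>, and the calculus carries
  this relation over to vectors. As \<open>Y (Some j)\<close> is a coordinate times
  \<open>G (Some j)\<close>, the bound \<open>norm (T l) \<le> 1\<close> closes the feedback
  loop.\<close>

lemma norm_calculus_truncated_le:
  fixes T :: "'m \<Rightarrow> 'k::complex_hilbert \<Rightarrow>\<^sub>L 'k"
  assumes calc: "functional_calculus T \<Phi>" and T: "\<And>l. norm (T l) \<le> 1"
  shows "norm (\<Phi> tr.transfer) \<le> 1"
proof -
  define J where "J = (UNIV :: 'm set) \<times> {..<n}"
  \<comment> \<open>\<open>None\<close> indexes the scalar channel, \<open>Some (l, k)\<close> the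
    coordinate of the state along \<open>e k\<close> in component \<open>l\<close>.\<close>
  define I where "I = insert None (Some ` J)"
  have [simp]: "finite J" "finite I"
    by (auto simp: J_def I_def)
  note sum_I = sum_insert_None[OF \<open>finite J\<close>, folded I_def]
  note sum_J = sum_Times_fst_snd[of _ "UNIV :: 'm set" "{..<n}", folded J_def]
  define b :: "'m \<times> nat \<Rightarrow> 'h ^ 'm" where "b j = axis (fst j) (e (snd j))" for j
  have cinner_b: "cinner v (b j) = cinner (v $ fst j) (e (snd j))" for v j
    by (simp add: b_def axis_def cinner_vec_def if_distrib[of "cinner _"] cong: if_cong)
  have trunc_b: "trunc e n v = (\<Sum>j\<in>J. scaleC (cinner v (b j)) (b j))" for v
  proof -
    have "(\<Sum>j\<in>J. scaleC (cinner v (b j)) (b j)) =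
        (\<Sum>l\<in>UNIV. \<Sum>k<n. scaleC (cinner (v $ l) (e k)) (axis l (e k)))"
      unfolding cinner_b unfolding b_def by (rule sum_J)
    moreover have "(\<Sum>l\<in>UNIV. \<Sum>k<n. scaleC (cinner (v $ l) (e k)) (axis l (e k))) $ i
        = trunc e n v $ i" for i
    proof -
      have "(\<Sum>l\<in>UNIV. \<Sum>k<n. scaleC (cinner (v $ l) (e k)) (axis l (e k))) $ i
          = (\<Sum>l\<in>UNIV. if l = i then \<Sum>k<n. scaleC (cinner (v $ i) (e k)) (e k) else 0)"
        unfolding sum_component by (intro sum.cong refl) (auto simp: axis_def)
      then show ?thesis
        by (simp add: trunc_def)
    qed
    ultimately show ?thesis
      by (simp add: Finite_Cartesian_Product.vec_eq_iff)
  qed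
  have bessel_b: "(\<Sum>j\<in>J. (cmod (cinner v (b j)))\<^sup>2) \<le> (norm v)\<^sup>2" for v
  proof -
    have "(\<Sum>j\<in>J. (cmod (cinner v (b j)))\<^sup>2) = (norm (trunc e n v))\<^sup>2"
      unfolding cinner_b norm_vec_power2 norm_trunc_nth[OF e] by (rule sum_J)
    then show ?thesis
      using norm_trunc_le[OF e, of n v] by (simp add: power_mono)
  qed
  have norm_b: "(norm (\<Sum>j\<in>J. scaleC (c j) (b j)))\<^sup>2 = (\<Sum>j\<in>J. (cmod (c j))\<^sup>2)" for c
  proof -
    have orth: "cinner (b i) (b j) = 0" if "i \<noteq> j" for i j
      using that orthonormal_or_zeroD(1)[OF e, of "snd i" "snd j"]
      unfolding cinner_b by (auto simp: b_def axis_def prod_eq_iff)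
    have "cinner (b j) (b j) = 1" for j
      unfolding cinner_b by (simp add: b_def cinner_self norm_e)
    then have "norm (b j) = 1" for j
      by (intro power2_eq_imp_eq[of _ 1]) (simp_all add: norm_power2_cinner)
    then show ?thesis
      by (subst norm_sum_orthogonal) (simp_all add: cinner_linear orth power_mult_distrib)
  qed
  define A where "A i j = (case i of
      None \<Rightarrow> (case j of None \<Rightarrow> a | Some j \<Rightarrow> cinner (b j) \<beta>)
    | Some i \<Rightarrow> (case j of None \<Rightarrow> cinner \<gamma> (b i) | Some j \<Rightarrow> cinner (D (b j)) (b i)))" for i j
  have A_contraction: "(\<Sum>i\<in>I. (cmod (\<Sum>j\<in>I. A i j * c j))\<^sup>2) \<le> (\<Sum>j\<in>I. (cmod (c j))\<^sup>2)" for c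
  proof -
    define v where "v = (\<Sum>j\<in>J. scaleC (c (Some j)) (b j))"
    have Dv: "D v = (\<Sum>j\<in>J. scaleC (c (Some j)) (D (b j)))"
      unfolding v_def by (rule clinear_sum_scaleC[OF D_add D_scaleC])
    have "(\<Sum>j\<in>I. A None j * c j) = a * c None + cinner v \<beta>"
      unfolding sum_I v_def cinner_sum_left cinner_scaleC_left by (simp add: A_def mult.commute)
    moreover have "(\<Sum>j\<in>I. A (Some i) j * c j) = cinner (scaleC (c None) \<gamma> + D v) (b i)" for i
      unfolding sum_I Dv cinner_add_left cinner_sum_left cinner_scaleC_left by
          (simp add: A_def mult.commute)
    ultimately have "(\<Sum>i\<in>I. (cmod (\<Sum>j\<in>I. A i j * c j))\<^sup>2)
        = (cmod (a * c None + cinner v \<beta>))\<^sup>2 +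
            (\<Sum>i\<in>J. (cmod (cinner (scaleC (c None) \<gamma> + D v) (b i)))\<^sup>2)"
      unfolding sum_I[of "\<lambda>i. (cmod (\<Sum>j\<in>I. A i j * c j))\<^sup>2"] by simp
    also have "\<dots> \<le> (norm (colligation a \<beta> \<gamma> D (c None, v)))\<^sup>2"
      unfolding colligation_def prod.case norm_prod_power2 fst_conv snd_conv by
          (intro add_left_mono bessel_b)
    also have "\<dots> \<le> (norm (c None, v))\<^sup>2"
      using contraction by (intro power_mono) auto
    also have "\<dots> = (\<Sum>j\<in>I. (cmod (c j))\<^sup>2)"
      unfolding norm_prod_power2 fst_conv snd_conv v_def norm_b sum_I ..
    finally show ?thesis .
  qed
  define G where "G i = (case i of None \<Rightarrow> tr.transfer | Some i \<Rightarrow> (\<lambda>z. cinner (tr.state z) (b i)))"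
      for i
  define Y where "Y j = (case j of None \<Rightarrow> (\<lambda>_. 1) | Some j \<Rightarrow> (\<lambda>z. z $ fst j * G (Some j) z))" for j
  have G_holo: "G i \<in> holo polydisc" for i
    by (auto simp: G_def tr.transfer_holo tr.state_component_holo split: option.split)
  have Y_holo: "Y j \<in> holo polydisc" for j
    by (auto simp: Y_def holo_const intro!: holo_mult holo_coordinate G_holo split: option.split)
  have G_eq: "G i z = (\<Sum>j\<in>I. A i j * Y j z)" if z: "z \<in> polydisc" and i: "i \<in> I" for i z
  proof -
    have state: "tr.state z = trunc e n \<gamma> + trunc e n (D (zop z (tr.state z)))"
      using tr.solution(2)[OF z tr.\<gamma>_M] .
    then have "trunc e n (tr.state z) = tr.state z"
      by (metis trunc_add trunc_idem[OF e])
    then have expand: "tr.state z = (\<Sum>j\<in>J. scaleC (G (Some j) z) (b j))"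
      by (simp add: G_def trunc_b[symmetric])
    have "zop z (b j) = scaleC (z $ fst j) (b j)" for j
      by (simp add: b_def axis_def Finite_Cartesian_Product.vec_eq_iff)
    then have zop: "zop z (tr.state z) = (\<Sum>j\<in>J. scaleC (Y (Some j) z) (b j))"
      by (subst expand, subst clinear_sum_scaleC[OF zop_add_right zop_scaleC_right])
        (simp add: Y_def scaleC_scaleC mult.commute)
    show ?thesis
    proof (cases i)
      case None
      have "tr.transfer z = a + cinner (\<Sum>j\<in>J. scaleC (Y (Some j) z) (b j)) \<beta>"
        unfolding tr.transfer_def zop ..
      then show ?thesis
        unfolding None sum_I cinner_sum_left cinner_scaleC_left
        by (simp add: G_def A_def Y_def[of None] mult.commute)
    next
      case (Some k)
      then have "snd k < n"
        using i by (auto simp: I_def J_def)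
      then have "cinner (trunc e n v) (b k) = cinner v (b k)" for v
        unfolding cinner_b by (rule cinner_trunc[OF e])
      then have "cinner (tr.state z) (b k) = cinner \<gamma> (b k) + cinner (D (zop z (tr.state z))) (b k)"
        by (subst state) (simp add: cinner_add_left)
      also have "D (zop z (tr.state z)) = (\<Sum>j\<in>J. scaleC (Y (Some j) z) (D (b j)))"
        unfolding zop by (rule clinear_sum_scaleC[OF D_add D_scaleC])
      finally show ?thesis
        unfolding Some sum_I cinner_sum_left cinner_scaleC_left
        by (simp add: G_def A_def Y_def[of None] mult.commute)
    qed
  qed
  have "norm (blinfun_apply (\<Phi> tr.transfer) x) \<le> 1 * norm x" for x
  proof -
    define y where "y j = blinfun_apply (\<Phi> (Y j)) x" for j
    have AY_holo: "(\<lambda>z. A i j * Y j z) \<in> holo polydisc" for i j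
      by (intro holo_mult holo_const Y_holo)
    have \<Phi>_G: "blinfun_apply (\<Phi> (G i)) x = (\<Sum>j\<in>I. scaleC (A i j) (y j))" if "i \<in> I" for i
    proof -
      have "\<Phi> (G i) = \<Phi> (\<lambda>z. \<Sum>j\<in>I. A i j * Y j z)"
        using G_eq that by (intro calculus_cong[OF calc] G_holo holo_sum AY_holo)
      then have "blinfun_apply (\<Phi> (G i)) x = (\<Sum>j\<in>I. blinfun_apply (\<Phi> (\<lambda>z. A i j * Y j z)) x)"
        by (simp add: calculus_sum[OF calc _ AY_holo])
      then show ?thesis
        by (simp add: calculus_mult[OF calc holo_const Y_holo] calculus_const[OF calc] y_def)
    qed
    have y_le: "(norm (y (Some j)))\<^sup>2 \<le> (norm (blinfun_apply (\<Phi> (G (Some j))) x))\<^sup>2" for j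
    proof -
      let ?g = "blinfun_apply (\<Phi> (G (Some j))) x"
      have "y (Some j) = blinfun_apply (T (fst j)) ?g"
        unfolding y_def Y_def
        by (simp add: calculus_mult[OF calc holo_coordinate G_holo] calculus_coordinate[OF calc])
      moreover have "norm (blinfun_apply (T (fst j)) ?g) \<le> 1 * norm ?g"
        by (rule order_trans[OF norm_blinfun mult_right_mono[OF T norm_ge_zero]])
      ultimately show ?thesis
        by (simp add: power_mono)
    qed
    have "(\<Sum>i\<in>I. (norm (blinfun_apply (\<Phi> (G i)) x))\<^sup>2) \<le> (\<Sum>j\<in>I. (norm (y j))\<^sup>2)"
      using matrix_contraction_vectors[OF \<open>finite I\<close> A_contraction, of y] by (simp add: \<Phi>_G)
    also have "\<dots> \<le> (norm x)\<^sup>2 + (\<Sum>j\<in>J. (norm (blinfun_apply (\<Phi> (G (Some j))) x))\<^sup>2)"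
      unfolding sum_I using y_le by (intro add_mono sum_mono)
          (simp_all add: y_def Y_def calculus_const[OF calc])
    \<comment> \<open>The terms with index \<open>Some j\<close> occur on both sides and cancel;
      what is left concerns the transfer function alone.\<close>
    finally have "(norm (blinfun_apply (\<Phi> tr.transfer) x))\<^sup>2 \<le> (norm x)\<^sup>2"
      unfolding sum_I by (simp add: G_def)
    from power2_le_imp_le[OF this norm_ge_zero] show ?thesis
      by simp
  qed
  then show ?thesis
    by (intro norm_blinfun_bound) simp_all
qed

end

text \<open>The states over a compact \<open>K\<close> form a compact set, on which the truncations
  converge uniformly. Hence the transfer functions converge locally uniformly, and the bound passes
  to the limit by continuity of the calculus.\<close>

theorem norm_calculus_transfer_le:
  fixes T :: "'m \<Rightarrow> 'k::complex_hilbert \<Rightarrow>\<^sub>L 'k"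
  assumes calc: "functional_calculus T \<Phi>" and T: "\<And>l. norm (T l) \<le> 1"
  shows "norm (\<Phi> transfer) \<le> 1"
proof (rule calculus_limit[OF calc transfer_holo])
  let ?D = "\<lambda>n v. trunc e n (D v)" and ?\<gamma> = "\<lambda>n. trunc e n \<gamma>"
  let ?F = "\<lambda>n. contractive_colligation.transfer M a \<beta> (?\<gamma> n) (?D n)"
  show "?F n \<in> holo polydisc" for n
    by (rule contractive_colligation.transfer_holo[OF truncated])
  show "norm (\<Phi> (?F n)) \<le> 1" for n
    by (rule norm_calculus_truncated_le[OF calc T])
  fix K :: "(complex ^ 'm) set" assume K: "K \<subseteq> polydisc" "compact K"
  obtain r where r: "r < 1" "\<And>z l. z \<in> K \<Longrightarrow> cmod (z $ l) \<le> r"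
    using compact_polydisc_radius[OF K(2,1)] by blast
  have "continuous_on K state"
    using state_has_derivative(1) K(1)
    by (intro continuous_at_imp_continuous_on ballI has_derivative_continuous) blast
  then have "compact (state ` K)"
    using K(2) by (rule compact_continuous_image)
  then have "uniform_limit (state ` K) (trunc e) (\<lambda>v. v) sequentially"
  proof (rule uniform_convergence_on_compact)
    show "(\<lambda>n. trunc e n v) \<longlonglongrightarrow> v" if "v \<in> state ` K" for v
      using that solution(1)[OF _ \<gamma>_M] K(1) unfolding M_eq by (intro trunc_tendsto[OF e]) blast
    show "norm (trunc e n v - trunc e n w) \<le> norm (v - w)" for n and v w :: "'h ^ 'm"
      unfolding trunc_diff[symmetric] by (rule norm_trunc_le[OF e])
  qed
  then have unif: "uniform_limit K (\<lambda>n z. trunc e n (state z)) state sequentially"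
    by (simp add: uniform_limit_iff)
  show "uniform_limit K ?F transfer sequentially"
  proof (rule uniform_limitI)
    fix \<epsilon> :: real assume "\<epsilon> > 0"
    define C where "C = norm \<beta> / (1 - r)"
    have "C \<ge> 0"
      using r(1) by (simp add: C_def)
    \<comment> \<open>The denominator \<open>C + 1\<close> covers the case
      \<open>\<beta> = 0\<close>, in which \<open>C\<close> vanishes.\<close>
    have "\<forall>\<^sub>F n in sequentially. \<forall>z\<in>K. dist (trunc e n (state z)) (state z) < \<epsilon> / (C + 1)"
      using unif \<open>\<epsilon> > 0\<close> \<open>C \<ge> 0\<close> by (intro uniform_limitD) auto
    then show "\<forall>\<^sub>F n in sequentially. \<forall>z\<in>K. dist (?F n z) (transfer z) < \<epsilon>"
    proof eventually_elim
      case (elim n)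
      show ?case
      proof
        fix z assume z: "z \<in> K"
        have "dist (?F n z) (transfer z) \<le> norm (trunc e n (state z) - state z) * C"
          unfolding dist_norm C_def using z K(1) by (intro transfer_truncated_diff r) auto
        also have "\<dots> \<le> \<epsilon> / (C + 1) * C"
          using elim z \<open>C \<ge> 0\<close> by (intro mult_right_mono) (auto simp: dist_norm intro: less_imp_le)
        also have "\<dots> < \<epsilon>"
          using \<open>\<epsilon> > 0\<close> \<open>C \<ge> 0\<close> by (simp add: field_simps)
        finally show "dist (?F n z) (transfer z) < \<epsilon>" .
      qed
    qed
  qed
qed

end

section \<open>Exactness of the Koszul complex\<close>

definition koszul_sign :: "'m::linorder \<Rightarrow> 'm set \<Rightarrow> real" where
  "koszul_sign i S = (-1) ^ card {j\<in>S. j < i}"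

lemma koszul_sign_square: "koszul_sign i S * koszul_sign i S = 1"
  by (simp add: koszul_sign_def power_add[symmetric])

lemma koszul_sign_delete_greater:
  "i \<le> j \<Longrightarrow> koszul_sign i (S - {j}) = koszul_sign i S" for i :: "'m::linorder"
  unfolding koszul_sign_def by (rule arg_cong[where f = "\<lambda>A. (-1) ^ card A"]) auto

lemma koszul_sign_delete_less:
  assumes "i < j" "i \<in> S" "finite (S :: 'm::linorder set)"
  shows "koszul_sign j (S - {i}) = - koszul_sign j S"
proof -
  have "{k\<in>S. k < j} = insert i {k\<in>S - {i}. k < j}"
    using assms by auto
  then have "card {k\<in>S. k < j} = Suc (card {k\<in>S - {i}. k < j})"
    using assms(3) by simp
  then show ?thesis
    by (simp add: koszul_sign_def)
qed

lemma koszul_sign_swap: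
  assumes "i \<noteq> j" "i \<in> S" "j \<in> S" "finite (S :: 'm::linorder set)"
  shows "koszul_sign i S * koszul_sign j (S - {i}) = - (koszul_sign j S * koszul_sign i (S - {j}))"
  using assms koszul_sign_delete_less[of i j S] koszul_sign_delete_less[of j i S]
    koszul_sign_delete_greater[of i j S] koszul_sign_delete_greater[of j i S]
  by (cases i j rule: linorder_cases) auto

context
  fixes A :: "'m::{finite,linorder} \<Rightarrow> 'h \<Rightarrow> 'h::real_vector"
  assumes lin: "\<And>i. linear (A i)" and commute: "\<And>i j x. A i (A j x) = A j (A i x)"
begin

lemma koszul_eq: "koszul A \<phi> S = (\<Sum>i\<in>S. koszul_sign i S *\<^sub>R A i (\<phi> (S - {i})))"
  by (simp add: koszul_def koszul_sign_def)

text \<open>Removing \<open>i\<close> and \<open>j\<close> in either order gives opposite signs and,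
  by commutativity, the same operators. Exchanging the summation indices shows that the double sum
  equals its own negative.\<close>

lemma koszul_koszul: "koszul A (koszul A \<phi>) = (\<lambda>_. 0)"
proof
  fix S :: "'m set"
  let ?t = "\<lambda>i j. (koszul_sign i S * koszul_sign j (S - {i})) *\<^sub>R A i (A j (\<phi> (S - {i} - {j})))"
  let ?P = "SIGMA i:S. S - {i}"
  have swap: "?t i j = - ?t j i" if "i \<in> S" "j \<in> S" "i \<noteq> j" for i j
    using koszul_sign_swap[of i j S] that commute[of i j]
    by (simp add: insert_commute Diff_insert[symmetric])
  have "koszul A (koszul A \<phi>) S = (\<Sum>i\<in>S. \<Sum>j\<in>S - {i}. ?t i j)"
    by (simp add: koszul_eq linear_sum[OF lin] linear_scale[OF lin] scaleR_sum_right)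
  also have "\<dots> = (\<Sum>(i, j)\<in>?P. ?t i j)"
    by (simp add: sum.Sigma)
  finally have sum: "koszul A (koszul A \<phi>) S = (\<Sum>(i, j)\<in>?P. ?t i j)" .
  also have "\<dots> = (\<Sum>(i, j)\<in>?P. ?t j i)"
    by (rule sum.reindex_bij_witness[of _ prod.swap prod.swap]) auto
  also have "\<dots> = (\<Sum>(i, j)\<in>?P. - ?t i j)"
    using swap by (intro sum.cong refl) auto
  also have "\<dots> = - (\<Sum>(i, j)\<in>?P. ?t i j)"
    by (simp add: sum_negf case_prod_beta)
  finally have "koszul A (koszul A \<phi>) S = - koszul A (koszul A \<phi>) S"
    using sum by simp
  then have "koszul A (koszul A \<phi>) S + koszul A (koszul A \<phi>) S = 0"
    by (metis add.right_inverse)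
  then show "koszul A (koszul A \<phi>) S = 0"
    by (simp add: scaleR_2[symmetric])
qed

text \<open>Contracting with an inverse of one operator gives a homotopy from the identity to zero.\<close>

lemma koszul_exact:
  assumes B: "linear B" "\<And>x. A l (B x) = x" "\<And>x. B (A l x) = x"
  shows "{\<phi>. koszul A \<phi> = (\<lambda>_. 0)} = range (koszul A)"
proof -
  \<comment> \<open>Contraction with the basis vector of \<open>l\<close>, followed by the inverse
    of \<open>A l\<close>. The sign is that of removing \<open>l\<close> from
    \<open>insert l S\<close>.\<close>
  define h where "h \<psi> S = (if l \<in> S then 0 else koszul_sign l S *\<^sub>R B (\<psi> (insert l S)))"
      for \<psi> :: "'m set \<Rightarrow> 'h" and S
  have BA: "B (A i x) = A i (B x)" for i x
    using B(2,3) commute by metis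
  have homotopy: "koszul A (h \<psi>) S + h (koszul A \<psi>) S = \<psi> S" for \<psi> S
  proof (cases "l \<in> S")
    case True
    \<comment> \<open>In every term except \<open>i = l\<close>, \<open>h \<psi>\<close> is
      evaluated at a set containing \<open>l\<close>, where it is zero.\<close>
    have "koszul A (h \<psi>) S = (\<Sum>i\<in>S. if i = l then \<psi> S else 0)"
      unfolding koszul_eq
      using True B koszul_sign_square[of l S]
      by (intro sum.cong refl)
        (auto simp: h_def linear_0[OF lin] linear_scale[OF lin] insert_absorb
            koszul_sign_delete_greater)
    then show ?thesis
      using True by (simp add: h_def)
  next
    case False
    have ins: "koszul_sign l (insert l S) = koszul_sign l S"
      using koszul_sign_delete_greater[of l l "insert l S"] False by simp
    have "h (koszul A \<psi>) S = koszul_sign l S *\<^sub>R B (koszul A \<psi> (insert l S))"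
      using False by (simp add: h_def)
    also have "\<dots> = (\<Sum>i\<in>insert l S. (koszul_sign l S * koszul_sign i (insert l S)) *\<^sub>R B
        (A i (\<psi> (insert l S - {i}))))"
      unfolding koszul_eq by (simp only: linear_sum[OF B(1)] linear_scale[OF B(1)] scaleR_sum_right
          scaleR_scaleR)
    also have "\<dots> = \<psi> S + (\<Sum>i\<in>S. (koszul_sign l S * koszul_sign i (insert l S)) *\<^sub>R B
        (A i (\<psi> (insert l S - {i}))))"
      using False B(3) by (simp add: ins koszul_sign_square)
    \<comment> \<open>The term \<open>i = l\<close> has produced \<open>\<psi> S\<close>. The others
      are the negatives of those in \<open>koszul A (h \<psi>) S\<close>, since exchanging
      \<open>i\<close> and \<open>l\<close> flips the sign.\<close>
    also have "(\<Sum>i\<in>S. (koszul_sign l S * koszul_sign i (insert l S)) *\<^sub>R B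
        (A i (\<psi> (insert l S - {i}))))
        = (\<Sum>i\<in>S. - (koszul_sign i S *\<^sub>R A i (h \<psi> (S - {i}))))"
    proof (rule sum.cong[OF refl])
      fix i assume i: "i \<in> S"
      then have "i \<noteq> l" and S: "insert l S - {i} = insert l (S - {i})" "insert l S - {l} = S"
        using False by auto
      have "koszul_sign l S * koszul_sign i (insert l S) = -
          (koszul_sign i S * koszul_sign l (S - {i}))"
      proof (cases "i < l")
        case True
        then show ?thesis
          using koszul_sign_delete_less[of i l S] koszul_sign_delete_greater[of i l "insert l S"] i
              S(2) by simp
      next
        case False
        then show ?thesis
          using koszul_sign_delete_less[of l i "insert l S"] koszul_sign_delete_greater[of l i S]
              S(2) \<open>i \<noteq> l\<close> by simp
      qed
      then show "(koszul_sign l S * koszul_sign i (insert l S)) *\<^sub>R B (A i (\<psi> (insert l S - {i})))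
          = - (koszul_sign i S *\<^sub>R A i (h \<psi> (S - {i})))"
        using False by (simp add: h_def S(1) linear_scale[OF lin] BA)
    qed
    finally show ?thesis
      by (simp add: koszul_eq[of "h \<psi>"] sum_negf)
  qed
  have "h (\<lambda>_. 0) = (\<lambda>_. 0)"
    by (simp add: h_def linear_0[OF B(1)] fun_eq_iff)
  then have "\<phi> = koszul A (h \<phi>)" if "koszul A \<phi> = (\<lambda>_. 0)" for \<phi>
    using homotopy[of \<phi>] that by (simp add: fun_eq_iff)
  then show ?thesis
    using koszul_koszul by auto
qed

end

section \<open>Diagonalizable tuples\<close>

text \<open>Strictness makes vectors with this Gram matrix linearly independent, as the eigenvectors
  of a generic tuple must be.\<close>

definition pd_kernel_on :: "'x set \<Rightarrow> ('x \<Rightarrow> 'x \<Rightarrow> complex) \<Rightarrow> bool" where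
  "pd_kernel_on F G \<longleftrightarrow> psd_kernel_on F G \<and>
    (\<forall>c. (\<Sum>p\<in>F. \<Sum>q\<in>F. G p q * c p * cnj (c q)) = 0 \<longrightarrow> (\<forall>p\<in>F. c p = 0))"

lemma sum_defect_gram:
  fixes k :: "'x \<Rightarrow> 'a::complex_hilbert"
  shows "(\<Sum>p\<in>F. \<Sum>q\<in>F. (1 - g p * cnj (g q)) * cinner (k p) (k q) * c p * cnj (c q)) =
    of_real ((norm (\<Sum>p\<in>F. scaleC (c p) (k p)))\<^sup>2 - (norm (\<Sum>p\<in>F. scaleC (g p * c p) (k p)))\<^sup>2)"
proof -
  have "(\<Sum>p\<in>F. \<Sum>q\<in>F. (1 - g p * cnj (g q)) * cinner (k p) (k q) * c p * cnj (c q)) =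
    (\<Sum>p\<in>F. \<Sum>q\<in>F. cinner (k p) (k q) * c p * cnj (c q)) -
    (\<Sum>p\<in>F. \<Sum>q\<in>F. cinner (k p) (k q) * (g p * c p) * cnj (g q * c q))"
    unfolding sum_subtractf[symmetric] by (intro sum.cong refl) (simp add: algebra_simps)
  then show ?thesis
    unfolding sum_cinner_gram by simp
qed

text \<open>By \<open>sum_defect_gram\<close> the form is a difference of two squared norms. This is
  the dictionary between kernels and operators: positivity of the defect means that scaling each
  \<open>k p\<close> by \<open>g p\<close> is a contraction on their span.\<close>

lemma psd_defect_iff:
  fixes k :: "'x \<Rightarrow> 'a::complex_hilbert"
  assumes "finite F"
  shows "psd_kernel_on F (\<lambda>p q. (1 - g p * cnj (g q)) * cinner (k p) (k q)) \<longleftrightarrow>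
    (\<forall>c. norm (\<Sum>p\<in>F. scaleC (g p * c p) (k p)) \<le> norm (\<Sum>p\<in>F. scaleC (c p) (k p)))"
  unfolding psd_kernel_on_finite[OF assms] sum_defect_gram
  by (simp add: power_mono_iff del: of_real_diff of_real_power)

lemma exists_projection:
  fixes k :: "'x \<Rightarrow> 'a::complex_hilbert"
  assumes "finite F"
  shows "\<exists>c. \<forall>q\<in>F. cinner (y - (\<Sum>p\<in>F. scaleC (c p) (k p))) (k q) = 0"
  using assms
proof (induction F arbitrary: y)
  case (insert x F)
  obtain c where c: "\<forall>q\<in>F. cinner (y - (\<Sum>p\<in>F. scaleC (c p) (k p))) (k q) = 0"
    using insert.IH by blast
  obtain d where d: "\<forall>q\<in>F. cinner (k x - (\<Sum>p\<in>F. scaleC (d p) (k p))) (k q) = 0"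
    using insert.IH by blast
  define r where "r = k x - (\<Sum>p\<in>F. scaleC (d p) (k p))"
  define s where "s = y - (\<Sum>p\<in>F. scaleC (c p) (k p))"
  \<comment> \<open>If \<open>k x\<close> depends on the other vectors then \<open>r = 0\<close>,
    and division by zero yields \<open>t = 0\<close>, which is the correct coefficient.\<close>
  define t where "t = cinner s r / cinner r r"
  define c' where "c' p = (if p = x then t else c p - t * d p)" for p
  have "(\<Sum>p\<in>insert x F. scaleC (c' p) (k p)) = scaleC t (k x) +
      (\<Sum>p\<in>F. scaleC (c p - t * d p) (k p))"
    using insert(1,2) by (auto simp: c'_def intro!: sum.cong)
  also have "\<dots> = (\<Sum>p\<in>F. scaleC (c p) (k p)) + scaleC t r"
    by (simp add: r_def scaleC_diff_left scaleC_diff_right sum_subtractf scaleC_sum_right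
        scaleC_scaleC)
  finally have res: "y - (\<Sum>p\<in>insert x F. scaleC (c' p) (k p)) = s - scaleC t r"
    by (simp add: s_def)
  have F0: "cinner (s - scaleC t r) (k q) = 0" if "q \<in> F" for q
    using c d that by (simp add: s_def[symmetric] r_def[symmetric] cinner_linear)
  have "cinner (s - scaleC t r) r = 0"
    by (simp add: cinner_linear t_def)
  moreover have "k x = r + (\<Sum>p\<in>F. scaleC (d p) (k p))"
    by (simp add: r_def)
  ultimately have "cinner (s - scaleC t r) (k x) = 0"
    using F0 by (simp add: cinner_add_right cinner_sum_right cinner_scaleC_right)
  then show ?case
    using res F0 by (intro exI[of _ c']) auto
qed simp

section \<open>Diagonal operators on a linearly independent family\<close>

locale independent_family =
  fixes F :: "'x set" and k :: "'x \<Rightarrow> 'a::complex_hilbert"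
  assumes finite_F: "finite F"
    and pd: "pd_kernel_on F (\<lambda>p q. cinner (k p) (k q))"
begin

lemma independent:
  assumes "(\<Sum>p\<in>F. scaleC (c p) (k p)) = 0" "p \<in> F"
  shows "c p = 0"
proof -
  have "(\<Sum>p\<in>F. \<Sum>q\<in>F. cinner (k p) (k q) * c p * cnj (c q)) = 0"
    unfolding sum_cinner_gram assms(1) by simp
  then show ?thesis
    using pd assms(2) unfolding pd_kernel_on_def by blast
qed

text \<open>The part \<open>r\<close> of \<open>k p\<close> orthogonal to the other vectors is
  nonzero by independence, and \<open>cinner (k p) r\<close> is its squared norm; rescaling gives
  the dual vector. Membership in the span is recorded because it makes \<open>proj\<close> the
  orthogonal projection.\<close>

lemma dual_exists:
  assumes p: "p \<in> F"
  shows "\<exists>d. (\<forall>q\<in>F. cinner (k q) d = (if q = p then 1 else 0)) \<and>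
      (\<exists>c. d = (\<Sum>q\<in>F. scaleC (c q) (k q)))"
proof -
  obtain c where c: "\<forall>q\<in>F - {p}. cinner (k p - (\<Sum>q\<in>F - {p}. scaleC (c q) (k q))) (k q) = 0"
    using exists_projection[of "F - {p}" "k p" k] finite_F by blast
  define r where "r = k p - (\<Sum>q\<in>F - {p}. scaleC (c q) (k q))"
  have r_sum: "r = (\<Sum>q\<in>F. scaleC (if q = p then 1 else - c q) (k q))"
    unfolding sum.remove[OF finite_F p] by (simp add: r_def sum_negf[symmetric])
  have "r \<noteq> 0"
    using independent[of "\<lambda>q. if q = p then 1 else - c q" p] p r_sum by auto
  have orth: "cinner (k q) r = 0" if "q \<in> F - {p}" for q
    using c that cinner_zero_sym unfolding r_def by blast
  have "k p = r + (\<Sum>q\<in>F - {p}. scaleC (c q) (k q))"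
    by (simp add: r_def)
  then have "cinner (k p) r = cinner r r + cinner (\<Sum>q\<in>F - {p}. scaleC (c q) (k q)) r"
    using cinner_add_left by metis
  also have "cinner (\<Sum>q\<in>F - {p}. scaleC (c q) (k q)) r = 0"
    unfolding cinner_sum_left by (intro sum.neutral) (simp add: cinner_scaleC_left orth)
  finally have kp: "cinner (k p) r = of_real ((norm r)\<^sup>2)"
    by (simp add: cinner_self)
  let ?d = "scaleC (of_real (1 / (norm r)\<^sup>2)) r"
  have "\<forall>q\<in>F. cinner (k q) ?d = (if q = p then 1 else 0)"
    using orth kp \<open>r \<noteq> 0\<close> by (auto simp: cinner_scaleC_right)
  moreover have "?d = (\<Sum>q\<in>F. scaleC (of_real (1 / (norm r)\<^sup>2) * (if q = p then 1 else - c q))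
      (k q))"
    by (subst (2) r_sum) (simp only: scaleC_sum_right scaleC_scaleC)
  ultimately show ?thesis
    by (intro exI[of _ ?d] conjI exI)
qed

definition dual :: "'x \<Rightarrow> 'a" where
  "dual p = (SOME d. (\<forall>q\<in>F. cinner (k q) d = (if q = p then 1 else 0)) \<and>
      (\<exists>c. d = (\<Sum>q\<in>F. scaleC (c q) (k q))))"

lemma dual:
  assumes "p \<in> F"
  shows "q \<in> F \<Longrightarrow> cinner (k q) (dual p) = (if q = p then 1 else 0)"
    and "\<exists>c. dual p = (\<Sum>q\<in>F. scaleC (c q) (k q))"
  using someI_ex[OF dual_exists[OF assms]] unfolding dual_def[symmetric] by blast+

definition proj :: "'a \<Rightarrow> 'a" where
  "proj x = (\<Sum>p\<in>F. scaleC (cinner x (dual p)) (k p))"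

text \<open>The dual vectors lie in the span, so they annihilate the residual of the orthogonal
  projection and read off its coefficients.\<close>

lemma proj_orthogonal:
  assumes "q \<in> F"
  shows "cinner (x - proj x) (k q) = 0"
proof -
  obtain c where c: "\<forall>q\<in>F. cinner (x - (\<Sum>p\<in>F. scaleC (c p) (k p))) (k q) = 0"
    using exists_projection[OF finite_F, of x k] by blast
  have "cinner x (dual p) = c p" if p: "p \<in> F" for p
  proof -
    obtain b where b: "dual p = (\<Sum>q\<in>F. scaleC (b q) (k q))"
      using dual(2)[OF p] by blast
    have "cinner (x - (\<Sum>p\<in>F. scaleC (c p) (k p))) (dual p) = 0"
      unfolding b cinner_sum_right cinner_scaleC_right using c by (intro sum.neutral) simp
    then have "cinner x (dual p) = (\<Sum>q\<in>F. c q * cinner (k q) (dual p))"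
      by (simp add: cinner_diff_left cinner_sum_left cinner_scaleC_left)
    also have "\<dots> = (\<Sum>q\<in>F. if q = p then c p else 0)"
      by (intro sum.cong refl) (simp add: dual(1)[OF p])
    finally show ?thesis
      using p finite_F by simp
  qed
  then have "proj x = (\<Sum>p\<in>F. scaleC (c p) (k p))"
    unfolding proj_def by (intro sum.cong refl) simp
  then show ?thesis
    using c assms by simp
qed

lemma norm_proj_le: "norm (proj x) \<le> norm x" and norm_diff_proj_le: "norm (x - proj x) \<le> norm x"
proof -
  have "cinner (x - proj x) (proj x) = 0"
    by (subst (2) proj_def) (simp add: cinner_sum_right cinner_scaleC_right proj_orthogonal)
  from norm_add_orthogonal[OF this] have *: "(norm x)\<^sup>2 = (norm (x - proj x))\<^sup>2 + (norm (proj x))\<^sup>2"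
    by simp
  show "norm (proj x) \<le> norm x"
    by (rule power2_le_imp_le) (use * in simp_all)
  show "norm (x - proj x) \<le> norm x"
    by (rule power2_le_imp_le) (use * in simp_all)
qed

text \<open>The value \<open>t\<close> on the orthogonal complement is a parameter, so that sums,
  products and scalars stay within this family.\<close>

definition diag :: "('x \<Rightarrow> complex) \<Rightarrow> complex \<Rightarrow> 'a \<Rightarrow> 'a" where
  "diag g t x = (\<Sum>p\<in>F. scaleC (g p * cinner x (dual p)) (k p)) + scaleC t (x - proj x)"

lemma proj_add: "proj (x + y) = proj x + proj y"
  by (simp add: proj_def cinner_add_left scaleC_add_left sum.distrib)

lemma proj_scaleC: "proj (scaleC c x) = scaleC c (proj x)"
  by (simp add: proj_def cinner_scaleC_left scaleC_sum_right scaleC_scaleC)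

lemma diag_add_right: "diag g t (x + y) = diag g t x + diag g t y"
  by (simp add: diag_def cinner_add_left scaleC_add_left scaleC_add_right scaleC_diff_right
      sum.distrib
      distrib_left proj_add)

lemma diag_scaleC: "diag g t (scaleC c x) = scaleC c (diag g t x)"
  by (simp add: diag_def cinner_scaleC_left scaleC_add_right scaleC_sum_right scaleC_scaleC
      proj_scaleC
      scaleC_diff_right mult_ac)

lemma diag_add_left: "diag (\<lambda>p. g p + h p) (s + t) x = diag g s x + diag h t x"
  by (simp add: diag_def distrib_right scaleC_add_left sum.distrib)

lemma diag_const: "diag (\<lambda>_. c) c x = scaleC c x"
  by (simp add: diag_def proj_def scaleC_scaleC[symmetric] scaleC_sum_right[symmetric]
      scaleC_diff_right)

lemma diag_diff_const: "diag g s x - scaleC c x = diag (\<lambda>p. g p - c) (s - c) x"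
  using diag_add_left[of g "\<lambda>_. - c" s "- c" x] diag_const[of "- c" x] by simp

lemma cinner_diag_dual:
  assumes "p \<in> F"
  shows "cinner (diag g t x) (dual p) = g p * cinner x (dual p)"
proof -
  have lin: "cinner (\<Sum>q\<in>F. scaleC (h q) (k q)) (dual p) = h p" for h
  proof -
    have "cinner (\<Sum>q\<in>F. scaleC (h q) (k q)) (dual p) = (\<Sum>q\<in>F. if q = p then h p else 0)"
      unfolding cinner_sum_left cinner_scaleC_left by (intro sum.cong refl)
          (simp add: dual(1)[OF assms])
    then show ?thesis
      using assms finite_F by simp
  qed
  show ?thesis
    unfolding diag_def proj_def by (simp add: cinner_linear lin)
qed

lemma diag_diag: "diag g s (diag h t x) = diag (\<lambda>p. g p * h p) (s * t) x"
proof -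
  have "proj (diag h t x) = (\<Sum>p\<in>F. scaleC (h p * cinner x (dual p)) (k p))"
    unfolding proj_def by (intro sum.cong refl) (simp add: cinner_diag_dual)
  then have "diag h t x - proj (diag h t x) = scaleC t (x - proj x)"
    by (simp add: diag_def)
  moreover have "(\<Sum>p\<in>F. scaleC (g p * cinner (diag h t x) (dual p)) (k p))
      = (\<Sum>p\<in>F. scaleC (g p * h p * cinner x (dual p)) (k p))"
    by (intro sum.cong refl) (simp add: cinner_diag_dual mult.assoc)
  ultimately show ?thesis
    unfolding diag_def[of g s "diag h t x"] by (simp add: diag_def scaleC_scaleC)
qed

lemma diag_sum_k: "diag g t (\<Sum>p\<in>F. scaleC (c p) (k p)) = (\<Sum>p\<in>F. scaleC (g p * c p) (k p))"
proof -
  let ?x = "\<Sum>p\<in>F. scaleC (c p) (k p)"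
  have "cinner ?x (dual p) = c p" if "p \<in> F" for p
  proof -
    have "cinner ?x (dual p) = (\<Sum>q\<in>F. if q = p then c p else 0)"
      unfolding cinner_sum_left cinner_scaleC_left by (intro sum.cong refl)
          (simp add: dual(1)[OF that])
    then show ?thesis
      using that finite_F by simp
  qed
  then have "diag g t ?x = (\<Sum>p\<in>F. scaleC (g p * c p) (k p)) + scaleC t
      (?x - (\<Sum>p\<in>F. scaleC (c p) (k p)))"
    unfolding diag_def proj_def by (intro arg_cong2[where f = "(+)"]
        arg_cong[where f = "\<lambda>v. scaleC t (?x - v)"] sum.cong refl) simp_all
  then show ?thesis
    by simp
qed

text \<open>A crude bound, chosen for being linear in the moduli of the eigenvalues: it tends to
  zero with them.\<close>

definition diag_bound :: "('x \<Rightarrow> complex) \<Rightarrow> complex \<Rightarrow> real" where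
  "diag_bound g t = (\<Sum>p\<in>F. cmod (g p) * (norm (dual p) * norm (k p))) + cmod t"

lemma norm_diag_le: "norm (diag g t x) \<le> diag_bound g t * norm x"
proof -
  have "norm (diag g t x) \<le> (\<Sum>p\<in>F. norm (scaleC (g p * cinner x (dual p)) (k p))) + cmod t * norm x"
    unfolding diag_def using norm_diff_proj_le[of x]
    by (intro order_trans[OF norm_triangle_ineq] add_mono norm_sum) (simp add: mult_left_mono)
  also have "(\<Sum>p\<in>F. norm (scaleC (g p * cinner x (dual p)) (k p)))
      \<le> (\<Sum>p\<in>F. cmod (g p) * (norm (dual p) * norm (k p)) * norm x)"
  proof (rule sum_mono)
    fix p
    have "norm (scaleC (g p * cinner x (dual p)) (k p)) = cmod (g p) * cmod
        (cinner x (dual p)) * norm (k p)"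
      by (simp add: norm_mult)
    also have "\<dots> \<le> cmod (g p) * (norm x * norm (dual p)) * norm (k p)"
      by (intro mult_right_mono mult_left_mono cinner_norm_le) auto
    finally show "norm (scaleC (g p * cinner x (dual p)) (k p)) \<le> cmod (g p) *
        (norm (dual p) * norm (k p)) * norm x"
      by (simp add: mult_ac)
  qed
  finally show ?thesis
    by (simp add: diag_bound_def distrib_right sum_distrib_right)
qed

lemma bounded_linear_diag: "bounded_linear (diag g t)"
proof (rule bounded_linear_intro[where K = "diag_bound g t"])
  show "diag g t (r *\<^sub>R x) = r *\<^sub>R diag g t x" for r x
    using diag_scaleC[of g t "of_real r" x] by (simp add: scaleC_complex_of_real)
qed (use norm_diag_le in \<open>simp_all add: diag_add_right mult.commute\<close>)

lift_definition diag_op :: "('x \<Rightarrow> complex) \<Rightarrow> complex \<Rightarrow> 'a \<Rightarrow>\<^sub>L 'a" is diag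
  by (rule bounded_linear_diag)

text \<open>The tuple is zero on the complement, so a function \<open>G\<close> acts there as
  \<open>G 0\<close>, the origin being a point of the polydisc. For continuity, convergence at this
  point and at the finitely many \<open>z p\<close> is enough, and singletons are compact.\<close>

lemma functional_calculus_diag:
  assumes z: "\<And>p. p \<in> F \<Longrightarrow> z p \<in> (polydisc :: (complex ^ 'm::finite) set)"
  shows "functional_calculus (\<lambda>l. diag_op (\<lambda>p. z p $ l) 0) (\<lambda>G. diag_op (\<lambda>p. G (z p)) (G 0))"
  unfolding functional_calculus_def
proof (intro conjI ballI allI impI)
  fix H and Fs :: "nat \<Rightarrow> complex ^ 'm \<Rightarrow> complex"
  assume unif: "\<forall>K\<subseteq>polydisc. compact K \<longrightarrow> uniform_limit K Fs H sequentially"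
  have lim: "(\<lambda>n. Fs n w) \<longlonglongrightarrow> H w" if "w \<in> polydisc" for w
    using unif[rule_format, of "{w}"] that by (auto intro: tendsto_uniform_limitI)
  have lim0: "(\<lambda>n. Fs n 0 - H 0) \<longlonglongrightarrow> 0"
    using lim[of 0] by (simp add: polydisc_def LIM_zero)
  have limz: "(\<lambda>n. Fs n (z p) - H (z p)) \<longlonglongrightarrow> 0" if "p \<in> F" for p
    using lim[OF z[OF that]] by (rule LIM_zero)
  have bound: "norm (diag_op (\<lambda>p. Fs n (z p)) (Fs n 0) - diag_op (\<lambda>p. H (z p)) (H 0))
      \<le> diag_bound (\<lambda>p. Fs n (z p) - H (z p)) (Fs n 0 - H 0)" for n
  proof (rule norm_blinfun_bound)
    show "0 \<le> diag_bound (\<lambda>p. Fs n (z p) - H (z p)) (Fs n 0 - H 0)"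
      by (simp add: diag_bound_def sum_nonneg)
    fix x
    have "diag (\<lambda>p. Fs n (z p)) (Fs n 0) x - diag (\<lambda>p. H (z p)) (H 0) x
        = diag (\<lambda>p. Fs n (z p) - H (z p)) (Fs n 0 - H 0) x"
      using diag_add_left[of "\<lambda>p. Fs n (z p) - H (z p)" "\<lambda>p. H (z p)" "Fs n 0 - H 0" "H 0" x]
          by simp
    then show "norm (blinfun_apply (diag_op (\<lambda>p. Fs n (z p)) (Fs n 0) - diag_op (\<lambda>p. H (z p)) (H 0))
        x)
        \<le> diag_bound (\<lambda>p. Fs n (z p) - H (z p)) (Fs n 0 - H 0) * norm x"
      using norm_diag_le by (simp add: blinfun.diff_left diag_op.rep_eq)
  qed
  have "(\<lambda>n. \<Sum>p\<in>F. cmod (Fs n (z p) - H (z p)) * (norm (dual p) * norm (k p))) \<longlonglongrightarrow> 0"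
    by (rule tendsto_null_sum, rule tendsto_mult_left_zero, rule tendsto_norm_zero, rule limz)
  then have "(\<lambda>n. diag_bound (\<lambda>p. Fs n (z p) - H (z p)) (Fs n 0 - H 0)) \<longlonglongrightarrow> 0"
    unfolding diag_bound_def by (rule tendsto_add_zero) (rule tendsto_norm_zero[OF lim0])
  then have "(\<lambda>n. diag_op (\<lambda>p. Fs n (z p)) (Fs n 0) - diag_op (\<lambda>p. H (z p)) (H 0)) \<longlonglongrightarrow> 0"
    by (rule Lim_null_comparison[OF always_eventually, OF allI[OF bound]])
  then show "(\<lambda>n. diag_op (\<lambda>p. Fs n (z p)) (Fs n 0)) \<longlonglongrightarrow> diag_op (\<lambda>p. H (z p)) (H 0)"
    by (rule LIM_zero_cancel)
qed (auto simp: clinear_op_def diag_op.rep_eq diag_scaleC diag_const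
    blinfun.add_left diag_add_left diag_diag intro!: blinfun_eqI)

text \<open>With \<open>t = 0\<close> the operator factors through \<open>proj\<close>, which does
  not increase norms; on the span the assumption applies by \<open>psd_defect_iff\<close>.\<close>

lemma commuting_contractions_diag:
  assumes "\<And>l. psd_kernel_on F (\<lambda>p q. (1 - z p $ l * cnj (z q $ l)) * cinner (k p) (k q))"
  shows "(\<lambda>l. diag_op (\<lambda>p. z p $ l) 0) \<in> commuting_contractions"
proof -
  have "norm (diag_op (\<lambda>p. z p $ l) 0) \<le> 1" for l
  proof (rule norm_blinfun_bound)
    fix x
    have "norm (diag (\<lambda>p. z p $ l) 0 x) \<le> norm (proj x)"
      using assms[of l] unfolding psd_defect_iff[OF finite_F] by (simp add: diag_def proj_def)
    then show "norm (blinfun_apply (diag_op (\<lambda>p. z p $ l) 0) x) \<le> 1 * norm x"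
      using norm_proj_le[of x] by (simp add: diag_op.rep_eq)
  qed simp
  then show ?thesis
    by (auto simp: commuting_contractions_def clinear_op_def diag_op.rep_eq diag_scaleC diag_diag
        mult.commute
        intro!: blinfun_eqI)
qed

text \<open>A point outside the polydisc has a coordinate \<open>w $ l\<close> of modulus at least
  \<open>1\<close>. It differs from \<open>0\<close> and from every \<open>z p $ l\<close>, so the
  \<open>l\<close>-th operator minus \<open>w $ l\<close> has a diagonal inverse and the Koszul
  complex is exact.\<close>

lemma taylor_spectrum_diag:
  fixes z :: "'x \<Rightarrow> complex ^ 'm::{finite,linorder}"
  assumes z: "\<And>p. p \<in> F \<Longrightarrow> z p \<in> polydisc"
  shows "taylor_spectrum (\<lambda>l. diag_op (\<lambda>p. z p $ l) 0) \<subseteq> polydisc"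
proof
  fix w assume w: "w \<in> taylor_spectrum (\<lambda>l. diag_op (\<lambda>p. z p $ l) 0)"
  show "w \<in> polydisc"
  proof (rule ccontr)
    assume "w \<notin> polydisc"
    then obtain l where l: "1 \<le> cmod (w $ l)"
      by (auto simp: polydisc_def not_less)
    let ?A = "\<lambda>i x. blinfun_apply (diag_op (\<lambda>p. z p $ i) 0) x - scaleC (w $ i) x"
    let ?B = "diag (\<lambda>p. 1 / (z p $ l - w $ l)) (1 / (0 - w $ l))"
    have A: "?A i x = diag (\<lambda>p. z p $ i - w $ i) (0 - w $ i) x" for i x
      unfolding diag_op.rep_eq by (rule diag_diff_const)
    have ne: "z p $ l - w $ l \<noteq> 0" if "p \<in> F" for p
      using z[OF that] l by (auto simp: polydisc_def) (metis linorder_not_less)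
    have diag_one: "diag g 1 x = x" if "\<And>p. p \<in> F \<Longrightarrow> g p = 1" for g x
    proof -
      have "diag g 1 x = diag (\<lambda>_. 1) 1 x"
        unfolding diag_def using that by (intro arg_cong2[where f = "(+)"] sum.cong refl) simp
      then show ?thesis
        by (simp add: diag_const)
    qed
    have w0: "w $ l \<noteq> 0"
      using l by auto
    have "{\<phi>. koszul ?A \<phi> = (\<lambda>_. 0)} = range (koszul ?A)"
    proof (rule koszul_exact[where B = ?B and l = l])
      show "linear (?A i)" for i
        unfolding A by (rule bounded_linear.linear[OF bounded_linear_diag])
      show "?A i (?A j x) = ?A j (?A i x)" for i j x
        unfolding A diag_diag by (simp add: mult.commute)
      show "linear ?B"
        by (rule bounded_linear.linear[OF bounded_linear_diag])
      show "?A l (?B x) = x" "?B (?A l x) = x" for x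
        unfolding A diag_diag using ne w0 by (simp_all add: diag_one)
    qed
    then show False
      using w unfolding taylor_spectrum_def by (simp add: Let_def)
  qed
qed

lemma psd_defect_of_polydisc_norm:
  fixes z :: "'x \<Rightarrow> complex ^ 'm::{finite,linorder}"
  assumes z: "\<And>p. p \<in> F \<Longrightarrow> z p \<in> polydisc"
    and psd: "\<And>l. psd_kernel_on F (\<lambda>p q. (1 - z p $ l * cnj (z q $ l)) * cinner (k p) (k q))"
    and H: "polydisc_norm TYPE('a) H \<le> 1"
  shows "psd_kernel_on F (\<lambda>p q. (1 - H (z p) * cnj (H (z q))) * cinner (k p) (k q))"
proof -
  let ?T = "\<lambda>l. diag_op (\<lambda>p. z p $ l) 0" and ?\<Phi> = "\<lambda>G. diag_op (\<lambda>p. G (z p)) (G 0)"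
  have "ennreal (norm (?\<Phi> H)) \<le> polydisc_norm TYPE('a) H"
    unfolding polydisc_norm_def
    by (rule SUP_upper2[of "(?T, ?\<Phi>)"])
      (simp_all add: functional_calculus_diag[OF z] commuting_contractions_diag[OF psd]
          taylor_spectrum_diag[OF z])
  then have "norm (?\<Phi> H) \<le> 1"
    using H by (metis ennreal_le_1 order_trans)
  then have "norm (diag (\<lambda>p. H (z p)) (H 0) x) \<le> norm x" for x
    using order_trans[OF norm_blinfun[of "?\<Phi> H" x] mult_right_mono[of _ 1 "norm x"]]
    by (simp add: diag_op.rep_eq)
  from this[of "\<Sum>p\<in>F. scaleC (c p) (k p)" for c] show ?thesis
    unfolding psd_defect_iff[OF finite_F] diag_sum_k by blast
qed

end

section \<open>The cone of kernels: separation and compactness\<close>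

definition gram_contractive :: "('m \<Rightarrow> 'x \<Rightarrow> complex) \<Rightarrow> 'x set \<Rightarrow> ('x \<Rightarrow> complex) \<Rightarrow> bool" where
  "gram_contractive \<delta> E f \<longleftrightarrow> (\<forall>F G. finite F \<longrightarrow> F \<subseteq> E \<longrightarrow> pd_kernel_on F G \<longrightarrow>
    (\<forall>l. psd_kernel_on F (\<lambda>p q. (1 - \<delta> l p * cnj (\<delta> l q)) * G p q)) \<longrightarrow>
    psd_kernel_on F (\<lambda>p q. (1 - f p * cnj (f q)) * G p q))"

text \<open>Hermitian symmetry makes the form equal to its own conjugate after exchanging the sums,
  so the imaginary part vanishes by itself.\<close>

lemma psd_kernel_onI_Re:
  assumes "finite F" "\<And>p q. p \<in> F \<Longrightarrow> q \<in> F \<Longrightarrow> a q p = cnj (a p q)"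
    and "\<And>c. 0 \<le> Re (\<Sum>p\<in>F. \<Sum>q\<in>F. a p q * c p * cnj (c q))"
  shows "psd_kernel_on F a"
proof -
  have "Im (\<Sum>p\<in>F. \<Sum>q\<in>F. a p q * c p * cnj (c q)) = 0" for c
  proof -
    have "cnj (\<Sum>p\<in>F. \<Sum>q\<in>F. a p q * c p * cnj (c q)) = (\<Sum>p\<in>F. \<Sum>q\<in>F. a q p * c q * cnj (c p))"
      unfolding cnj_sum complex_cnj_mult complex_cnj_cnj
      by (intro sum.cong refl) (simp only: assms(2)[symmetric] mult.assoc mult.commute[of "c _"])
    also have "\<dots> = (\<Sum>p\<in>F. \<Sum>q\<in>F. a p q * c p * cnj (c q))"
      by (rule sum.swap)
    finally have "Im (cnj (\<Sum>p\<in>F. \<Sum>q\<in>F. a p q * c p * cnj (c q))) = Im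
        (\<Sum>p\<in>F. \<Sum>q\<in>F. a p q * c p * cnj (c q))"
      by (rule arg_cong)
    then show ?thesis
      unfolding cnj.simps by linarith
  qed
  then show ?thesis
    unfolding psd_kernel_on_finite[OF assms(1)] complex_nonneg_Reals_iff using assms(3) by simp
qed

lemma psd_kernel_on_diagonal:
  assumes "finite F" "\<And>p. p \<in> F \<Longrightarrow> 0 \<le> d p"
  shows "psd_kernel_on F (\<lambda>p q. if p = q then of_real (d p) else 0)"
proof (rule psd_kernel_onI_Re[OF assms(1)])
  fix c :: "'a \<Rightarrow> complex"
  have "(\<Sum>p\<in>F. \<Sum>q\<in>F. (if p = q then of_real (d p) else 0) * c p * cnj (c q)) =
      (\<Sum>p\<in>F. of_real (d p * (cmod (c p))\<^sup>2))"
  proof (rule sum.cong[OF refl])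
    fix p assume p: "p \<in> F"
    have "(\<Sum>q\<in>F. (if p = q then of_real (d p) else 0) * c p * cnj (c q)) =
        (\<Sum>q\<in>F. if p = q then of_real (d p) * c p * cnj (c p) else 0)"
      by (intro sum.cong refl) auto
    also have "\<dots> = of_real (d p * (cmod (c p))\<^sup>2)"
      using p assms(1) by (simp add: mult.assoc complex_norm_square del: of_real_power)
    finally show "(\<Sum>q\<in>F. (if p = q then of_real (d p) else 0) * c p * cnj (c q)) = of_real
        (d p * (cmod (c p))\<^sup>2)" .
  qed
  then show "0 \<le> Re (\<Sum>p\<in>F. \<Sum>q\<in>F. (if p = q then of_real (d p) else 0) * c p * cnj (c q))"
    using assms(2) by (simp add: sum_nonneg flip: of_real_sum)
qed auto

text \<open>The Szego kernel is positive semidefinite; dividing by it amounts to iterating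
  \<open>Q(c) = P(c) + Q(zc)\<close>, where \<open>P\<close> is the given form and \<open>Q\<close> the form of \<open>G\<close>.\<close>

lemma psd_kernel_on_divide_szego:
  assumes "finite F" "\<And>p. p \<in> F \<Longrightarrow> cmod (z p) < 1"
    and "psd_kernel_on F (\<lambda>p q. (1 - z p * cnj (z q)) * G p q)"
  shows "psd_kernel_on F G"
proof -
  define Q where "Q c = (\<Sum>p\<in>F. \<Sum>q\<in>F. G p q * c p * cnj (c q))" for c
  have step: "Q c - Q (\<lambda>p. z p * c p) \<in> \<real>\<^sub>\<ge>\<^sub>0" for c
  proof -
    have "Q c - Q (\<lambda>p. z p * c p) = (\<Sum>p\<in>F. \<Sum>q\<in>F. (1 - z p * cnj (z q)) * G p q * c p * cnj (c q))"
      unfolding Q_def sum_subtractf[symmetric] by (intro sum.cong refl) (simp add: algebra_simps)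
    then show ?thesis
      using assms(3) unfolding psd_kernel_on_finite[OF assms(1)] by simp
  qed
  have iter: "Q c - Q (\<lambda>p. z p ^ n * c p) \<in> \<real>\<^sub>\<ge>\<^sub>0" for c n
  proof (induction n)
    case (Suc n)
    have "Q c - Q (\<lambda>p. z p ^ Suc n * c p) = (Q c - Q (\<lambda>p. z p ^ n * c p)) +
        (Q (\<lambda>p. z p ^ n * c p) - Q (\<lambda>p. z p * (z p ^ n * c p)))"
      by (simp add: mult.assoc)
    then show ?case
      using nonneg_Reals_add_I[OF Suc step[of "\<lambda>p. z p ^ n * c p"]] by simp
  qed simp
  have "Q c \<in> \<real>\<^sub>\<ge>\<^sub>0" for c
  \<comment> \<open>Since \<open>cmod (z p) < 1\<close>, the form at \<open>z p ^ n * c p\<close>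
    tends to zero, and the nonnegative reals are closed.\<close>
  proof (rule closed_sequentially[OF closed_nonneg_Reals_complex iter])
    have z0: "(\<lambda>n. z p ^ n * c p) \<longlonglongrightarrow> 0" if "p \<in> F" for p
      by (rule tendsto_mult_left_zero[OF LIMSEQ_power_zero]) (rule assms(2)[OF that])
    have "(\<lambda>n. G p q * (z p ^ n * c p) * cnj (z q ^ n * c q)) \<longlonglongrightarrow> 0" if "p \<in> F" "q \<in> F" for p q
      using tendsto_mult[OF tendsto_mult_right_zero[OF z0[OF that(1)], of "G p q"]
          tendsto_cnj[OF z0[OF that(2)]]]
      by simp
    then have "(\<lambda>n. Q (\<lambda>p. z p ^ n * c p)) \<longlonglongrightarrow> 0"
      unfolding Q_def by (intro tendsto_null_sum) auto
    then show "(\<lambda>n. Q c - Q (\<lambda>p. z p ^ n * c p)) \<longlonglongrightarrow> Q c"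
      using tendsto_diff[OF tendsto_const, of _ 0] by fastforce
  qed
  then show ?thesis
    unfolding psd_kernel_on_finite[OF assms(1)] Q_def by simp
qed

text \<open>Tychonoff's theorem for a product of closed discs; the function type carries the product
  topology.\<close>

lemma compact_bounded_functions: "compact {a :: 'i \<Rightarrow> complex. \<forall>t. cmod (a t) \<le> B t}"
proof -
  have "{a :: 'i \<Rightarrow> complex. \<forall>t. cmod (a t) \<le> B t} = PiE UNIV (\<lambda>t. cball 0 (B t))"
    by (auto simp: PiE_def)
  moreover have "compactin (product_topology (\<lambda>_ :: 'i. euclidean) UNIV)
      (PiE UNIV (\<lambda>t. cball (0::complex) (B t)))"
    by (subst compactin_PiE) simp
  ultimately show ?thesis
    by (simp add: euclidean_product_topology)
qed

lemma closed_psd_kernel_on: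
  assumes "finite F"
  shows "closed {a :: 'm \<times> 'x \<times> 'x \<Rightarrow> complex. \<forall>l. psd_kernel_on F (\<lambda>p q. a (l, p, q))}"
proof -
  have "{a :: 'm \<times> 'x \<times> 'x \<Rightarrow> complex. \<forall>l. psd_kernel_on F (\<lambda>p q. a (l, p, q))}
      = (\<Inter>l. \<Inter>c. (\<lambda>a. \<Sum>p\<in>F. \<Sum>q\<in>F. a (l, p, q) * c p * cnj (c q)) -` \<real>\<^sub>\<ge>\<^sub>0)"
    unfolding psd_kernel_on_finite[OF assms] by auto
  also have "closed \<dots>"
    by (intro closed_INT ballI closed_vimage closed_nonneg_Reals_complex continuous_intros
        continuous_on_product_coordinates)
  finally show ?thesis .
qed

text \<open>First-order optimality: for small \<open>t\<close> a positive linear coefficient would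
  dominate the quadratic term.\<close>

lemma nonpos_of_quadratic:
  assumes "\<And>t. 0 < t \<Longrightarrow> t \<le> 1 \<Longrightarrow> (0::real) \<le> t\<^sup>2 * b - 2 * t * a"
  shows "a \<le> 0"
proof (rule ccontr)
  assume "\<not> a \<le> 0"
  then have a: "a > 0"
    by simp
  \<comment> \<open>This makes \<open>t * b\<close> smaller than \<open>2 * a\<close>, so the
    quadratic becomes negative.\<close>
  define t where "t = min 1 (a / (\<bar>b\<bar> + 1))"
  have t: "0 < t" "t \<le> 1"
    using a by (auto simp: t_def)
  have "t * b \<le> t * \<bar>b\<bar>"
    using t by (intro mult_left_mono) auto
  also have "\<dots> \<le> a / (\<bar>b\<bar> + 1) * \<bar>b\<bar>"
    by (intro mult_right_mono) (auto simp: t_def)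
  also have "\<dots> < 2 * a"
    using a by (simp add: field_simps) (smt (verit) mult_nonneg_nonneg)
  finally have "t * (t * b - 2 * a) < 0"
    using t(1) by (simp add: mult_pos_neg)
  then show False
    using assms[OF t] by (simp add: power2_eq_square algebra_simps)
qed

text \<open>The kernels are bundled into one function of a triple, so that all tuples of kernels
  live in a single product space.\<close>

definition cone_elem :: "('m::finite \<Rightarrow> 'x \<Rightarrow> complex) \<Rightarrow> ('m \<times> 'x \<times> 'x \<Rightarrow> complex) \<Rightarrow> 'x \<Rightarrow> 'x \<Rightarrow> complex"
    where
  "cone_elem \<delta> a p q = (\<Sum>l\<in>UNIV. (1 - \<delta> l p * cnj (\<delta> l q)) * a (l, p, q))"

definition psd_tuple :: "'x set \<Rightarrow> ('m \<times> 'x \<times> 'x \<Rightarrow> complex) \<Rightarrow> bool" where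
  "psd_tuple F a \<longleftrightarrow> (\<forall>l. psd_kernel_on F (\<lambda>p q. a (l, p, q)))"

section \<open>Best approximation from the cone over a finite set\<close>

context
  fixes \<delta> :: "'m::finite \<Rightarrow> 'x \<Rightarrow> complex" and F :: "'x set"
  assumes F: "finite F" and \<delta>: "\<And>l p. p \<in> F \<Longrightarrow> cmod (\<delta> l p) < 1"
begin

definition sqnorm :: "('x \<Rightarrow> 'x \<Rightarrow> complex) \<Rightarrow> real" where
  "sqnorm R = (\<Sum>p\<in>F. \<Sum>q\<in>F. (cmod (R p q))\<^sup>2)"

text \<open>The real part of the Frobenius inner product, whose quadratic form is
  \<open>sqnorm\<close>.\<close>

definition ip :: "('x \<Rightarrow> 'x \<Rightarrow> complex) \<Rightarrow> ('x \<Rightarrow> 'x \<Rightarrow> complex) \<Rightarrow> real" where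
  "ip R Y = (\<Sum>p\<in>F. \<Sum>q\<in>F. Re (R p q * cnj (Y p q)))"

lemma sqnorm_diff: "sqnorm (\<lambda>p q. R p q - of_real t * Y p q) = sqnorm R - 2 * t * ip R Y
    + t\<^sup>2 * sqnorm Y"
proof -
  have sq: "(cmod (x - of_real t * y))\<^sup>2 = (cmod x)\<^sup>2 - 2 * t * Re (x * cnj y) + t\<^sup>2 * (cmod y)\<^sup>2"
      for x y
    unfolding cmod_power2 by (simp add: algebra_simps power2_eq_square)
  show ?thesis
    unfolding sqnorm_def ip_def sq by (simp only: sum.distrib sum_subtractf sum_distrib_left)
qed

lemma cone_elem_lin: "cone_elem \<delta> (\<lambda>x. a x + of_real t * b x) p q = cone_elem \<delta> a p q
    + of_real t * cone_elem \<delta> b p q"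
  unfolding cone_elem_def sum_distrib_left sum.distrib[symmetric]
  by (intro sum.cong refl) (simp add: algebra_simps)

lemma sqnorm_nonneg: "0 \<le> sqnorm R"
  by (simp add: sqnorm_def sum_nonneg)

lemma norm_le_sqnorm: "p \<in> F \<Longrightarrow> q \<in> F \<Longrightarrow> (cmod (R p q))\<^sup>2 \<le> sqnorm R"
  unfolding sqnorm_def using F
  by (intro order_trans[OF member_le_sum[of q F "\<lambda>q. (cmod (R p q))\<^sup>2"]
      member_le_sum[of p F "\<lambda>p. \<Sum>q\<in>F. (cmod (R p q))\<^sup>2"]])
    (auto simp: sum_nonneg)

text \<open>On the diagonal all summands are nonnegative because
  \<open>cmod (\<delta> l p) < 1\<close>, so each is at most their sum. Hence bounded cone elements
  come from bounded kernels.\<close>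

lemma cone_diag:
  assumes "psd_tuple F a" "p \<in> F"
  shows "(1 - (cmod (\<delta> l p))\<^sup>2) * Re (a (l, p, p)) \<le> Re (cone_elem \<delta> a p p)"
proof -
  have nonneg: "0 \<le> (1 - (cmod (\<delta> l p))\<^sup>2) * Re (a (l, p, p))" for l
  proof (intro mult_nonneg_nonneg)
    show "0 \<le> 1 - (cmod (\<delta> l p))\<^sup>2"
      using \<delta>[OF assms(2), of l] by (simp add: power_le_one)
    show "0 \<le> Re (a (l, p, p))"
      using psd_kernel_diag[of F "\<lambda>p q. a (l, p, q)"] assms by
          (simp add: psd_tuple_def complex_nonneg_Reals_iff)
  qed
  have re: "Re ((1 - \<delta> l p * cnj (\<delta> l p)) * a (l, p, p)) = (1 - (cmod (\<delta> l p))\<^sup>2) * Re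
      (a (l, p, p))" for l
    unfolding complex_norm_square[symmetric] by (simp flip: of_real_power)
  have "Re (cone_elem \<delta> a p p) = (\<Sum>l\<in>UNIV. (1 - (cmod (\<delta> l p))\<^sup>2) * Re (a (l, p, p)))"
    unfolding cone_elem_def Re_sum by (simp only: re)
  also have "\<dots> \<ge> (1 - (cmod (\<delta> l p))\<^sup>2) * Re (a (l, p, p))"
    using nonneg by (intro member_le_sum) auto
  finally show ?thesis .
qed

text \<open>Only tuples at least as good as zero matter. Their cone elements are bounded, hence so
  are their diagonals by \<open>cone_diag\<close> and all entries by
  \<open>psd_kernel_bound\<close>. It remains to minimize a continuous function on a compact
  set.\<close>

lemma minimizer_exists:
  fixes h :: "'x \<Rightarrow> 'x \<Rightarrow> complex"
  obtains a where "psd_tuple F a"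
    "\<And>b. psd_tuple F b \<Longrightarrow> sqnorm (\<lambda>p q. h p q - cone_elem \<delta> a p q) \<le> sqnorm
        (\<lambda>p q. h p q - cone_elem \<delta> b p q)"
proof -
  let ?\<phi> = "\<lambda>a. sqnorm (\<lambda>p q. h p q - cone_elem \<delta> a p q)"
  define H where "H = sqrt (sqnorm h)"
  \<comment> \<open>A cone element within distance \<open>H\<close> of \<open>h\<close> has diagonal
    entries at most \<open>2 * H\<close>; dividing by the weight in \<open>cone_diag\<close> bounds
    the kernels.\<close>
  define b where "b l p = 2 * H / (1 - (cmod (\<delta> l p))\<^sup>2)" for l p
  define B where "B t = (case t of (l, p, q) \<Rightarrow> if p \<in> F \<and> q \<in> F then b l p + b l q else 0)" for t
  define K where "K = {a. \<forall>l. psd_kernel_on F (\<lambda>p q. a (l, p, q))} \<inter> {a. \<forall>t. cmod (a t) \<le> B t}"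
  have H: "0 \<le> H" "cmod (h p q) \<le> H" if "p \<in> F" "q \<in> F" for p q
    using norm_le_sqnorm[OF that, of h] real_le_rsqrt by (auto simp: H_def sqnorm_nonneg)
  have K0: "(\<lambda>_. 0) \<in> K"
  proof -
    have "0 \<le> b l p" if "p \<in> F" for l p
      using H(1)[OF that that] \<delta>[OF that, of l] by (simp add: b_def power_le_one)
    then show ?thesis
      by (auto simp: K_def psd_kernel_on_zero B_def split: prod.splits)
  qed
  have "compact K"
    unfolding K_def by (intro closed_Int_compact closed_psd_kernel_on F compact_bounded_functions)
  moreover have "continuous_on K ?\<phi>"
    unfolding sqnorm_def cone_elem_def
    by (intro continuous_intros continuous_on_subset[OF continuous_on_product_coordinates]) auto
  ultimately obtain a where a: "a \<in> K" "\<And>c. c \<in> K \<Longrightarrow> ?\<phi> a \<le> ?\<phi> c"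
    using continuous_attains_inf[of K ?\<phi>] K0 by blast
  have zero: "?\<phi> (\<lambda>_. 0) = sqnorm h"
    by (simp add: cone_elem_def)
  have "?\<phi> a \<le> ?\<phi> c" if c: "psd_tuple F c" for c
  proof (cases "?\<phi> c \<le> sqnorm h")
    case False
    then show ?thesis
      using a(2)[OF K0] zero by simp
  next
    case True
    \<comment> \<open>Entries outside \<open>F\<close> are unrestricted but do not influence the
      objective; setting them to zero moves the tuple into the box.\<close>
    define c' where "c' t = (case t of (l, p, q) \<Rightarrow> if p \<in> F \<and> q \<in> F then c (l, p, q) else 0)" for t
    have psd: "psd_kernel_on F (\<lambda>p q. c (l, p, q))" for l
      using c by (simp add: psd_tuple_def)
    have bound: "Re (c (l, p, p)) \<le> b l p" if p: "p \<in> F" for l p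
    proof -
      have "(cmod (h p p - cone_elem \<delta> c p p))\<^sup>2 \<le> H\<^sup>2"
        using norm_le_sqnorm[OF p p, of "\<lambda>p q. h p q - cone_elem \<delta> c p q"] True by
            (simp add: H_def sqnorm_nonneg)
      then have "cmod (h p p - cone_elem \<delta> c p p) \<le> H"
        by (rule power2_le_imp_le) (rule H(1)[OF p p])
      moreover have "cmod (cone_elem \<delta> c p p) \<le> cmod (h p p) + cmod (h p p - cone_elem \<delta> c p p)"
        by (metis norm_minus_commute norm_triangle_sub)
      ultimately have "Re (cone_elem \<delta> c p p) \<le> 2 * H"
        using H(2)[OF p p] complex_Re_le_cmod[of "cone_elem \<delta> c p p"] by linarith
      then have "(1 - (cmod (\<delta> l p))\<^sup>2) * Re (c (l, p, p)) \<le> 2 * H"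
        using cone_diag[OF c p, of l] by linarith
      moreover have "0 < 1 - (cmod (\<delta> l p))\<^sup>2"
        using \<delta>[OF p, of l] by (simp add: power_less_one_iff abs_square_less_1)
      ultimately show ?thesis
        by (simp add: b_def pos_le_divide_eq mult.commute)
    qed
    have "cmod (c' t) \<le> B t" for t
    proof (cases t)
      case (fields l p q)
      show ?thesis
      proof (cases "p \<in> F \<and> q \<in> F")
        case True
        then have "cmod (c (l, p, q)) \<le> b l p + b l q"
          by (intro psd_kernel_bound[OF psd] bound) auto
        then show ?thesis
          using True by (simp add: fields c'_def B_def)
      next
        case False
        then show ?thesis
          unfolding fields c'_def B_def prod.case by (simp only: if_False norm_zero order_refl)
      qed
    qed
    moreover have "psd_kernel_on F (\<lambda>p q. c' (l, p, q))" for l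
    proof -
      have "psd_kernel_on F (\<lambda>p q. c' (l, p, q)) = psd_kernel_on F (\<lambda>p q. c (l, p, q))"
        by (rule psd_kernel_on_cong) (simp add: c'_def)
      then show ?thesis
        using psd by simp
    qed
    ultimately have "c' \<in> K"
      by (simp add: K_def)
    moreover have "?\<phi> c' = ?\<phi> c"
      unfolding sqnorm_def cone_elem_def by (intro sum.cong refl) (simp add: c'_def)
    ultimately show ?thesis
      using a(2)[of c'] by simp
  qed
  moreover have "psd_tuple F a"
    using a(1) by (simp add: K_def psd_tuple_def)
  ultimately show thesis
    using that by blast
qed

lemma psd_tuple_add:
  assumes "psd_tuple F a" "psd_tuple F b" "0 \<le> t"
  shows "psd_tuple F (\<lambda>x. a x + of_real t * b x)"
  using assms unfolding psd_tuple_def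
  by (intro allI psd_kernel_on_add psd_kernel_on_scale) auto

text \<open>The residual \<open>R\<close> pairs nonpositively with the cone and nonnegatively with
  the best approximant, so \<open>sqnorm R \<le> ip R ?h\<close>. The negated conjugate of
  \<open>R\<close> is a limit of admissible kernels, for which contractivity gives
  \<open>ip R ?h \<le> 0\<close>; hence \<open>R\<close> vanishes.\<close>

theorem finite_cone_membership:
  assumes "gram_contractive \<delta> F f"
  obtains a where "psd_tuple F a" "\<And>p q. p \<in> F \<Longrightarrow> q \<in> F \<Longrightarrow> 1 - f p * cnj (f q) = cone_elem \<delta> a p q"
proof -
  let ?h = "\<lambda>p q. 1 - f p * cnj (f q)"
  obtain a where a: "psd_tuple F a"
    "\<And>b. psd_tuple F b \<Longrightarrow> sqnorm (\<lambda>p q. ?h p q - cone_elem \<delta> a p q) \<le> sqnorm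
        (\<lambda>p q. ?h p q - cone_elem \<delta> b p q)"
    using minimizer_exists[of ?h] by blast
  define R where "R p q = ?h p q - cone_elem \<delta> a p q" for p q
  have var: "0 \<le> t\<^sup>2 * sqnorm (cone_elem \<delta> b) - 2 * t * ip R (cone_elem \<delta> b)"
    if "psd_tuple F (\<lambda>x. a x + of_real t * b x)" for t b
  proof -
    have "sqnorm R \<le> sqnorm (\<lambda>p q. R p q - of_real t * cone_elem \<delta> b p q)"
      using a(2)[OF that] unfolding cone_elem_lin R_def by (simp add: algebra_simps)
    then show ?thesis
      unfolding sqnorm_diff by simp
  qed
  have nonpos: "ip R (cone_elem \<delta> b) \<le> 0" if b: "psd_tuple F b" for b
  proof (rule nonpos_of_quadratic)
    fix t :: real assume "0 < t" "t \<le> 1"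
    then show "0 \<le> t\<^sup>2 * sqnorm (cone_elem \<delta> b) - 2 * t * ip R (cone_elem \<delta> b)"
      by (intro var psd_tuple_add a b) simp
  qed
  \<comment> \<open>Scaling the minimizer by \<open>1 - t\<close> stays in the cone, so the
    variation in the direction \<open>- a\<close> is allowed too.\<close>
  have "- ip R (cone_elem \<delta> a) \<le> 0"
  proof (rule nonpos_of_quadratic)
    fix t :: real assume t: "0 < t" "t \<le> 1"
    have "psd_tuple F (\<lambda>x. a x + of_real (- t) * a x)"
    proof -
      have "psd_tuple F (\<lambda>x. of_real (1 - t) * a x)"
        using a(1) t unfolding psd_tuple_def
        by (intro allI psd_kernel_on_scale iffD2[OF nonneg_Reals_of_real_iff]) auto
      then show ?thesis
        by (simp add: algebra_simps)
    qed
    from var[OF this] show "0 \<le> t\<^sup>2 * sqnorm (cone_elem \<delta> a) - 2 * t * - ip R (cone_elem \<delta> a)"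
      by simp
  qed
  moreover have "ip R ?h = sqnorm R + ip R (cone_elem \<delta> a)"
  proof -
    have "Re (R p q * cnj (?h p q)) = (cmod (R p q))\<^sup>2 + Re (R p q * cnj (cone_elem \<delta> a p q))"
        for p q
    proof -
      have "?h p q = R p q + cone_elem \<delta> a p q"
        by (simp add: R_def)
      then have "R p q * cnj (?h p q) = R p q * cnj (R p q) + R p q * cnj (cone_elem \<delta> a p q)"
        by (simp add: distrib_left)
      then show ?thesis
        unfolding complex_norm_square[symmetric] by (simp flip: of_real_power)
    qed
    then show ?thesis
      unfolding ip_def sqnorm_def by (simp add: sum.distrib)
  qed
  ultimately have ip_h: "sqnorm R \<le> ip R ?h"
    by simp
  have herm_a: "a (l, q, p) = cnj (a (l, p, q))" if "p \<in> F" "q \<in> F" for l p q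
    using a(1) that unfolding psd_tuple_def
    by (intro psd_kernel_hermitian[of F "\<lambda>p q. a (l, p, q)"]) blast+
  have herm_R: "R q p = cnj (R p q)" if "p \<in> F" "q \<in> F" for p q
    using herm_a[OF that] by (simp add: R_def cone_elem_def mult.commute)
  \<comment> \<open>\<open>ip\<close> conjugates one argument while the forms to be tested do not,
    hence the conjugate; the sign turns nonpositive pairings into nonnegative ones.\<close>
  define G where "G p q = - cnj (R p q)" for p q
  have herm_G: "G q p = cnj (G p q)" if "p \<in> F" "q \<in> F" for p q
    using herm_R[OF that] by (simp add: G_def)
  have psd_\<delta>: "psd_kernel_on F (\<lambda>p q. (1 - \<delta> l p * cnj (\<delta> l q)) * G p q)" for l
  proof (rule psd_kernel_onI_Re[OF F])
    show "(1 - \<delta> l q * cnj (\<delta> l p)) * G q p = cnj ((1 - \<delta> l p * cnj (\<delta> l q)) * G p q)"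
        if "p \<in> F" "q \<in> F" for p q
      using herm_G[OF that] by (simp add: mult.commute)
    fix c :: "'x \<Rightarrow> complex"
    \<comment> \<open>A rank-one kernel in slot \<open>l\<close> and zero in the others: pairing
      with it isolates the form of the \<open>l\<close>-th defect kernel at
      \<open>c\<close>.\<close>
    define b where "b t = (case t of (l', p, q) \<Rightarrow> if l' = l then c p * cnj (c q) else 0)" for t
    have "psd_tuple F b"
      unfolding psd_tuple_def
    proof
      fix l'
      show "psd_kernel_on F (\<lambda>p q. b (l', p, q))"
        using psd_kernel_on_rank_one[of F c] psd_kernel_on_zero[of F] by (cases "l' = l")
            (simp_all add: b_def)
    qed
    moreover have "cone_elem \<delta> b p q = (1 - \<delta> l p * cnj (\<delta> l q)) * (c p * cnj (c q))" for p q
    proof -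
      have "cone_elem \<delta> b p q = (\<Sum>l'\<in>UNIV. if l' = l then (1 - \<delta> l p * cnj (\<delta> l q)) *
          (c p * cnj (c q)) else 0)"
        unfolding cone_elem_def by (intro sum.cong refl) (simp add: b_def)
      then show ?thesis
        by simp
    qed
    ultimately have "(\<Sum>p\<in>F. \<Sum>q\<in>F. Re (R p q * cnj ((1 - \<delta> l p * cnj (\<delta> l q)) * (c p * cnj (c q)))))
        \<le> 0"
      using nonpos[of b] by (simp add: ip_def)
    also have "(\<Sum>p\<in>F. \<Sum>q\<in>F. Re (R p q * cnj ((1 - \<delta> l p * cnj (\<delta> l q)) * (c p * cnj (c q)))))
        = (\<Sum>p\<in>F. \<Sum>q\<in>F. Re (cnj (R p q * cnj ((1 - \<delta> l p * cnj (\<delta> l q)) * (c p * cnj (c q))))))"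
      by (simp only: cnj.simps(1))
    also have "\<dots> = - Re (\<Sum>p\<in>F. \<Sum>q\<in>F. (1 - \<delta> l p * cnj (\<delta> l q)) * G p q * c p * cnj (c q))"
      unfolding Re_sum sum_negf[symmetric] uminus_complex.sel(1)[symmetric]
      by (intro sum.cong refl arg_cong[where f = Re]) (simp add: G_def mult_ac)
    finally show "0 \<le> Re (\<Sum>p\<in>F. \<Sum>q\<in>F. (1 - \<delta> l p * cnj (\<delta> l q)) * G p q * c p * cnj (c q))"
      by simp
  qed
  have psd_G: "psd_kernel_on F G"
    by (rule psd_kernel_on_divide_szego[OF F _ psd_\<delta>]) (rule \<delta>)
  \<comment> \<open>Adding \<open>\<epsilon>\<close> times the identity makes \<open>G\<close>
    strictly positive. The defect conditions survive, since the \<open>l\<close>-th one gains the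
    diagonal \<open>(1 - (cmod (\<delta> l p))\<^sup>2) * \<epsilon>\<close>.\<close>
  have eps: "0 \<le> Re (\<Sum>p\<in>F. \<Sum>q\<in>F. ?h p q * G p q) + \<epsilon> * Re (\<Sum>p\<in>F. ?h p p)" if "\<epsilon> > 0" for \<epsilon>
  proof -
    define I :: "'x \<Rightarrow> 'x \<Rightarrow> complex" where "I p q = (if p = q then of_real \<epsilon> else 0)" for p q
    have psd_I: "psd_kernel_on F I"
      unfolding I_def using psd_kernel_on_diagonal[OF F, of "\<lambda>_. \<epsilon>"] that by simp
    have I_sum: "(\<Sum>q\<in>F. g q * I p q) = g p * of_real \<epsilon>" if "p \<in> F" for g p
    proof -
      have "(\<Sum>q\<in>F. g q * I p q) = (\<Sum>q\<in>F. if q = p then g p * of_real \<epsilon> else 0)"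
        by (intro sum.cong refl) (auto simp: I_def)
      then show ?thesis
        using F that by simp
    qed
    have "pd_kernel_on F (\<lambda>p q. G p q + I p q)"
      unfolding pd_kernel_on_def
    proof (intro conjI allI impI)
      fix c assume "(\<Sum>p\<in>F. \<Sum>q\<in>F. (G p q + I p q) * c p * cnj (c q)) = 0"
      then have "(\<Sum>p\<in>F. \<Sum>q\<in>F. G p q * c p * cnj (c q)) + (\<Sum>p\<in>F. \<Sum>q\<in>F. (c p * cnj (c q)) * I p q)
          = 0"
        by (simp add: sum.distrib algebra_simps)
      also have "(\<Sum>p\<in>F. \<Sum>q\<in>F. (c p * cnj (c q)) * I p q) = of_real (\<Sum>p\<in>F. (cmod (c p))\<^sup>2 * \<epsilon>)"
        unfolding of_real_sum by (intro sum.cong refl)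
            (simp only: I_sum of_real_mult complex_norm_square)
      finally have "Re ((\<Sum>p\<in>F. \<Sum>q\<in>F. G p q * c p * cnj (c q)) + of_real (\<Sum>p\<in>F. (cmod (c p))\<^sup>2 * \<epsilon>))
          = Re 0"
        by (rule arg_cong)
      then have "Re (\<Sum>p\<in>F. \<Sum>q\<in>F. G p q * c p * cnj (c q)) + (\<Sum>p\<in>F. (cmod (c p))\<^sup>2 * \<epsilon>) = 0"
        unfolding plus_complex.sel(1) Re_complex_of_real zero_complex.sel(1) .
      moreover have "0 \<le> Re (\<Sum>p\<in>F. \<Sum>q\<in>F. G p q * c p * cnj (c q))"
        using psd_G unfolding psd_kernel_on_finite[OF F] complex_nonneg_Reals_iff by blast
      ultimately have "(\<Sum>p\<in>F. (cmod (c p))\<^sup>2 * \<epsilon>) \<le> 0"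
        by linarith
      then have "(\<Sum>p\<in>F. (cmod (c p))\<^sup>2 * \<epsilon>) = 0"
        using that by (intro antisym sum_nonneg) auto
      then have "\<forall>p\<in>F. (cmod (c p))\<^sup>2 * \<epsilon> = 0"
        using F that by (subst (asm) sum_nonneg_eq_0_iff) auto
      then show "\<forall>p\<in>F. c p = 0"
        using that by simp
    qed (rule psd_kernel_on_add[OF psd_G psd_I])
    moreover have "psd_kernel_on F (\<lambda>p q. (1 - \<delta> l p * cnj (\<delta> l q)) * (G p q + I p q))" for l
    proof -
      have "(1 - \<delta> l p * cnj (\<delta> l q)) * I p q =
          (if p = q then of_real ((1 - (cmod (\<delta> l p))\<^sup>2) * \<epsilon>) else 0)" for p q
        by (simp add: I_def complex_norm_square del: of_real_power)
      moreover have "psd_kernel_on F (\<lambda>p q. if p = q then of_real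
          ((1 - (cmod (\<delta> l p))\<^sup>2) * \<epsilon>) else 0)"
        using \<delta> that by (intro psd_kernel_on_diagonal F) (simp add: power_le_one less_imp_le)
      ultimately have "psd_kernel_on F (\<lambda>p q. (1 - \<delta> l p * cnj (\<delta> l q)) * I p q)"
        by simp
      then show ?thesis
        unfolding distrib_left by (rule psd_kernel_on_add[OF psd_\<delta>])
    qed
    ultimately have "psd_kernel_on F (\<lambda>p q. ?h p q * (G p q + I p q))"
      using assms F unfolding gram_contractive_def by blast
    then have "0 \<le> Re (\<Sum>p\<in>F. \<Sum>q\<in>F. ?h p q * (G p q + I p q) * 1 * cnj 1)"
      unfolding psd_kernel_on_finite[OF F] complex_nonneg_Reals_iff by
          (elim allE[of _ "\<lambda>_. 1"]) simp
    also have "(\<Sum>p\<in>F. \<Sum>q\<in>F. ?h p q * (G p q + I p q) * 1 * cnj 1)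
        = (\<Sum>p\<in>F. \<Sum>q\<in>F. ?h p q * G p q) + (\<Sum>p\<in>F. \<Sum>q\<in>F. ?h p q * I p q)"
      by (simp add: distrib_left sum.distrib)
    also have "(\<Sum>p\<in>F. \<Sum>q\<in>F. ?h p q * I p q) = (\<Sum>p\<in>F. ?h p p * of_real \<epsilon>)"
      by (intro sum.cong refl I_sum)
    also have "\<dots> = of_real \<epsilon> * (\<Sum>p\<in>F. ?h p p)"
      by (simp only: sum_distrib_left mult.commute)
    finally have "0 \<le> Re ((\<Sum>p\<in>F. \<Sum>q\<in>F. ?h p q * G p q) + of_real \<epsilon> * (\<Sum>p\<in>F. ?h p p))" .
    moreover have "Re (of_real \<epsilon> * w) = \<epsilon> * Re w" for w
      by simp
    ultimately show ?thesis
      unfolding plus_complex.sel(1) by metis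
  qed
  have "0 \<le> Re (\<Sum>p\<in>F. \<Sum>q\<in>F. ?h p q * G p q)"
  proof (rule field_le_epsilon)
    fix \<epsilon> :: real assume "\<epsilon> > 0"
    define s where "s = \<bar>Re (\<Sum>p\<in>F. ?h p p)\<bar>"
    have "0 \<le> Re (\<Sum>p\<in>F. \<Sum>q\<in>F. ?h p q * G p q) + \<epsilon> / (s + 1) * Re (\<Sum>p\<in>F. ?h p p)"
      using \<open>\<epsilon> > 0\<close> by (intro eps) (simp add: s_def)
    also have "\<epsilon> / (s + 1) * Re (\<Sum>p\<in>F. ?h p p) \<le> \<epsilon> / (s + 1) * s"
      using \<open>\<epsilon> > 0\<close> by (intro mult_left_mono) (auto simp: s_def)
    also have "\<dots> \<le> \<epsilon>"
      using \<open>\<epsilon> > 0\<close> by (simp add: s_def field_simps)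
    finally show "0 \<le> Re (\<Sum>p\<in>F. \<Sum>q\<in>F. ?h p q * G p q) + \<epsilon>"
      by simp
  qed
  also have "Re (\<Sum>p\<in>F. \<Sum>q\<in>F. ?h p q * G p q) = - ip R ?h"
  proof -
    have "Re (?h p q * G p q) = - Re (R p q * cnj (?h p q))" for p q
      by (simp add: G_def algebra_simps)
    then show ?thesis
      unfolding Re_sum ip_def sum_negf[symmetric] by (intro sum.cong refl) blast
  qed
  finally have "sqnorm R \<le> 0"
    using ip_h by simp
  have "1 - f p * cnj (f q) = cone_elem \<delta> a p q" if "p \<in> F" "q \<in> F" for p q
  proof -
    have "(cmod (R p q))\<^sup>2 \<le> 0"
      by (rule order_trans[OF norm_le_sqnorm[OF that] \<open>sqnorm R \<le> 0\<close>])
    then have "R p q = 0"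
      by simp
    then show ?thesis
      by (simp add: R_def)
  qed
  then show thesis
    using that a(1) by blast
qed

end

text \<open>For finite \<open>F\<close> the tuples solving the problem on \<open>F\<close> form a
  closed set that meets one fixed compact box, and larger \<open>F\<close> give smaller sets. The
  finite intersection property yields a tuple that works for all finite \<open>F\<close> at
  once.\<close>

theorem cone_membership:
  fixes \<delta> :: "'m::finite \<Rightarrow> 'x \<Rightarrow> complex"
  assumes \<delta>: "\<And>l p. p \<in> E \<Longrightarrow> cmod (\<delta> l p) < 1" and gram: "gram_contractive \<delta> E f"
  obtains a where "\<And>l. psd_kernel_on E (a l)"
    "\<And>p q. p \<in> E \<Longrightarrow> q \<in> E \<Longrightarrow> 1 - f p * cnj (f q) = (\<Sum>l\<in>UNIV. (1 - \<delta> l p * cnj (\<delta> l q)) * a l p q)"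
proof -
  \<comment> \<open>The diagonal of the target kernel is at most \<open>1\<close>, so this bound
    depends on the point alone and not on the finite set.\<close>
  define b where "b l p = 1 / (1 - (cmod (\<delta> l p))\<^sup>2)" for l p
  define B where "B t = (case t of (l, p, q) \<Rightarrow> if p \<in> E \<and> q \<in> E then b l p + b l q else 0)" for t
  define C where "C F = {a :: 'm \<times> 'x \<times> 'x \<Rightarrow> complex. \<forall>l. psd_kernel_on F (\<lambda>p q. a (l, p, q))} \<inter>
    {a. \<forall>p\<in>F. \<forall>q\<in>F. 1 - f p * cnj (f q) = cone_elem \<delta> a p q}" for F
  let ?I = "{F. finite F \<and> F \<subseteq> E}" and ?K = "{a :: 'm \<times> 'x \<times> 'x \<Rightarrow> complex. \<forall>t. cmod (a t) \<le> B t}"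
  have C_mono: "C F' \<subseteq> C F" if "F \<subseteq> F'" for F F'
    unfolding C_def
  proof (intro Int_mono Collect_mono impI allI)
    fix a :: "'m \<times> 'x \<times> 'x \<Rightarrow> complex" and l
    assume "\<forall>l. psd_kernel_on F' (\<lambda>p q. a (l, p, q))"
    then have "psd_kernel_on F' (\<lambda>p q. a (l, p, q))"
      by blast
    then show "psd_kernel_on F (\<lambda>p q. a (l, p, q))"
      using that by (rule psd_kernel_on_subset)
  qed (use that in blast)
  have nonempty: "?K \<inter> C F \<noteq> {}" if "F \<in> ?I" for F
  proof -
    have F: "finite F" "F \<subseteq> E"
      using that by auto
    have \<delta>F: "\<And>l p. p \<in> F \<Longrightarrow> cmod (\<delta> l p) < 1"
      using \<delta> F(2) by blast
    have gramF: "gram_contractive \<delta> F f"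
      using gram F(2) unfolding gram_contractive_def by (meson order_trans)
    obtain a where a: "psd_tuple F a" "\<And>p q. p \<in> F \<Longrightarrow> q \<in> F \<Longrightarrow> 1 - f p * cnj (f q)
        = cone_elem \<delta> a p q"
    proof (rule finite_cone_membership[OF F(1) _ gramF])
      fix a assume "psd_tuple F a" "\<And>p q. p \<in> F \<Longrightarrow> q \<in> F \<Longrightarrow> 1 - f p * cnj (f q) = cone_elem \<delta> a p q"
      then show thesis
        by (rule that)
    qed (rule \<delta>F)
    define c where "c t = (case t of (l, p, q) \<Rightarrow> if p \<in> F \<and> q \<in> F then a (l, p, q) else 0)" for t
    have psd: "psd_kernel_on F (\<lambda>p q. a (l, p, q))" for l
      using a(1) by (simp add: psd_tuple_def)
    have nz: "0 < 1 - (cmod (\<delta> l p))\<^sup>2" if "p \<in> E" for l p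
      using \<delta>[OF that, of l] by (simp add: abs_square_less_1)
    have bound: "Re (a (l, p, p)) \<le> b l p" if p: "p \<in> F" for l p
    proof -
      have "(1 - (cmod (\<delta> l p))\<^sup>2) * Re (a (l, p, p)) \<le> Re (1 - f p * cnj (f p))"
        unfolding a(2)[OF p p] by (rule cone_diag[OF F(1) _ a(1) p]) (erule \<delta>F)
      also have "\<dots> \<le> 1"
        unfolding complex_norm_square[symmetric] by (simp flip: of_real_power)
      finally show ?thesis
        using nz p F(2) by (simp add: b_def pos_le_divide_eq mult.commute subset_iff)
    qed
    have "cmod (c t) \<le> B t" for t
    proof (cases t)
      case (fields l p q)
      show ?thesis
      proof (cases "p \<in> F \<and> q \<in> F")
        case True
        then have "cmod (a (l, p, q)) \<le> b l p + b l q"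
          by (intro psd_kernel_bound[OF psd] bound) auto
        then show ?thesis
          using True F(2) by (auto simp: fields c_def B_def)
      next
        case False
        moreover have "0 \<le> b l p" if "p \<in> E" for p
          using nz[OF that, of l] by (simp add: b_def)
        ultimately show ?thesis
          unfolding fields c_def B_def prod.case by (simp only: if_False norm_zero) simp
      qed
    qed
    moreover have "psd_kernel_on F (\<lambda>p q. c (l, p, q))" for l
    proof -
      have "psd_kernel_on F (\<lambda>p q. c (l, p, q)) = psd_kernel_on F (\<lambda>p q. a (l, p, q))"
        by (rule psd_kernel_on_cong) (simp add: c_def)
      then show ?thesis
        using psd by simp
    qed
    moreover have "1 - f p * cnj (f q) = cone_elem \<delta> c p q" if "p \<in> F" "q \<in> F" for p q
    proof -
      have "cone_elem \<delta> c p q = cone_elem \<delta> a p q"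
        unfolding cone_elem_def using that by (intro sum.cong refl) (simp add: c_def)
      then show ?thesis
        using a(2)[OF that] by simp
    qed
    ultimately have "c \<in> ?K \<inter> C F"
      by (simp add: C_def)
    then show ?thesis
      by blast
  qed
  have "?K \<inter> (\<Inter>F\<in>?I. C F) \<noteq> {}"
  proof (rule compact_imp_fip_image)
    show "compact ?K"
      by (rule compact_bounded_functions)
    show "closed (C F)" if "F \<in> ?I" for F
    proof -
      have "{a. \<forall>p\<in>F. \<forall>q\<in>F. 1 - f p * cnj (f q) = cone_elem \<delta> a p q}
          = (\<Inter>p\<in>F. \<Inter>q\<in>F. {a. 1 - f p * cnj (f q) = cone_elem \<delta> a p q})"
        by auto
      moreover have "closed \<dots>"
        unfolding cone_elem_def
        by (intro closed_INT ballI closed_Collect_eq continuous_intros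
            continuous_on_product_coordinates)
      ultimately show ?thesis
        using that unfolding C_def by (intro closed_Int closed_psd_kernel_on) auto
    qed
    fix I' assume I': "finite I'" "I' \<subseteq> ?I"
    then have "\<Union>I' \<in> ?I"
      by auto
    then have "?K \<inter> C (\<Union>I') \<noteq> {}"
      by (rule nonempty)
    moreover have "C (\<Union>I') \<subseteq> (\<Inter>F\<in>I'. C F)"
      using C_mono by blast
    ultimately show "?K \<inter> (\<Inter>F\<in>I'. C F) \<noteq> {}"
      by blast
  qed
  then obtain a where a: "\<And>F. finite F \<Longrightarrow> F \<subseteq> E \<Longrightarrow> a \<in> C F"
    by blast
  show thesis
  proof (rule that[of "\<lambda>l p q. a (l, p, q)"])
    show "psd_kernel_on E (\<lambda>p q. a (l, p, q))" for l
      unfolding psd_kernel_on_iff[of E]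
    proof (intro allI impI)
      fix F c assume "finite F" "F \<subseteq> E"
      then show "(\<Sum>p\<in>F. \<Sum>q\<in>F. a (l, p, q) * c p * cnj (c q)) \<in> \<real>\<^sub>\<ge>\<^sub>0"
        using a[of F] unfolding C_def psd_kernel_on_finite[OF \<open>finite F\<close>] by simp
    qed
    show "1 - f p * cnj (f q) = (\<Sum>l\<in>UNIV. (1 - \<delta> l p * cnj (\<delta> l q)) * a (l, p, q))"
        if "p \<in> E" "q \<in> E" for p q
      using a[of "{p, q}"] that by (simp add: C_def cone_elem_def)
  qed
qed

section \<open>Realizations\<close>

definition point_eval :: "('m::finite \<Rightarrow> 'x \<Rightarrow> complex) \<Rightarrow> 'x \<Rightarrow> complex ^ 'm" where
  "point_eval \<delta> p = (\<chi> l. \<delta> l p)"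

lemma point_eval_polydisc: "(\<And>l. cmod (\<delta> l p) < 1) \<Longrightarrow> point_eval \<delta> p \<in> polydisc"
  by (simp add: point_eval_def polydisc_def)

abbreviation transfer_function where
  "transfer_function \<equiv> contractive_colligation.transfer"

text \<open>Isometry is asked on \<open>M\<close> only, since off \<open>M\<close> the projections
  used in the construction lose norm.\<close>

definition isometric_colligation ::
  "(nat \<Rightarrow> 'h::complex_hilbert) \<Rightarrow> complex \<Rightarrow> 'h ^ 'm::finite \<Rightarrow> 'h ^ 'm \<Rightarrow> ('h ^ 'm \<Rightarrow> 'h ^ 'm) \<Rightarrow> bool"
      where
  "isometric_colligation e a \<beta> \<gamma> D \<longleftrightarrow>
    (let M = direct_sum (\<lambda>_. sequence_span e) in
      sequence_colligation M a \<beta> \<gamma> D e \<and> \<beta> \<in> M \<and>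
      (\<forall>c. \<forall>x\<in>M. norm (colligation a \<beta> \<gamma> D (c, x)) = norm (c, x)))"

context
  fixes e :: "nat \<Rightarrow> 'h::complex_hilbert"
  assumes e: "orthonormal_or_zero e" and norm_e: "\<And>k. norm (e k) = 1"
begin

lemma isometric_colligation_of_sequence:
  fixes z :: "nat \<Rightarrow> complex ^ 'm::finite" and w :: "nat \<Rightarrow> complex"
  assumes z: "\<And>i. z i \<in> polydisc" and psd: "\<And>l. psd_kernel_on UNIV (\<kappa> l)"
    and id: "\<And>i j. 1 - w i * cnj (w j) = (\<Sum>l\<in>UNIV. (1 - z i $ l * cnj (z j $ l)) * \<kappa> l i j)"
  obtains a \<beta> \<gamma> D where "isometric_colligation e a \<beta> \<gamma> (D :: 'h ^ 'm \<Rightarrow> 'h ^ 'm)"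
    "\<And>i. w i = transfer_function (direct_sum (\<lambda>_. sequence_span e)) a \<beta> \<gamma> D (z i)"
proof -
  let ?M = "direct_sum (\<lambda>_ :: 'm. sequence_span e)"
  obtain a \<beta> \<gamma> D u where col: "contractive_colligation ?M a \<beta> \<gamma> D" and \<beta>: "\<beta> \<in> ?M"
    and iso: "\<And>c x. x \<in> ?M \<Longrightarrow> norm (colligation a \<beta> \<gamma> D (c, x)) = norm (c, x)"
    and u: "\<And>i. u i \<in> ?M" "\<And>i. u i = \<gamma> + D (zop (z i) (u i))"
        "\<And>i. w i = a + cinner (zop (z i) (u i)) \<beta>"
    using lurking_isometry[OF e norm_e psd id] by blast
  interpret contractive_colligation ?M a \<beta> \<gamma> D
    by (rule col)
  show thesis
  proof
    show "isometric_colligation e a \<beta> \<gamma> D"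
      unfolding isometric_colligation_def Let_def sequence_colligation_def
          sequence_colligation_axioms_def
      using col \<beta> iso e norm_e by blast
    show "w i = transfer (z i)" for i
      using solution_unique[OF z \<gamma>_M u(1,2), of i] u(3)[of i] by (simp add: transfer_def)
  qed
qed

text \<open>No continuity of \<open>f\<close> is known in advance. A colligation interpolating along
  a sequence with dense image is compared with a second one that also interpolates at
  \<open>p\<close>. Both transfer functions are continuous and agree on a dense set, hence at
  \<open>p\<close>.\<close>

theorem isometric_colligation_of_cone:
  fixes \<delta> :: "'m::finite \<Rightarrow> 'x \<Rightarrow> complex"
  assumes \<delta>: "\<And>l p. p \<in> E \<Longrightarrow> cmod (\<delta> l p) < 1"
    and psd: "\<And>l. psd_kernel_on E (\<kappa> l)"
    and id: "\<And>p q. p \<in> E \<Longrightarrow> q \<in> E \<Longrightarrow> 1 - f p * cnj (f q) =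
        (\<Sum>l\<in>UNIV. (1 - \<delta> l p * cnj (\<delta> l q)) * \<kappa> l p q)"
  obtains a \<beta> \<gamma> D where "isometric_colligation e a \<beta> \<gamma> (D :: 'h ^ 'm \<Rightarrow> 'h ^ 'm)"
    "\<And>p. p \<in> E \<Longrightarrow> f p = transfer_function (direct_sum (\<lambda>_. sequence_span e)) a \<beta> \<gamma> D
        (point_eval \<delta> p)"
proof (cases "E = {}")
  case True
  show thesis
  \<comment> \<open>Nothing has to be interpolated, so the value \<open>1\<close> at the origin with
    zero kernels supplies some colligation.\<close>
  proof (rule isometric_colligation_of_sequence[of "\<lambda>_. 0 :: complex ^ 'm" "\<lambda>_ _ _. 0" "\<lambda>_. 1"])
    fix a \<beta> \<gamma> and D :: "'h ^ 'm \<Rightarrow> 'h ^ 'm"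
    assume "isometric_colligation e a \<beta> \<gamma> D"
    then show thesis
      using that True by blast
  qed (simp_all add: polydisc_def psd_kernel_on_zero)
next
  case False
  let ?M = "direct_sum (\<lambda>_ :: 'm. sequence_span e)" and ?z = "point_eval \<delta>"
  have z: "?z p \<in> polydisc" if "p \<in> E" for p
    using \<delta> that by (intro point_eval_polydisc)
  have seq: "\<exists>a \<beta> \<gamma> D. isometric_colligation e a \<beta> \<gamma> (D :: 'h ^ 'm \<Rightarrow> 'h ^ 'm) \<and>
      (\<forall>i. f (x i) = transfer_function ?M a \<beta> \<gamma> D (?z (x i)))" if x: "\<And>i. x i \<in> E" for x :: "nat \<Rightarrow>
          'x"
  proof -
    have psd_x: "psd_kernel_on UNIV (\<lambda>i j. \<kappa> l (x i) (x j))" for l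
      using x by (intro psd_kernel_on_compose[OF psd]) auto
    have id_x: "1 - f (x i) * cnj (f (x j)) =
        (\<Sum>l\<in>UNIV. (1 - ?z (x i) $ l * cnj (?z (x j) $ l)) * \<kappa> l (x i) (x j))" for i j
      unfolding id[OF x x] point_eval_def by simp
    show ?thesis
    proof (rule isometric_colligation_of_sequence[OF z[OF x] psd_x id_x])
      fix a \<beta> \<gamma> and D :: "'h ^ 'm \<Rightarrow> 'h ^ 'm"
      assume "isometric_colligation e a \<beta> \<gamma> D"
        "\<And>i. f (x i) = transfer_function ?M a \<beta> \<gamma> D (?z (x i))"
      then show ?thesis
        by blast
    qed
  qed
  obtain T where T: "countable T" "T \<subseteq> ?z ` E" "?z ` E \<subseteq> closure T"
    by (rule separable)
  have "T \<noteq> {}"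
    using T(3) False by auto
  define x where "x i = inv_into E ?z (from_nat_into T i)" for i
  have x: "x i \<in> E" "?z (x i) = from_nat_into T i" for i
    using from_nat_into[OF \<open>T \<noteq> {}\<close>, of i] T(2)
    by (auto simp: x_def intro: inv_into_into f_inv_into_f)
  obtain a \<beta> \<gamma> D where iso: "isometric_colligation e a \<beta> \<gamma> (D :: 'h ^ 'm \<Rightarrow> 'h ^ 'm)"
    and fx: "\<And>i. f (x i) = transfer_function ?M a \<beta> \<gamma> D (?z (x i))"
    using seq[of x] x(1) by blast
  have cont: "continuous_on polydisc (transfer_function ?M a \<beta> \<gamma> D)"
    if "isometric_colligation e a \<beta> \<gamma> (D :: 'h ^ 'm \<Rightarrow> 'h ^ 'm)" for a \<beta> \<gamma> D
  proof (rule holo_continuous_on[OF contractive_colligation.transfer_holo])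
    show "contractive_colligation ?M a \<beta> \<gamma> D"
      using that unfolding isometric_colligation_def Let_def sequence_colligation_def by blast
  qed
  have "f p = transfer_function ?M a \<beta> \<gamma> D (?z p)" if p: "p \<in> E" for p
  proof -
    \<comment> \<open>Prepending \<open>p\<close> forces interpolation at \<open>p\<close> and keeps
      it along the dense sequence.\<close>
    define x' where "x' i = (case i of 0 \<Rightarrow> p | Suc i \<Rightarrow> x i)" for i
    have "x' i \<in> E" for i
      using x(1) p by (simp add: x'_def split: nat.split)
    then obtain a' \<beta>' \<gamma>' D' where iso': "isometric_colligation e a' \<beta>' \<gamma>' (D' :: 'h ^ 'm \<Rightarrow> 'h ^ 'm)"
      and fx': "\<And>i. f (x' i) = transfer_function ?M a' \<beta>' \<gamma>' D' (?z (x' i))"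
      using seq[of x'] by blast
    let ?F = "transfer_function ?M a \<beta> \<gamma> D" and ?F' = "transfer_function ?M a' \<beta>' \<gamma>' D'"
    have eq: "?F t = ?F' t" if t: "t \<in> T" for t
    proof -
      obtain i where "t = ?z (x i)"
        using x(2) from_nat_into_surj[OF T(1) t] by metis
      then show ?thesis
        using fx[of i] fx'[of "Suc i"] by (simp add: x'_def)
    qed
    have "?z p \<in> closure T"
      using p by (intro subsetD[OF T(3)] imageI)
    then obtain t where t: "\<And>n. t n \<in> T" "t \<longlonglongrightarrow> ?z p"
      by (auto simp: closure_sequential)
    have pt: "t n \<in> polydisc" for n
    proof -
      have "t n \<in> ?z ` E"
        by (rule subsetD[OF T(2) t(1)])
      then show ?thesis
        using z by auto
    qed
    have "(\<lambda>n. ?F (t n)) \<longlonglongrightarrow> ?F (?z p)"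
      by (rule continuous_on_tendsto_compose[OF cont[OF iso] t(2) z[OF p]]) (simp add: pt)
    moreover have "(\<lambda>n. ?F' (t n)) \<longlonglongrightarrow> ?F' (?z p)"
      by (rule continuous_on_tendsto_compose[OF cont[OF iso'] t(2) z[OF p]]) (simp add: pt)
    then have "(\<lambda>n. ?F (t n)) \<longlonglongrightarrow> ?F' (?z p)"
      by (simp only: eq[OF t(1)])
    ultimately have "?F (?z p) = ?F' (?z p)"
      by (rule LIMSEQ_unique)
    then show ?thesis
      using fx'[of 0] by (simp add: x'_def)
  qed
  then show thesis
    using that iso by blast
qed

text \<open>The equation \<open>x - D (zop z x) = y\<close> is the fixed point equation for
  \<open>solution y z\<close>. Unique solvability is bijectivity, and the inverse image of
  \<open>\<gamma>\<close> is the state.\<close>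

lemma realization_of_isometric_colligation:
  fixes \<delta> :: "'m::finite \<Rightarrow> complex ^ 'd \<Rightarrow> complex"
  assumes iso: "isometric_colligation e a \<beta> \<gamma> (D :: 'h ^ 'm \<Rightarrow> 'h ^ 'm)"
    and \<delta>: "\<And>l p. p \<in> E \<Longrightarrow> cmod (\<delta> l p) < 1"
    and f: "\<And>p. p \<in> E \<Longrightarrow> f p = transfer_function (direct_sum (\<lambda>_. sequence_span e)) a \<beta> \<gamma> D
        (point_eval \<delta> p)"
  shows "realization \<delta> E f (\<lambda>_. sequence_span e) a \<beta> \<gamma> D"
proof -
  let ?M = "direct_sum (\<lambda>_ :: 'm. sequence_span e)"
  have col: "contractive_colligation ?M a \<beta> \<gamma> D" and \<beta>: "\<beta> \<in> ?M"
    and norm: "\<And>c x. x \<in> ?M \<Longrightarrow> norm (colligation a \<beta> \<gamma> D (c, x)) = norm (c, x)"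
    using iso unfolding isometric_colligation_def Let_def sequence_colligation_def by blast+
  interpret contractive_colligation ?M a \<beta> \<gamma> D
    by (rule col)
  have "bij_betw (\<lambda>x. x - D (delta_op \<delta> p x)) ?M ?M \<and>
      f p = a + cinner (delta_op \<delta> p (inv_into ?M (\<lambda>x. x - D (delta_op \<delta> p x)) \<gamma>)) \<beta>" if p: "p \<in>
          E" for p
  proof -
    let ?z = "point_eval \<delta> p"
    let ?R = "\<lambda>x. x - D (zop ?z x)"
    have z: "?z \<in> polydisc"
      using \<delta> p by (intro point_eval_polydisc)
    have R_iff: "?R x = y \<longleftrightarrow> x = y + D (zop ?z x)" for x y
      by (auto simp: algebra_simps)
    have R_M: "?R x \<in> ?M" if "x \<in> ?M" for x
      by (rule closed_csubspaceD(5)[OF closed_M that D_M])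
    have bij: "bij_betw ?R ?M ?M"
    proof (rule bij_betw_imageI)
      show "inj_on ?R ?M"
      proof (rule inj_onI)
        fix x y assume xy: "x \<in> ?M" "y \<in> ?M" "?R x = ?R y"
        have "x = solution (?R y) ?z" "y = solution (?R y) ?z"
          using xy R_iff R_M by (auto intro!: solution_unique[OF z])
        then show "x = y"
          by metis
      qed
      show "?R ` ?M = ?M"
      proof
        show "?M \<subseteq> ?R ` ?M"
        proof
          fix y assume "y \<in> ?M"
          then have "solution y ?z \<in> ?M" "y = ?R (solution y ?z)"
            using solution[OF z] R_iff by metis+
          then show "y \<in> ?R ` ?M"
            by blast
        qed
      qed (use R_M in blast)
    qed
    have "inv_into ?M ?R \<gamma> = state ?z"
      using solution[OF z \<gamma>_M] R_iff[of "state ?z" \<gamma>] bij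
      by (intro inv_into_f_eq) (auto simp: bij_betw_def)
    then show ?thesis
      unfolding delta_op_eq_zop point_eval_def[symmetric] using bij f[OF p] by
          (simp add: transfer_def)
  qed
  moreover have "bounded_operator_on ?M D"
    unfolding bounded_operator_on_def using D_M D_add D_scaleC norm_D_le by
        (auto intro!: exI[of _ 1])
  ultimately show ?thesis
    unfolding realization_def Let_def
    using closed_sequence_span[OF e norm_e] \<beta> \<gamma>_M norm by blast
qed

lemma polydisc_norm_transfer_le:
  assumes iso: "isometric_colligation e a \<beta> \<gamma>
      (D :: 'h ^ 'm::{finite,linorder} \<Rightarrow> 'h ^ 'm::{finite,linorder})"
  shows "polydisc_norm TYPE('k::complex_hilbert)
      (transfer_function (direct_sum (\<lambda>_. sequence_span e)) a \<beta> \<gamma> D) \<le> 1"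
    and "transfer_function (direct_sum (\<lambda>_. sequence_span e)) a \<beta> \<gamma> D \<in> Hinf_m TYPE('k)"
proof -
  let ?F = "transfer_function (direct_sum (\<lambda>_. sequence_span e)) a \<beta> \<gamma> D"
  have col: "sequence_colligation (direct_sum (\<lambda>_. sequence_span e)) a \<beta> \<gamma> D e"
    using iso unfolding isometric_colligation_def Let_def by blast
  show le: "polydisc_norm TYPE('k) ?F \<le> 1"
    unfolding polydisc_norm_def
  proof (rule SUP_least, clarify)
    fix T :: "'m \<Rightarrow> 'k \<Rightarrow>\<^sub>L 'k" and \<Phi>
    assume "T \<in> commuting_contractions" "functional_calculus T \<Phi>"
    then have "norm (\<Phi> ?F) \<le> 1"
      by (intro sequence_colligation.norm_calculus_transfer_le[OF col])
          (auto simp: commuting_contractions_def)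
    then show "ennreal (norm (\<Phi> ?F)) \<le> 1"
      by simp
  qed
  have "?F \<in> holo polydisc"
    using col unfolding sequence_colligation_def by
        (intro contractive_colligation.transfer_holo) blast
  then show "?F \<in> Hinf_m TYPE('k)"
    using le by (auto simp: Hinf_m_def intro: le_less_trans)
qed

end

text \<open>The isometry property of the colligation, polarized at the vectors \<open>1 \<oplus> \<delta>(p) u\<^sub>p\<close>.\<close>

lemma C_cone_of_realization:
  fixes \<delta> :: "'m::finite \<Rightarrow> complex ^ 'd \<Rightarrow> complex" and D :: "'h::complex_hilbert ^ 'm \<Rightarrow> 'h ^ 'm"
  assumes real: "realization \<delta> E f Ms a \<beta> \<gamma> D"
  shows "(\<lambda>p q. 1 - cnj (f q) * f p) \<in> C_cone \<delta> E"
proof -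
  define M where "M = direct_sum Ms"
  have closed: "closed_csubspace (Ms l)" and \<gamma>: "\<gamma> \<in> M" and D: "bounded_operator_on M D"
    and iso: "\<And>c x. x \<in> M \<Longrightarrow> norm (colligation a \<beta> \<gamma> D (c, x)) = norm (c, x)" for l
    using real unfolding realization_def Let_def M_def by blast+
  have R: "bij_betw (\<lambda>x. x - D (delta_op \<delta> p x)) M M"
    "f p = a + cinner (delta_op \<delta> p (inv_into M (\<lambda>x. x - D (delta_op \<delta> p x)) \<gamma>)) \<beta>" if "p \<in> E" for p
    using real that unfolding realization_def Let_def M_def by blast+
  define u where "u p = inv_into M (\<lambda>x. x - D (delta_op \<delta> p x)) \<gamma>" for p
  define v where "v p = delta_op \<delta> p (u p)" for p
  have closed_M: "closed_csubspace M"
    unfolding M_def by (rule closed_csubspace_direct_sum[OF closed])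
  have u: "u p \<in> M" "u p = \<gamma> + D (v p)" "f p = a + cinner (v p) \<beta>" if "p \<in> E" for p
  proof -
    have im: "\<gamma> \<in> (\<lambda>x. x - D (delta_op \<delta> p x)) ` M"
      using R(1)[OF that] \<gamma> by (simp add: bij_betw_def)
    show "u p \<in> M"
      unfolding u_def by (rule inv_into_into[OF im])
    show "u p = \<gamma> + D (v p)"
      using f_inv_into_f[OF im] unfolding u_def[symmetric] v_def by (simp add: algebra_simps)
    show "f p = a + cinner (v p) \<beta>"
      using R(2)[OF that] unfolding u_def[symmetric] v_def .
  qed
  have v: "v p \<in> M" if "p \<in> E" for p
    using u(1)[OF that] unfolding v_def delta_op_eq_zop M_def direct_sum_def
    by (auto intro: closed_csubspaceD(4)[OF closed])
  have col: "colligation a \<beta> \<gamma> D (1 + c, v p + scaleC c (v q)) = (f p, u p) + scaleC c (f q, u q)"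
    if "p \<in> E" "q \<in> E" for p q c
  proof -
    have "D (v p + scaleC c (v q)) = D (v p) + scaleC c (D (v q))"
      using D v[OF that(1)] v[OF that(2)] closed_csubspaceD(4)[OF closed_M v[OF that(2)], of c]
      unfolding bounded_operator_on_def by simp
    then show ?thesis
      using u(2,3)[OF that(1)] u(2,3)[OF that(2)]
      by (simp add: colligation_def scaleC_prod_def scaleC_complex_def cinner_linear scaleC_add_left
          scaleC_add_right algebra_simps)
  qed
  have inner: "cinner (1 :: complex, v p) (1, v q) = cinner (f p, u p) (f q, u q)"
      if "p \<in> E" "q \<in> E" for p q
  proof (rule cinner_eq_of_norm_eq)
    show "norm ((1 :: complex, v p) + scaleC c (1, v q)) = norm ((f p, u p) + scaleC c (f q, u q))"
        for c
    proof -
      have "v p + scaleC c (v q) \<in> M"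
        by (intro closed_csubspaceD(3,4)[OF closed_M] v that)
      then show ?thesis
        unfolding col[OF that, symmetric] by (simp add: iso scaleC_prod_def scaleC_complex_def)
    qed
    show "norm (1 :: complex, v q) = norm (f q, u q)"
      using col[OF that(2) that(2), of 0] iso[OF v[OF that(2)], of 1] by simp
  qed
  have "1 - cnj (f q) * f p = (\<Sum>l\<in>UNIV. (1 - cnj (\<delta> l q) * \<delta> l p) * cinner (u p $ l) (u q $ l))"
    if "p \<in> E" "q \<in> E" for p q
  proof -
    have "1 + cinner (v p) (v q) = f p * cnj (f q) + cinner (u p) (u q)"
      using inner[OF that] by (simp add: cinner_prod_def cinner_complex_def)
    moreover have "cinner (v p) (v q) = (\<Sum>l\<in>UNIV. \<delta> l p * cnj (\<delta> l q) * cinner (u p $ l) (u q $ l))"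
      unfolding v_def delta_op_eq_zop cinner_zop_zop by simp
    ultimately show ?thesis
      unfolding cinner_vec_def[of "u p"] left_diff_distrib sum_subtractf
      by (simp add: algebra_simps)
  qed
  then show ?thesis
    unfolding C_cone_def
    by (intro CollectI exI[of _ "\<lambda>l p q. cinner (u p $ l) (u q $ l)"] conjI allI ballI
        psd_kernel_on_cinner)
qed

lemma gram_contractive_of_polydisc_norm:
  fixes \<delta> :: "'m::{finite,linorder} \<Rightarrow> 'x \<Rightarrow> complex" and e :: "nat \<Rightarrow> 'k::complex_hilbert"
  assumes e: "orthonormal_or_zero e" and norm_e: "\<And>k. norm (e k) = 1"
    and \<delta>: "\<And>l p. p \<in> E \<Longrightarrow> cmod (\<delta> l p) < 1"
    and H: "polydisc_norm TYPE('k) H \<le> 1" and f: "\<And>p. p \<in> E \<Longrightarrow> f p = H (point_eval \<delta> p)"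
  shows "gram_contractive \<delta> E f"
  unfolding gram_contractive_def
proof (intro allI impI)
  fix F and G :: "'x \<Rightarrow> 'x \<Rightarrow> complex"
  assume F: "finite F" "F \<subseteq> E" and pd: "pd_kernel_on F G"
    and psd: "\<forall>l. psd_kernel_on F (\<lambda>p q. (1 - \<delta> l p * cnj (\<delta> l q)) * G p q)"
  obtain v :: "'x \<Rightarrow> nat \<Rightarrow> complex"
    where v: "\<And>p q. p \<in> F \<Longrightarrow> q \<in> F \<Longrightarrow> G p q = (\<Sum>k<card F. v p k * cnj (v q k))"
    using psd_kernel_finite_factorization[OF F(1), of G] pd unfolding pd_kernel_on_def by blast
  \<comment> \<open>The orthonormal sequence carries the coordinate vectors of the factorization
    into \<open>'k\<close> and preserves their Gram matrix.\<close>
  define k where "k p = (\<Sum>i<card F. scaleC (v p i) (e i))" for p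
  have gram: "cinner (k p) (k q) = G p q" if "p \<in> F" "q \<in> F" for p q
  proof -
    have orth: "cinner (e i) (e j) = (if i = j then 1 else 0)" for i j
      using orthonormal_or_zeroD(1)[OF e] by (simp add: cinner_self norm_e)
    have "cinner (k p) (k q) = (\<Sum>i<card F. \<Sum>j<card F. v p i * (cnj (v q j) * cinner (e i) (e j)))"
      unfolding k_def cinner_sum_left cinner_scaleC_left
      by (simp add: cinner_sum_right cinner_scaleC_right sum_distrib_left)
    also have "\<dots> = (\<Sum>i<card F. \<Sum>j<card F. if j = i then v p i * cnj (v q i) else 0)"
      by (intro sum.cong refl) (auto simp: orth)
    finally have "cinner (k p) (k q) = (\<Sum>i<card F. \<Sum>j<card F. if j = i then v p i * cnj
        (v q i) else 0)" .
    then show ?thesis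
      using v[OF that] by simp
  qed
  have pd': "pd_kernel_on F (\<lambda>p q. cinner (k p) (k q))"
  proof -
    have eq: "(\<Sum>p\<in>F. \<Sum>q\<in>F. cinner (k p) (k q) * c p * cnj (c q)) =
        (\<Sum>p\<in>F. \<Sum>q\<in>F. G p q * c p * cnj (c q))" for c
      by (intro sum.cong refl) (simp add: gram)
    show ?thesis
      unfolding pd_kernel_on_def eq
      by (intro conjI psd_kernel_on_cinner conjunct2[OF pd[unfolded pd_kernel_on_def]])
  qed
  interpret independent_family F k
    by standard (fact F(1), fact pd')
  have "psd_kernel_on F (\<lambda>p q. (1 - H (point_eval \<delta> p) * cnj (H (point_eval \<delta> q))) * cinner (k p)
      (k q))"
  proof (rule psd_defect_of_polydisc_norm[OF _ _ H])
    show "point_eval \<delta> p \<in> polydisc" if "p \<in> F" for p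
      using that F(2) \<delta> by (intro point_eval_polydisc) blast
    show "psd_kernel_on F (\<lambda>p q. (1 - point_eval \<delta> p $ l * cnj (point_eval \<delta> q $ l)) * cinner (k p)
        (k q))" for l
    proof (subst psd_kernel_on_cong)
      show "psd_kernel_on F (\<lambda>p q. (1 - \<delta> l p * cnj (\<delta> l q)) * G p q)"
        using psd by blast
    qed (simp add: point_eval_def gram)
  qed
  then show "psd_kernel_on F (\<lambda>p q. (1 - f p * cnj (f q)) * G p q)"
  proof (subst psd_kernel_on_cong)
    show "(1 - f p * cnj (f q)) * G p q =
        (1 - H (point_eval \<delta> p) * cnj (H (point_eval \<delta> q))) * cinner (k p) (k q)"
      if "p \<in> F" "q \<in> F" for p q
      using that F(2) f gram by (simp add: subset_iff)
  qed
qed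

text \<open>After multiplication by \<open>G\<close>, each summand of the decomposition is the Schur
  product of \<open>\<kappa> l\<close> with the \<open>l\<close>-th defect kernel of
  \<open>G\<close>.\<close>

lemma psd_defect_of_cone:
  fixes \<delta> :: "'m::finite \<Rightarrow> 'x \<Rightarrow> complex"
  assumes psd: "\<And>l. psd_kernel_on F (\<kappa> l)"
    and id: "\<And>p q. p \<in> F \<Longrightarrow> q \<in> F \<Longrightarrow> 1 - f p * cnj (f q) =
        (\<Sum>l\<in>UNIV. (1 - \<delta> l p * cnj (\<delta> l q)) * \<kappa> l p q)"
    and G: "\<And>l. psd_kernel_on F (\<lambda>p q. (1 - \<delta> l p * cnj (\<delta> l q)) * G p q)"
  shows "psd_kernel_on F (\<lambda>p q. (1 - f p * cnj (f q)) * G p q)"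
proof -
  have sum_psd: "psd_kernel_on F (\<lambda>p q. \<Sum>l\<in>L. (1 - \<delta> l p * cnj (\<delta> l q)) * G p q * \<kappa> l p q)"
      if "finite L" for L
    using that
  proof (induction L)
    case (insert l L)
    then show ?case
      using psd_kernel_on_add[OF psd_kernel_on_mult[OF G psd]] by simp
  qed (simp add: psd_kernel_on_zero)
  show ?thesis
  proof (subst psd_kernel_on_cong)
    show "psd_kernel_on F (\<lambda>p q. \<Sum>l\<in>UNIV. (1 - \<delta> l p * cnj (\<delta> l q)) * G p q * \<kappa> l p q)"
      by (rule sum_psd) simp
    show "(1 - f p * cnj (f q)) * G p q = (\<Sum>l\<in>UNIV. (1 - \<delta> l p * cnj (\<delta> l q)) * G p q * \<kappa> l p q)"
      if "p \<in> F" "q \<in> F" for p q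
      unfolding id[OF that] sum_distrib_right by (intro sum.cong refl) (simp add: mult_ac)
  qed
qed

section \<open>Generic tuples of matrices\<close>

text \<open>Independence is enough, as \<open>card \<Lambda>\<close> independent vectors in
  dimension \<open>card \<Lambda>\<close> span. Because coefficients are indexed by points,
  injectivity of \<open>k\<close> is a consequence.\<close>

definition coordinate_basis :: "'x set \<Rightarrow> ('x \<Rightarrow> complex Matrix.vec) \<Rightarrow> bool" where
  "coordinate_basis \<Lambda> k \<longleftrightarrow> (\<forall>p\<in>\<Lambda>. k p \<in> carrier_vec (card \<Lambda>)) \<and>
    (\<forall>c. (\<forall>i<card \<Lambda>. (\<Sum>p\<in>\<Lambda>. c p * vec_index (k p) i) = 0) \<longrightarrow> (\<forall>p\<in>\<Lambda>. c p = 0))"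

lemma coordinate_basis_of_basis:
  assumes "finite \<Lambda>" "inj_on k \<Lambda>"
    and "vectorspace.basis class_ring (module_vec TYPE(complex) (card \<Lambda>)) (k ` \<Lambda>)"
  shows "coordinate_basis \<Lambda> k"
proof -
  interpret vec_space "TYPE(complex)" "card \<Lambda>" .
  have basis: "lin_indpt (k ` \<Lambda>)" "k ` \<Lambda> \<subseteq> carrier_vec (card \<Lambda>)"
    using assms(3) unfolding basis_def by auto
  have "c p = 0" if c: "\<forall>i<card \<Lambda>. (\<Sum>p\<in>\<Lambda>. c p * vec_index (k p) i) = 0" and p: "p \<in> \<Lambda>" for c p
  proof -
    define a where "a x = c (inv_into \<Lambda> k x)" for x
    have ak: "a (k p) = c p" if "p \<in> \<Lambda>" for p
      using that assms(2) by (simp add: a_def)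
    have "lincomb a (k ` \<Lambda>) = 0\<^sub>v (card \<Lambda>)"
    proof (rule eq_vecI)
      show "dim_vec (lincomb a (k ` \<Lambda>)) = dim_vec (0\<^sub>v (card \<Lambda>))"
        using lincomb_dim[OF _ basis(2)] assms(1) by simp
      fix i assume "i < dim_vec (0\<^sub>v (card \<Lambda>) :: complex Matrix.vec)"
      then have i: "i < card \<Lambda>"
        by simp
      have "vec_index (lincomb a (k ` \<Lambda>)) i = (\<Sum>p\<in>\<Lambda>. c p * vec_index (k p) i)"
        unfolding lincomb_index[OF i basis(2)] sum.reindex[OF assms(2)] by (intro sum.cong refl)
            (simp add: ak)
      then show "vec_index (lincomb a (k ` \<Lambda>)) i = vec_index (0\<^sub>v (card \<Lambda>)) i"
        using c i by simp
    qed
    then have "a \<in> k ` \<Lambda> \<rightarrow> {0}"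
      using not_lindepD[OF basis(1), of "k ` \<Lambda>" a] assms(1) by auto
    then show ?thesis
      using funcset_mem[of a "k ` \<Lambda>" "{0}" "k p"] ak[OF p] p by simp
  qed
  then show ?thesis
    using basis(2) unfolding coordinate_basis_def by blast
qed

lemma basis_of_coordinate_basis:
  assumes "finite \<Lambda>" "coordinate_basis \<Lambda> k"
  shows "inj_on k \<Lambda>" "vectorspace.basis class_ring (module_vec TYPE(complex) (card \<Lambda>)) (k ` \<Lambda>)"
proof -
  interpret vec_space "TYPE(complex)" "card \<Lambda>" .
  have carrier: "k ` \<Lambda> \<subseteq> carrier_vec (card \<Lambda>)"
    using assms(2) by (auto simp: coordinate_basis_def)
  have indep: "c p = 0" if "\<forall>i<card \<Lambda>. (\<Sum>p\<in>\<Lambda>. c p * vec_index (k p) i) = 0" "p \<in> \<Lambda>" for c p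
    using assms(2) that unfolding coordinate_basis_def by blast
  show inj: "inj_on k \<Lambda>"
  proof (rule inj_onI, rule ccontr)
    fix p q assume pq: "p \<in> \<Lambda>" "q \<in> \<Lambda>" "k p = k q" "p \<noteq> q"
    define c where "c r = (if r = p then 1 else if r = q then -1 else (0::complex))" for r
    have sum0: "(\<Sum>r\<in>\<Lambda>. c r * vec_index (k r) i) = 0" for i
    proof -
      have "(\<Sum>r\<in>\<Lambda>. c r * vec_index (k r) i) = (\<Sum>r\<in>{p, q}. c r * vec_index (k r) i)"
        using assms(1) pq by (intro sum.mono_neutral_right) (auto simp: c_def)
      also have "\<dots> = vec_index (k p) i - vec_index (k q) i"
        using pq(4) by (simp add: c_def)
      finally show ?thesis
        using pq(3) by simp
    qed
    have "c p = 0"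
      by (rule indep[OF _ pq(1)]) (simp add: sum0)
    then show False
      by (simp add: c_def)
  qed
  have "lin_indpt (k ` \<Lambda>)"
  proof (rule finite_lin_indpt2)
    show "finite (k ` \<Lambda>)"
      using assms(1) by simp
    show "k ` \<Lambda> \<subseteq> carrier_vec (card \<Lambda>)"
      by (rule carrier)
    fix a :: "complex Matrix.vec \<Rightarrow> complex"
    assume a: "lincomb a (k ` \<Lambda>) = 0\<^sub>v (card \<Lambda>)"
    have "(\<Sum>p\<in>\<Lambda>. a (k p) * vec_index (k p) i) = 0" if "i < card \<Lambda>" for i
      using lincomb_index[OF that carrier, of a] a that
          sum.reindex[OF inj, of "\<lambda>x. a x * vec_index x i"] by simp
    then show "\<forall>v\<in>k ` \<Lambda>. a v = 0"
      using indep[of "\<lambda>p. a (k p)"] by blast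
  qed
  then show "vectorspace.basis class_ring (module_vec TYPE(complex) (card \<Lambda>)) (k ` \<Lambda>)"
    using assms(1) carrier card_image[OF inj] by (intro dim_li_is_basis) (simp_all add: dim_is_n)
qed

lemma coordinate_basis_span:
  assumes "finite \<Lambda>" "coordinate_basis \<Lambda> k" "v \<in> carrier_vec (card \<Lambda>)"
  shows "\<exists>c. \<forall>i<card \<Lambda>. vec_index v i = (\<Sum>p\<in>\<Lambda>. c p * vec_index (k p) i)"
proof -
  interpret vec_space "TYPE(complex)" "card \<Lambda>" .
  note b = basis_of_coordinate_basis[OF assms(1,2)]
  have carrier: "k ` \<Lambda> \<subseteq> carrier_vec (card \<Lambda>)"
    using assms(2) by (auto simp: coordinate_basis_def)
  have "v \<in> span (k ` \<Lambda>)"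
    using b(2) assms(3) unfolding basis_def by auto
  then obtain a where a: "lincomb a (k ` \<Lambda>) = v"
    using finite_in_span[of "k ` \<Lambda>" v] assms(1) carrier by auto
  have "vec_index v i = (\<Sum>p\<in>\<Lambda>. a (k p) * vec_index (k p) i)" if "i < card \<Lambda>" for i
    using lincomb_index[OF that carrier, of a] a sum.reindex[OF b(1), of "\<lambda>x. a x * vec_index x i"]
        by simp
  then show ?thesis
    by (intro exI[of _ "\<lambda>p. a (k p)"]) blast
qed

section \<open>Matrix norms and matrices diagonal in a given basis\<close>

lemma mult_mat_vec_index:
  assumes "A \<in> carrier_mat n n" "v \<in> carrier_vec n" "i < n"
  shows "vec_index (A *\<^sub>v v) i = (\<Sum>j<n. A $$ (i, j) * vec_index v j)"
  using assms by (simp add: scalar_prod_def atLeast0LessThan)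

lemma mult_mat_vec_combination:
  fixes A :: "'a::comm_semiring_0 mat"
  assumes "A \<in> carrier_mat n n" "v \<in> carrier_vec n" "\<And>p. p \<in> \<Lambda> \<Longrightarrow> k p \<in> carrier_vec n" "i < n"
    and "\<And>j. j < n \<Longrightarrow> vec_index v j = (\<Sum>p\<in>\<Lambda>. c p * vec_index (k p) j)"
  shows "vec_index (A *\<^sub>v v) i = (\<Sum>p\<in>\<Lambda>. c p * vec_index (A *\<^sub>v k p) i)"
proof -
  have "vec_index (A *\<^sub>v v) i = (\<Sum>j<n. \<Sum>p\<in>\<Lambda>. c p * (A $$ (i, j) * vec_index (k p) j))"
    unfolding mult_mat_vec_index[OF assms(1,2,4)]
  proof (rule sum.cong[OF refl])
    fix j assume "j \<in> {..<n}"
    then show "A $$ (i, j) * vec_index v j = (\<Sum>p\<in>\<Lambda>. c p * (A $$ (i, j) * vec_index (k p) j))"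
      using assms(5)[of j] by (simp only: lessThan_iff sum_distrib_left
          mult.left_commute[of "A $$ (i, j)"])
  qed
  also have "\<dots> = (\<Sum>p\<in>\<Lambda>. \<Sum>j<n. c p * (A $$ (i, j) * vec_index (k p) j))"
    by (rule sum.swap)
  also have "\<dots> = (\<Sum>p\<in>\<Lambda>. c p * vec_index (A *\<^sub>v k p) i)"
    by (intro sum.cong refl) (simp only: mult_mat_vec_index[OF assms(1,3,4)] sum_distrib_left)
  finally show ?thesis .
qed

lemma vec_norm2_power2: "v \<in> carrier_vec n \<Longrightarrow> (vec_norm2 v)\<^sup>2 = (\<Sum>i<n. (cmod (vec_index v i))\<^sup>2)"
  by (simp add: vec_norm2_def L2_set_def sum_nonneg)

lemma vec_norm2_nonneg: "0 \<le> vec_norm2 v"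
  by (simp add: vec_norm2_def)

text \<open>A real supremum is an upper bound only for sets that are bounded above; the sum of the
  moduli of all entries is a sufficient bound.\<close>

lemma op_norm_bdd:
  assumes A: "A \<in> carrier_mat n n"
  shows "bdd_above ((\<lambda>v. vec_norm2 (A *\<^sub>v v)) ` {v \<in> carrier_vec n. vec_norm2 v \<le> 1})"
proof (rule bdd_aboveI2)
  fix v :: "complex Matrix.vec" assume "v \<in> {v \<in> carrier_vec n. vec_norm2 v \<le> 1}"
  then have v: "v \<in> carrier_vec n" "vec_norm2 v \<le> 1"
    by auto
  have vj: "cmod (vec_index v j) \<le> 1" if "j < n" for j
    using member_le_L2_set[of "{..<n}" j "\<lambda>i. cmod (vec_index v i)"] that v by
        (simp add: vec_norm2_def)
  have "vec_norm2 (A *\<^sub>v v) \<le> (\<Sum>i<n. cmod (vec_index (A *\<^sub>v v) i))"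
  proof -
    have "dim_vec (A *\<^sub>v v) = n"
      using A by simp
    then show ?thesis
      unfolding vec_norm2_def by (simp only:) (rule L2_set_le_sum, simp)
  qed
  also have "\<dots> \<le> (\<Sum>i<n. \<Sum>j<n. cmod (A $$ (i, j)))"
  proof (rule sum_mono)
    fix i assume "i \<in> {..<n}"
    then have "cmod (vec_index (A *\<^sub>v v) i) \<le> (\<Sum>j<n. cmod (A $$ (i, j) * vec_index v j))"
      using mult_mat_vec_index[OF A v(1)] norm_sum by simp
    also have "\<dots> \<le> (\<Sum>j<n. cmod (A $$ (i, j)))"
      using vj by (intro sum_mono) (simp add: norm_mult mult_left_le)
    finally show "cmod (vec_index (A *\<^sub>v v) i) \<le> (\<Sum>j<n. cmod (A $$ (i, j)))" .
  qed
  finally show "vec_norm2 (A *\<^sub>v v) \<le> (\<Sum>i<n. \<Sum>j<n. cmod (A $$ (i, j)))" .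
qed

lemma op_norm_le_one_iff:
  assumes A: "A \<in> carrier_mat n n"
  shows "op_norm n A \<le> 1 \<longleftrightarrow> (\<forall>v\<in>carrier_vec n. vec_norm2 (A *\<^sub>v v) \<le> vec_norm2 v)"
proof
  assume *: "\<forall>v\<in>carrier_vec n. vec_norm2 (A *\<^sub>v v) \<le> vec_norm2 v"
  have "0\<^sub>v n \<in> {v \<in> carrier_vec n. vec_norm2 v \<le> 1}"
    by (simp add: vec_norm2_def L2_set_def)
  then show "op_norm n A \<le> 1"
    unfolding op_norm_def using * by (intro cSUP_least) force+
next
  assume le: "op_norm n A \<le> 1"
  have scale: "vec_norm2 (c \<cdot>\<^sub>v v) = cmod c * vec_norm2 v" for c v
  proof -
    have "vec_norm2 (c \<cdot>\<^sub>v v) = L2_set (\<lambda>i. cmod c * cmod (vec_index v i)) {..<dim_vec v}"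
      unfolding vec_norm2_def index_smult_vec(2) by (rule L2_set_cong) (simp_all add: norm_mult)
    then show ?thesis
      by (simp add: vec_norm2_def L2_set_right_distrib)
  qed
  show "\<forall>v\<in>carrier_vec n. vec_norm2 (A *\<^sub>v v) \<le> vec_norm2 v"
  proof
    fix v :: "complex Matrix.vec" assume v: "v \<in> carrier_vec n"
    show "vec_norm2 (A *\<^sub>v v) \<le> vec_norm2 v"
    proof (cases "vec_norm2 v = 0")
      case True
      then have "\<forall>i<n. vec_index v i = 0"
        using v by (simp add: vec_norm2_def L2_set_eq_0_iff)
      then have "vec_index (A *\<^sub>v v) i = 0" if "i < n" for i
        using mult_mat_vec_index[OF A v that] by simp
      then have "vec_norm2 (A *\<^sub>v v) = 0"
        using A by (simp add: vec_norm2_def L2_set_eq_0_iff)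
      then show ?thesis
        using True by simp
    next
      case False
      then have pos: "0 < vec_norm2 v"
        using vec_norm2_nonneg[of v] by simp
      let ?c = "complex_of_real (1 / vec_norm2 v)"
      have "vec_norm2 (?c \<cdot>\<^sub>v v) \<le> 1"
        unfolding scale using pos by (simp add: norm_divide)
      then have "vec_norm2 (A *\<^sub>v (?c \<cdot>\<^sub>v v)) \<le> op_norm n A"
        unfolding op_norm_def using v by (intro cSUP_upper op_norm_bdd[OF A]) auto
      also have "A *\<^sub>v (?c \<cdot>\<^sub>v v) = ?c \<cdot>\<^sub>v (A *\<^sub>v v)"
        using A v by (intro mult_mat_vec)
      finally have "vec_norm2 (A *\<^sub>v v) / vec_norm2 v \<le> op_norm n A"
        using pos unfolding scale by (simp add: norm_divide)
      then have "vec_norm2 (A *\<^sub>v v) / vec_norm2 v \<le> 1"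
        using le by linarith
      then show ?thesis
        using pos by (simp add: divide_le_eq)
    qed
  qed
qed

definition gram :: "'x set \<Rightarrow> ('x \<Rightarrow> complex Matrix.vec) \<Rightarrow> 'x \<Rightarrow> 'x \<Rightarrow> complex" where
  "gram \<Lambda> k p q = (\<Sum>i<card \<Lambda>. vec_index (k p) i * cnj (vec_index (k q) i))"

context
  fixes \<Lambda> :: "'x set" and k :: "'x \<Rightarrow> complex Matrix.vec"
  assumes fin: "finite \<Lambda>" and basis: "coordinate_basis \<Lambda> k"
begin

lemma basis_carrier: "p \<in> \<Lambda> \<Longrightarrow> k p \<in> carrier_vec (card \<Lambda>)"
  using basis by (simp add: coordinate_basis_def)

lemma basis_independent:
  assumes "\<And>i. i < card \<Lambda> \<Longrightarrow> (\<Sum>p\<in>\<Lambda>. c p * vec_index (k p) i) = 0" "p \<in> \<Lambda>"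
  shows "c p = 0"
  using basis assms unfolding coordinate_basis_def by blast

lemma matrix_eq_on_basis:
  assumes A: "A \<in> carrier_mat (card \<Lambda>) (card \<Lambda>)" and B: "B \<in> carrier_mat (card \<Lambda>) (card \<Lambda>)"
    and eq: "\<And>p. p \<in> \<Lambda> \<Longrightarrow> A *\<^sub>v k p = B *\<^sub>v k p"
  shows "A = B"
proof (rule eq_matI)
  fix i j assume "i < dim_row B" "j < dim_col B"
  then have ij: "i < card \<Lambda>" "j < card \<Lambda>"
    using B by auto
  have u: "unit_vec (card \<Lambda>) j \<in> carrier_vec (card \<Lambda>)"
    by simp
  obtain c where "\<forall>i<card \<Lambda>. vec_index (unit_vec (card \<Lambda>) j) i = (\<Sum>p\<in>\<Lambda>. c p * vec_index (k p) i)"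
    using coordinate_basis_span[OF fin basis u] by (elim exE)
  note c = this[rule_format]
  have entry: "vec_index (C *\<^sub>v unit_vec (card \<Lambda>) j) i = C $$ (i, j)"
      if C: "C \<in> carrier_mat (card \<Lambda>) (card \<Lambda>)" for C :: "complex mat"
  proof -
    have "vec_index (C *\<^sub>v unit_vec (card \<Lambda>) j) i = (\<Sum>j'<card \<Lambda>. if j' = j then C $$ (i, j) else 0)"
      unfolding mult_mat_vec_index[OF C u ij(1)] using ij(2) by (intro sum.cong refl) auto
    then show ?thesis
      using ij(2) by simp
  qed
  have "vec_index (A *\<^sub>v unit_vec (card \<Lambda>) j) i = vec_index (B *\<^sub>v unit_vec (card \<Lambda>) j) i"
    using mult_mat_vec_combination[OF A u basis_carrier ij(1) c]
        mult_mat_vec_combination[OF B u basis_carrier ij(1) c]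
    by (simp add: eq)
  then show "A $$ (i, j) = B $$ (i, j)"
    by (simp add: entry A B)
qed (use A B in auto)

lemma diagonal_matrix_exists:
  "\<exists>A \<in> carrier_mat (card \<Lambda>) (card \<Lambda>). \<forall>p\<in>\<Lambda>. A *\<^sub>v k p = g p \<cdot>\<^sub>v k p"
proof -
  let ?n = "card \<Lambda>"
  have "\<exists>c. \<forall>i<?n. vec_index (unit_vec ?n j) i = (\<Sum>p\<in>\<Lambda>. c p * vec_index (k p) i)" for j
    by (rule coordinate_basis_span[OF fin basis unit_vec_carrier])
  then obtain c where c: "\<And>j i. i < ?n \<Longrightarrow> vec_index (unit_vec ?n j) i =
      (\<Sum>p\<in>\<Lambda>. c j p * vec_index (k p) i)"
    by metis
  \<comment> \<open>Column \<open>j\<close> is the image of the \<open>j\<close>-th unit vector: its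
    coordinates \<open>c j p\<close> in the basis are scaled by \<open>g p\<close>.\<close>
  define A where "A = mat ?n ?n (\<lambda>(i, j). \<Sum>p\<in>\<Lambda>. c j p * g p * vec_index (k p) i)"
  have A: "A \<in> carrier_mat ?n ?n"
    by (simp add: A_def)
  have "A *\<^sub>v k q = g q \<cdot>\<^sub>v k q" if q: "q \<in> \<Lambda>" for q
  proof (rule eq_vecI)
    show "dim_vec (A *\<^sub>v k q) = dim_vec (g q \<cdot>\<^sub>v k q)"
      using A basis_carrier[OF q] by simp
    fix i assume "i < dim_vec (g q \<cdot>\<^sub>v k q)"
    then have i: "i < ?n"
      using basis_carrier[OF q] by simp
    \<comment> \<open>These are the coordinates of \<open>k q\<close> itself, computed through the
      unit vectors; by independence they are \<open>1\<close> at \<open>q\<close> and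
      \<open>0\<close> elsewhere.\<close>
    define d where "d p = (\<Sum>j<?n. c j p * vec_index (k q) j)" for p
    have expand: "(\<Sum>p\<in>\<Lambda>. d p * (h p * vec_index (k p) i)) =
        (\<Sum>j<?n. vec_index (k q) j * (\<Sum>p\<in>\<Lambda>. c j p * h p * vec_index (k p) i))" for h i
    proof -
      have "(\<Sum>p\<in>\<Lambda>. d p * (h p * vec_index (k p) i)) =
          (\<Sum>p\<in>\<Lambda>. \<Sum>j<?n. vec_index (k q) j * (c j p * h p * vec_index (k p) i))"
        unfolding d_def sum_distrib_right by (intro sum.cong refl) (simp add: mult_ac)
      also have "\<dots> = (\<Sum>j<?n. \<Sum>p\<in>\<Lambda>. vec_index (k q) j * (c j p * h p * vec_index (k p) i))"
        by (rule sum.swap)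
      finally show ?thesis
        by (simp only: sum_distrib_left)
    qed
    have "d p - (if p = q then 1 else 0) = 0" if p: "p \<in> \<Lambda>" for p
    proof (rule basis_independent[where c = "\<lambda>p. d p - (if p = q then 1 else 0)", OF _ p])
      fix i assume i: "i < ?n"
      have "(\<Sum>p\<in>\<Lambda>. d p * vec_index (k p) i) =
          (\<Sum>j<?n. vec_index (k q) j * vec_index (unit_vec ?n j) i)"
        using expand[of "\<lambda>_. 1" i] c[OF i] by simp
      also have "\<dots> = (\<Sum>j<?n. if j = i then vec_index (k q) i else 0)"
        using i by (intro sum.cong refl) auto
      also have "\<dots> = (\<Sum>p\<in>\<Lambda>. (if p = q then 1 else 0) * vec_index (k p) i)"
        using i q fin by (simp add: if_distrib[of "\<lambda>x. x * _"] cong: if_cong)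
      finally show "(\<Sum>p\<in>\<Lambda>. (d p - (if p = q then 1 else 0)) * vec_index (k p) i) = 0"
        by (simp only: left_diff_distrib sum_subtractf) simp
    qed
    then have d: "d p = (if p = q then 1 else 0)" if "p \<in> \<Lambda>" for p
      using that by (metis eq_iff_diff_eq_0)
    have "vec_index (A *\<^sub>v k q) i = (\<Sum>j<?n. vec_index (k q) j *
        (\<Sum>p\<in>\<Lambda>. c j p * g p * vec_index (k p) i))"
      unfolding mult_mat_vec_index[OF A basis_carrier[OF q] i] using i
      by (intro sum.cong refl) (simp add: A_def mult.commute)
    also have "\<dots> = (\<Sum>p\<in>\<Lambda>. if p = q then g q * vec_index (k q) i else 0)"
      unfolding expand[symmetric] by (intro sum.cong refl) (simp add: d)
    also have "\<dots> = vec_index (g q \<cdot>\<^sub>v k q) i"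
      using q fin i basis_carrier[OF q] by simp
    finally show "vec_index (A *\<^sub>v k q) i = vec_index (g q \<cdot>\<^sub>v k q) i" .
  qed
  then show ?thesis
    using A by (intro bexI[of _ A] ballI)
qed

text \<open>The defect form splits over the coordinates \<open>i\<close> into scalar instances of
  \<open>sum_defect_gram\<close>. It is thus the squared norm of a combination of the
  \<open>k p\<close> minus that of its image under \<open>A\<close>, and every vector is such a
  combination.\<close>

lemma op_norm_diagonal_iff:
  assumes A: "A \<in> carrier_mat (card \<Lambda>) (card \<Lambda>)" and eig: "\<And>p. p \<in> \<Lambda> \<Longrightarrow> A *\<^sub>v k p = g p \<cdot>\<^sub>v k p"
  shows "op_norm (card \<Lambda>) A \<le> 1 \<longleftrightarrow> psd_kernel_on \<Lambda> (\<lambda>p q. (1 - g p * cnj (g q)) * gram \<Lambda> k p q)"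
proof -
  let ?n = "card \<Lambda>"
  define N where "N c = (\<Sum>i<?n. (cmod (\<Sum>p\<in>\<Lambda>. c p * vec_index (k p) i))\<^sup>2)" for c
  have form: "(\<Sum>p\<in>\<Lambda>. \<Sum>q\<in>\<Lambda>. (1 - g p * cnj (g q)) * gram \<Lambda> k p q * c p * cnj (c q))
      = of_real (N c - N (\<lambda>p. g p * c p))" for c
  proof -
    have "(\<Sum>p\<in>\<Lambda>. \<Sum>q\<in>\<Lambda>. (1 - g p * cnj (g q)) * gram \<Lambda> k p q * c p * cnj (c q))
        = (\<Sum>p\<in>\<Lambda>. \<Sum>q\<in>\<Lambda>. \<Sum>i<?n. (1 - g p * cnj (g q)) * cinner (vec_index (k p) i)
            (vec_index (k q) i) * c p * cnj (c q))"
      unfolding gram_def cinner_complex_def sum_distrib_left sum_distrib_right ..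
    also have "\<dots> = (\<Sum>p\<in>\<Lambda>. \<Sum>i<?n. \<Sum>q\<in>\<Lambda>. (1 - g p * cnj (g q)) * cinner (vec_index (k p) i)
        (vec_index (k q) i) * c p * cnj (c q))"
      by (intro sum.cong refl sum.swap)
    also have "\<dots> = (\<Sum>i<?n. \<Sum>p\<in>\<Lambda>. \<Sum>q\<in>\<Lambda>. (1 - g p * cnj (g q)) * cinner (vec_index (k p) i)
        (vec_index (k q) i) * c p * cnj (c q))"
      by (rule sum.swap)
    also have "\<dots> = (\<Sum>i<?n. of_real ((cmod (\<Sum>p\<in>\<Lambda>. c p * vec_index (k p) i))\<^sup>2 -
        (cmod (\<Sum>p\<in>\<Lambda>. g p * c p * vec_index (k p) i))\<^sup>2))"
      unfolding sum_defect_gram scaleC_complex_def ..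
    finally show ?thesis
      unfolding N_def of_real_sum[symmetric] sum_subtractf .
  qed
  have "op_norm ?n A \<le> 1 \<longleftrightarrow> (\<forall>c. N (\<lambda>p. g p * c p) \<le> N c)"
  proof -
    have norms: "(vec_norm2 v)\<^sup>2 = N c" "(vec_norm2 (A *\<^sub>v v))\<^sup>2 = N (\<lambda>p. g p * c p)"
      if v: "v \<in> carrier_vec ?n" and c: "\<And>i. i < ?n \<Longrightarrow> vec_index v i =
          (\<Sum>p\<in>\<Lambda>. c p * vec_index (k p) i)"
      for v :: "complex Matrix.vec" and c
    proof -
      show "(vec_norm2 v)\<^sup>2 = N c"
        unfolding vec_norm2_power2[OF v] N_def by (simp add: c)
      have Av: "A *\<^sub>v v \<in> carrier_vec ?n"
        using A v by simp
      have "vec_index (A *\<^sub>v v) i = (\<Sum>p\<in>\<Lambda>. g p * c p * vec_index (k p) i)" if i: "i < ?n" for i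
      proof -
        have "vec_index (A *\<^sub>v v) i = (\<Sum>p\<in>\<Lambda>. c p * vec_index (A *\<^sub>v k p) i)"
          by (rule mult_mat_vec_combination[OF A v basis_carrier i c])
        also have "\<dots> = (\<Sum>p\<in>\<Lambda>. g p * c p * vec_index (k p) i)"
        proof (rule sum.cong[OF refl])
          fix p assume p: "p \<in> \<Lambda>"
          show "c p * vec_index (A *\<^sub>v k p) i = g p * c p * vec_index (k p) i"
            unfolding eig[OF p] using i basis_carrier[OF p] by simp
        qed
        finally show ?thesis .
      qed
      then show "(vec_norm2 (A *\<^sub>v v))\<^sup>2 = N (\<lambda>p. g p * c p)"
        unfolding vec_norm2_power2[OF Av] N_def by simp
    qed
    show ?thesis
      unfolding op_norm_le_one_iff[OF A]
    proof (intro iffI allI ballI)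
      fix c assume *: "\<forall>v\<in>carrier_vec ?n. vec_norm2 (A *\<^sub>v v) \<le> vec_norm2 v"
      define v where "v = Matrix.vec ?n (\<lambda>i. \<Sum>p\<in>\<Lambda>. c p * vec_index (k p) i)"
      have v: "v \<in> carrier_vec ?n" "\<And>i. i < ?n \<Longrightarrow> vec_index v i = (\<Sum>p\<in>\<Lambda>. c p * vec_index (k p) i)"
        by (simp_all add: v_def)
      have "(vec_norm2 (A *\<^sub>v v))\<^sup>2 \<le> (vec_norm2 v)\<^sup>2"
        using * v(1) vec_norm2_nonneg by (intro power_mono) auto
      moreover have "(vec_norm2 v)\<^sup>2 = N c" "(vec_norm2 (A *\<^sub>v v))\<^sup>2 = N (\<lambda>p. g p * c p)"
        by (rule norms[OF v(1)], erule v(2))+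
      ultimately show "N (\<lambda>p. g p * c p) \<le> N c"
        by simp
    next
      fix v :: "complex Matrix.vec"
      assume *: "\<forall>c. N (\<lambda>p. g p * c p) \<le> N c" and v: "v \<in> carrier_vec ?n"
      obtain c where "\<forall>i<?n. vec_index v i = (\<Sum>p\<in>\<Lambda>. c p * vec_index (k p) i)"
        using coordinate_basis_span[OF fin basis v] by (elim exE)
      note c = this[rule_format]
      have "(vec_norm2 (A *\<^sub>v v))\<^sup>2 \<le> (vec_norm2 v)\<^sup>2"
      proof -
        have "(vec_norm2 v)\<^sup>2 = N c" "(vec_norm2 (A *\<^sub>v v))\<^sup>2 = N (\<lambda>p. g p * c p)"
          by (rule norms[OF v], erule c)+
        then show ?thesis
          using * by simp
      qed
      then show "vec_norm2 (A *\<^sub>v v) \<le> vec_norm2 v"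
        by (rule power2_le_imp_le) (rule vec_norm2_nonneg)
    qed
  qed
  also have "\<dots> \<longleftrightarrow> psd_kernel_on \<Lambda> (\<lambda>p q. (1 - g p * cnj (g q)) * gram \<Lambda> k p q)"
    unfolding psd_kernel_on_finite[OF fin] form nonneg_Reals_of_real_iff by simp
  finally show ?thesis .
qed

end

text \<open>Distinct points separate the joint eigenspaces, so every joint eigenbasis is a rescaling of a
  given one and diagonalizes the same matrices.\<close>

lemma eigenbasis_independence:
  fixes \<Lambda> :: "(complex ^ 'd::finite) set"
  assumes fin: "finite \<Lambda>" and T: "\<And>r. T r \<in> carrier_mat (card \<Lambda>) (card \<Lambda>)"
    and k: "joint_eigenbasis \<Lambda> T k" and k': "joint_eigenbasis \<Lambda> T k'"
    and A: "A \<in> carrier_mat (card \<Lambda>) (card \<Lambda>)" "\<And>p. p \<in> \<Lambda> \<Longrightarrow> A *\<^sub>v k p = g p \<cdot>\<^sub>v k p"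
    and p: "p \<in> \<Lambda>"
  shows "A *\<^sub>v k' p = g p \<cdot>\<^sub>v k' p"
proof -
  let ?n = "card \<Lambda>"
  have basis: "coordinate_basis \<Lambda> k" and basis': "coordinate_basis \<Lambda> k'"
    using k k' fin unfolding joint_eigenbasis_def by (blast intro: coordinate_basis_of_basis)+
  note carrier = basis_carrier[OF fin basis] and carrier' = basis_carrier[OF fin basis' p]
  have eig: "T r *\<^sub>v k q = (q $ r) \<cdot>\<^sub>v k q" and eig': "T r *\<^sub>v k' q = (q $ r) \<cdot>\<^sub>v k' q" if "q \<in> \<Lambda>"
      for q r
    using k k' that unfolding joint_eigenbasis_def by blast+
  obtain c where "\<forall>i<?n. vec_index (k' p) i = (\<Sum>q\<in>\<Lambda>. c q * vec_index (k q) i)"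
    using coordinate_basis_span[OF fin basis carrier'] by (elim exE)
  note c = this[rule_format]
  have c0: "c q = 0" if q: "q \<in> \<Lambda>" "q \<noteq> p" for q
  proof -
    \<comment> \<open>Distinct points differ in some coordinate. Evaluating \<open>T r\<close> on
      the expansion of \<open>k' p\<close> in two ways gives a linear relation with coefficients
      \<open>(q $ r - p $ r) * c q\<close>.\<close>
    obtain r where r: "q $ r \<noteq> p $ r"
      using q(2) by (auto simp: Finite_Cartesian_Product.vec_eq_iff)
    have "(q $ r - p $ r) * c q = 0"
    proof (rule basis_independent[OF fin basis _ q(1), where c = "\<lambda>q. (q $ r - p $ r) * c q"])
      fix i assume i: "i < ?n"
      have "(\<Sum>q\<in>\<Lambda>. c q * vec_index (T r *\<^sub>v k q) i) = vec_index (T r *\<^sub>v k' p) i"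
        by (rule mult_mat_vec_combination[OF T carrier' carrier i c, symmetric])
      also have "\<dots> = p $ r * (\<Sum>q\<in>\<Lambda>. c q * vec_index (k q) i)"
        unfolding eig'[OF p] using i carrier' c[OF i] by simp
      also have "(\<Sum>q\<in>\<Lambda>. c q * vec_index (T r *\<^sub>v k q) i) = (\<Sum>q\<in>\<Lambda>. q $ r * c q * vec_index (k q) i)"
      proof (rule sum.cong[OF refl])
        fix q assume q: "q \<in> \<Lambda>"
        show "c q * vec_index (T r *\<^sub>v k q) i = q $ r * c q * vec_index (k q) i"
          unfolding eig[OF q] using i carrier[OF q] by simp
      qed
      finally show "(\<Sum>q\<in>\<Lambda>. (q $ r - p $ r) * c q * vec_index (k q) i) = 0"
        by (simp add: left_diff_distrib sum_subtractf sum_distrib_left mult.assoc)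
    qed
    then show ?thesis
      using r by simp
  qed
  show ?thesis
  proof (rule eq_vecI)
    show "dim_vec (A *\<^sub>v k' p) = dim_vec (g p \<cdot>\<^sub>v k' p)"
      using A(1) carrier' by simp
    fix i assume "i < dim_vec (g p \<cdot>\<^sub>v k' p)"
    then have i: "i < ?n"
      using carrier' by simp
    have "vec_index (A *\<^sub>v k' p) i = (\<Sum>q\<in>\<Lambda>. c q * vec_index (A *\<^sub>v k q) i)"
      by (rule mult_mat_vec_combination[OF A(1) carrier' carrier i c])
    also have "\<dots> = (\<Sum>q\<in>\<Lambda>. g p * (c q * vec_index (k q) i))"
    proof (rule sum.cong[OF refl])
      fix q assume q: "q \<in> \<Lambda>"
      show "c q * vec_index (A *\<^sub>v k q) i = g p * (c q * vec_index (k q) i)"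
        unfolding A(2)[OF q] using i carrier[OF q] c0[OF q] by (cases "q = p") simp_all
    qed
    also have "\<dots> = vec_index (g p \<cdot>\<^sub>v k' p) i"
      using i carrier' c[OF i] by (simp add: sum_distrib_left)
    finally show "vec_index (A *\<^sub>v k' p) i = vec_index (g p \<cdot>\<^sub>v k' p) i" .
  qed
qed

text \<open>A matrix diagonal in one joint eigenbasis is so in all of them by
  \<open>eigenbasis_independence\<close>, and its action on one basis determines it; this justifies
  the definite description.\<close>

lemma generic_apply:
  fixes \<Lambda> :: "(complex ^ 'd::finite) set"
  assumes fin: "finite \<Lambda>" and T: "\<And>r. T r \<in> carrier_mat (card \<Lambda>) (card \<Lambda>)"
    and k: "joint_eigenbasis \<Lambda> T k"
  shows "generic_apply \<Lambda> g T \<in> carrier_mat (card \<Lambda>) (card \<Lambda>)"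
    and "p \<in> \<Lambda> \<Longrightarrow> generic_apply \<Lambda> g T *\<^sub>v k p = g p \<cdot>\<^sub>v k p"
proof -
  have basis: "coordinate_basis \<Lambda> k"
    using k fin unfolding joint_eigenbasis_def by (blast intro: coordinate_basis_of_basis)
  obtain A where A: "A \<in> carrier_mat (card \<Lambda>) (card \<Lambda>)" "\<And>p. p \<in> \<Lambda> \<Longrightarrow> A *\<^sub>v k p = g p \<cdot>\<^sub>v k p"
    using diagonal_matrix_exists[OF fin basis, of g] by blast
  have "generic_apply \<Lambda> g T = A"
    unfolding generic_apply_def
  proof (rule the_equality)
    show "A \<in> carrier_mat (card \<Lambda>) (card \<Lambda>) \<and>
        (\<forall>k. joint_eigenbasis \<Lambda> T k \<longrightarrow> (\<forall>p\<in>\<Lambda>. A *\<^sub>v k p = g p \<cdot>\<^sub>v k p))"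
      using A(1) eigenbasis_independence[OF fin T k _ A] by blast
    fix B assume B: "B \<in> carrier_mat (card \<Lambda>) (card \<Lambda>) \<and>
        (\<forall>k. joint_eigenbasis \<Lambda> T k \<longrightarrow> (\<forall>p\<in>\<Lambda>. B *\<^sub>v k p = g p \<cdot>\<^sub>v k p))"
    then show "B = A"
      using k A by (intro matrix_eq_on_basis[OF fin basis]) auto
  qed
  then show "generic_apply \<Lambda> g T \<in> carrier_mat (card \<Lambda>) (card \<Lambda>)"
    and "p \<in> \<Lambda> \<Longrightarrow> generic_apply \<Lambda> g T *\<^sub>v k p = g p \<cdot>\<^sub>v k p"
    using A by auto
qed

lemma op_norm_generic_apply_iff:
  fixes \<Lambda> :: "(complex ^ 'd::finite) set"
  assumes "finite \<Lambda>" "\<And>r. T r \<in> carrier_mat (card \<Lambda>) (card \<Lambda>)" "joint_eigenbasis \<Lambda> T k"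
  shows "op_norm (card \<Lambda>) (generic_apply \<Lambda> g T) \<le> 1 \<longleftrightarrow>
    psd_kernel_on \<Lambda> (\<lambda>p q. (1 - g p * cnj (g q)) * gram \<Lambda> k p q)"
proof (rule op_norm_diagonal_iff)
  show "coordinate_basis \<Lambda> k"
    using assms(1,3) unfolding joint_eigenbasis_def by (blast intro: coordinate_basis_of_basis)
  show "generic_apply \<Lambda> g T *\<^sub>v k p = g p \<cdot>\<^sub>v k p" if "p \<in> \<Lambda>" for p
    by (rule generic_apply(2)[OF assms that])
qed (rule assms(1), rule generic_apply(1)[OF assms])

section \<open>The generic norm in terms of admissible kernels\<close>

lemma generic_norm_le_one_iff:
  "generic_norm U \<delta> E f \<le> 1 \<longleftrightarrow>
    (\<forall>\<Lambda> T. finite \<Lambda> \<and> \<Lambda> \<subseteq> G_poly U \<delta> \<and> T \<in> F_generic \<delta> \<Lambda> \<and> \<Lambda> \<subseteq> E \<longrightarrow>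
      op_norm (card \<Lambda>) (generic_apply \<Lambda> f T) \<le> 1)"
  unfolding generic_norm_def SUP_le_iff by auto

lemma generic_norm_le_one_of_cone:
  fixes \<delta> :: "'m::finite \<Rightarrow> complex ^ 'd::finite \<Rightarrow> complex"
  assumes psd: "\<And>l. psd_kernel_on E (\<kappa> l)"
    and id: "\<And>p q. p \<in> E \<Longrightarrow> q \<in> E \<Longrightarrow> 1 - f p * cnj (f q) =
        (\<Sum>l\<in>UNIV. (1 - \<delta> l p * cnj (\<delta> l q)) * \<kappa> l p q)"
  shows "generic_norm U \<delta> E f \<le> 1"
  unfolding generic_norm_le_one_iff
proof (intro allI impI, elim conjE)
  fix \<Lambda> T assume \<Lambda>: "finite \<Lambda>" "\<Lambda> \<subseteq> E" and T: "T \<in> F_generic \<delta> \<Lambda>"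
  obtain k where k: "joint_eigenbasis \<Lambda> T k" and carrier: "\<And>r. T r \<in> carrier_mat (card \<Lambda>) (card \<Lambda>)"
    using T unfolding F_generic_def generic_tuples_def by blast
  note iff = op_norm_generic_apply_iff[OF \<Lambda>(1) carrier k]
  show "op_norm (card \<Lambda>) (generic_apply \<Lambda> f T) \<le> 1"
    unfolding iff
  proof (rule psd_defect_of_cone[where \<kappa> = \<kappa> and \<delta> = \<delta>])
    show "psd_kernel_on \<Lambda> (\<lambda>p q. (1 - \<delta> l p * cnj (\<delta> l q)) * gram \<Lambda> k p q)" for l
      using T unfolding F_generic_def iff[symmetric] by blast
    show "psd_kernel_on \<Lambda> (\<kappa> l)" for l
      by (rule psd_kernel_on_subset[OF psd \<Lambda>(2)])
    show "1 - f p * cnj (f q) = (\<Sum>l\<in>UNIV. (1 - \<delta> l p * cnj (\<delta> l q)) * \<kappa> l p q)" if "p \<in> \<Lambda>" "q \<in> \<Lambda>"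
        for p q
      using that \<Lambda>(2) by (intro id) blast+
  qed
qed

text \<open>Every admissible \<open>G\<close> comes from a generic tuple: the vectors of a
  factorization of \<open>G\<close> serve as joint eigenbasis, and the conditions on
  \<open>G\<close> then say that the tuple lies in \<open>F_generic \<delta> F\<close>.\<close>

lemma gram_contractive_of_generic_norm:
  fixes \<delta> :: "'m::finite \<Rightarrow> complex ^ 'd::finite \<Rightarrow> complex"
  assumes norm: "generic_norm U \<delta> E f \<le> 1" and E: "E \<subseteq> G_poly U \<delta>"
  shows "gram_contractive \<delta> E f"
  unfolding gram_contractive_def
proof (intro allI impI)
  fix F and G :: "complex ^ 'd \<Rightarrow> complex ^ 'd \<Rightarrow> complex"
  assume F: "finite F" "F \<subseteq> E" and pd: "pd_kernel_on F G"
    and psd: "\<forall>l. psd_kernel_on F (\<lambda>p q. (1 - \<delta> l p * cnj (\<delta> l q)) * G p q)"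
  let ?n = "card F"
  obtain v :: "complex ^ 'd \<Rightarrow> nat \<Rightarrow> complex"
    where v: "\<And>p q. p \<in> F \<Longrightarrow> q \<in> F \<Longrightarrow> G p q = (\<Sum>i<?n. v p i * cnj (v q i))"
    using psd_kernel_finite_factorization[OF F(1), of G] pd unfolding pd_kernel_on_def by blast
  define k where "k p = Matrix.vec ?n (v p)" for p
  have basis: "coordinate_basis F k"
    unfolding coordinate_basis_def
  proof (intro conjI ballI allI impI)
    fix c p assume c: "\<forall>i<?n. (\<Sum>p\<in>F. c p * vec_index (k p) i) = 0" and p: "p \<in> F"
    \<comment> \<open>A linear relation among the vectors makes the form of \<open>G\<close> vanish
      at its coefficients, so strict positivity makes them zero.\<close>
    have "(\<Sum>p\<in>F. \<Sum>q\<in>F. G p q * c p * cnj (c q)) =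
        (\<Sum>p\<in>F. \<Sum>q\<in>F. \<Sum>i<?n. c p * v p i * cnj (c q * v q i))"
    proof (intro sum.cong refl)
      fix p q assume "p \<in> F" "q \<in> F"
      then show "G p q * c p * cnj (c q) = (\<Sum>i<?n. c p * v p i * cnj (c q * v q i))"
        unfolding v[OF \<open>p \<in> F\<close> \<open>q \<in> F\<close>] sum_distrib_right by (intro sum.cong refl) simp
    qed
    also have "\<dots> = (\<Sum>p\<in>F. \<Sum>i<?n. \<Sum>q\<in>F. c p * v p i * cnj (c q * v q i))"
      by (intro sum.cong refl sum.swap)
    also have "\<dots> = (\<Sum>p\<in>F. \<Sum>i<?n. c p * v p i * cnj (\<Sum>q\<in>F. c q * vec_index (k q) i))"
      by (intro sum.cong refl) (simp add: k_def sum_distrib_left)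
    also have "\<dots> = 0"
      using c by (intro sum.neutral ballI) simp
    finally show "c p = 0"
      using pd p unfolding pd_kernel_on_def by blast
  qed (simp add: k_def)
  have "\<exists>A\<in>carrier_mat ?n ?n. \<forall>p\<in>F. A *\<^sub>v k p = (p $ r) \<cdot>\<^sub>v k p" for r
    by (rule diagonal_matrix_exists[OF F(1) basis])
  then obtain T where T: "\<And>r. T r \<in> carrier_mat ?n ?n" "\<And>r p. p \<in> F \<Longrightarrow> T r *\<^sub>v k p = (p $ r) \<cdot>\<^sub>v k p"
    by metis
  have carrier: "k p \<in> carrier_vec ?n" for p
    by (simp add: k_def)
  have eigen: "joint_eigenbasis F T k"
    unfolding joint_eigenbasis_def using basis_of_coordinate_basis[OF F(1) basis] T(2) by blast
  have product: "(T r * T s) *\<^sub>v k p = (p $ r * p $ s) \<cdot>\<^sub>v k p" if "p \<in> F" for r s p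
  proof -
    have "(T r * T s) *\<^sub>v k p = T r *\<^sub>v (T s *\<^sub>v k p)"
      by (rule assoc_mult_mat_vec[OF T(1) T(1) carrier])
    also have "\<dots> = (p $ s) \<cdot>\<^sub>v (T r *\<^sub>v k p)"
      unfolding T(2)[OF that, of s] by (rule mult_mat_vec[OF T(1) carrier])
    finally show ?thesis
      unfolding T(2)[OF that] by (simp add: smult_smult_assoc mult.commute)
  qed
  have "T r * T s = T s * T r" for r s
  proof (rule matrix_eq_on_basis[OF F(1) basis])
    show "(T r * T s) *\<^sub>v k p = (T s * T r) *\<^sub>v k p" if "p \<in> F" for p
      unfolding product[OF that] by (simp add: mult.commute)
  qed (rule mult_carrier_mat[OF T(1) T(1)])+
  then have tuple: "T \<in> generic_tuples F"
    using T(1) eigen unfolding generic_tuples_def by blast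
  have gram: "gram F k p q = G p q" if "p \<in> F" "q \<in> F" for p q
    using v[OF that] by (simp add: gram_def k_def)
  have iff: "op_norm ?n (generic_apply F g T) \<le> 1 \<longleftrightarrow> psd_kernel_on F
      (\<lambda>p q. (1 - g p * cnj (g q)) * G p q)" for g
  proof -
    have "psd_kernel_on F (\<lambda>p q. (1 - g p * cnj (g q)) * gram F k p q) = psd_kernel_on F
        (\<lambda>p q. (1 - g p * cnj (g q)) * G p q)"
      by (rule psd_kernel_on_cong) (simp add: gram)
    then show ?thesis
      unfolding op_norm_generic_apply_iff[OF F(1) T(1) eigen] .
  qed
  have "T \<in> F_generic \<delta> F"
    unfolding F_generic_def mem_Collect_eq iff using tuple psd by (intro conjI)
  then have "op_norm ?n (generic_apply F f T) \<le> 1"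
    using norm F E unfolding generic_norm_le_one_iff by blast
  then show "psd_kernel_on F (\<lambda>p q. (1 - f p * cnj (f q)) * G p q)"
    unfolding iff .
qed

theorem theorem3p11:
  fixes U E :: "(complex ^ 'd::finite) set"
    and \<delta> :: "'m::{finite,linorder} \<Rightarrow> complex ^ 'd \<Rightarrow> complex"
    and f :: "complex ^ 'd \<Rightarrow> complex"
  assumes "domain_of_holomorphy U"
    and "\<And>l. \<delta> l \<in> holo U"
    and "\<And>l. \<not> \<delta> l constant_on U"
    and "compact (K_poly U \<delta>)"
    and "infinite_dimensional TYPE('h::complex_hilbert)"
    and "infinite_dimensional TYPE('k::complex_hilbert)"
    and "separable_space (euclidean :: 'k topology)"
    and "E \<subseteq> G_poly U \<delta>"
  shows
    "((f \<in> Hinf_generic U \<delta> E \<and> generic_norm U \<delta> E f \<le> 1) \<longleftrightarrow>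
      (\<lambda>p q. 1 - cnj (f q) * f p) \<in> C_cone \<delta> E) \<and>
     ((\<lambda>p q. 1 - cnj (f q) * f p) \<in> C_cone \<delta> E \<longleftrightarrow>
      has_realization TYPE('h) \<delta> E f) \<and>
     (has_realization TYPE('h) \<delta> E f \<longleftrightarrow>
      (\<exists>F \<in> Hinf_m TYPE('k). polydisc_norm TYPE('k) F \<le> 1 \<and>
         (\<forall>p\<in>E. f p = F (\<chi> l. \<delta> l p))))"
proof -
  have \<delta>: "cmod (\<delta> l p) < 1" if "p \<in> E" for l p
    using assms(8) that by (auto simp: G_poly_def)
  obtain e :: "nat \<Rightarrow> 'h" where e: "orthonormal_or_zero e" "\<And>k. norm (e k) = 1"
    using exists_orthonormal_sequence[OF assms(5)] by metis
  obtain e' :: "nat \<Rightarrow> 'k" where e': "orthonormal_or_zero e'" "\<And>k. norm (e' k) = 1"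
    using exists_orthonormal_sequence[OF assms(6)] by metis
  let ?a = "f \<in> Hinf_generic U \<delta> E \<and> generic_norm U \<delta> E f \<le> 1"
  let ?b = "(\<lambda>p q. 1 - cnj (f q) * f p) \<in> C_cone \<delta> E"
  let ?c = "has_realization TYPE('h) \<delta> E f"
  let ?d = "\<exists>F \<in> Hinf_m TYPE('k). polydisc_norm TYPE('k) F \<le> 1 \<and> (\<forall>p\<in>E. f p = F (\<chi> l. \<delta> l p))"
  have kernels: "?b \<longleftrightarrow> (\<exists>\<kappa>. (\<forall>l. psd_kernel_on E (\<kappa> l)) \<and>
      (\<forall>p\<in>E. \<forall>q\<in>E. 1 - f p * cnj (f q) = (\<Sum>l\<in>UNIV. (1 - \<delta> l p * cnj (\<delta> l q)) * \<kappa> l p q)))"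
    unfolding C_cone_def by (simp add: mult.commute)
  have b_of_gram: ?b if gram: "gram_contractive \<delta> E f"
    unfolding kernels by (rule cone_membership[OF _ gram]) (use \<delta> in auto)
  have ab: ?b if ?a
    by (rule b_of_gram, rule gram_contractive_of_generic_norm[OF conjunct2[OF that] assms(8)])
  have ba: ?a if b: ?b
  proof -
    obtain \<kappa> where \<kappa>: "\<And>l. psd_kernel_on E (\<kappa> l)"
      "\<forall>p\<in>E. \<forall>q\<in>E. 1 - f p * cnj (f q) = (\<Sum>l\<in>UNIV. (1 - \<delta> l p * cnj (\<delta> l q)) * \<kappa> l p q)"
      using b kernels by blast
    have "generic_norm U \<delta> E f \<le> 1"
      by (rule generic_norm_le_one_of_cone[OF \<kappa>(1) \<kappa>(2)[rule_format]])
    moreover have "f \<in> Hinf_generic U \<delta> E"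
      using calculation by (auto simp: Hinf_generic_def intro: le_less_trans)
    ultimately show ?thesis
      by blast
  qed
  \<comment> \<open>One isometric colligation over \<open>'h\<close> serves both conditions: it
    realizes \<open>f\<close>, and its transfer function is bounded on tuples over the other space
    \<open>'k\<close>.\<close>
  have bcd: "?c \<and> ?d" if b: ?b
  proof -
    obtain \<kappa> where \<kappa>: "\<And>l. psd_kernel_on E (\<kappa> l)"
      "\<forall>p\<in>E. \<forall>q\<in>E. 1 - f p * cnj (f q) = (\<Sum>l\<in>UNIV. (1 - \<delta> l p * cnj (\<delta> l q)) * \<kappa> l p q)"
      using b kernels by blast
    show ?thesis
    proof (rule isometric_colligation_of_cone[where E = E and \<delta> = \<delta> and \<kappa> = \<kappa> and f = f, OF e])
      show "cmod (\<delta> l p) < 1" if "p \<in> E" for l p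
        using that by (rule \<delta>)
      show "psd_kernel_on E (\<kappa> l)" for l
        by (rule \<kappa>(1))
      show "1 - f p * cnj (f q) = (\<Sum>l\<in>UNIV. (1 - \<delta> l p * cnj (\<delta> l q)) * \<kappa> l p q)" if "p \<in> E" "q \<in> E"
          for p q
        using \<kappa>(2) that by blast
      fix a \<beta> \<gamma> and D :: "'h ^ 'm::{finite,linorder} \<Rightarrow> 'h ^ 'm::{finite,linorder}"
      let ?F = "transfer_function (direct_sum (\<lambda>_. sequence_span e)) a \<beta> \<gamma> D"
      assume iso: "isometric_colligation e a \<beta> \<gamma> D" and f: "\<And>p. p \<in> E \<Longrightarrow> f p = ?F (point_eval \<delta> p)"
      have "realization \<delta> E f (\<lambda>_. sequence_span e) a \<beta> \<gamma> D"
        by (rule realization_of_isometric_colligation[OF e iso]) (use \<delta> f in auto)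
      then have ?c
        unfolding has_realization_def by blast
      moreover have ?d
        using polydisc_norm_transfer_le[OF e iso, where 'k = 'k] f
        by (intro bexI[of _ ?F] conjI ballI) (simp_all add: point_eval_def)
      ultimately show ?thesis ..
    qed
  qed
  have cb: ?b if ?c
    using that C_cone_of_realization unfolding has_realization_def by blast
  have db: ?b if d: ?d
  proof -
    obtain F where F: "polydisc_norm TYPE('k) F \<le> 1" "\<forall>p\<in>E. f p = F (\<chi> l. \<delta> l p)"
      using d by blast
    show ?thesis
      by (rule b_of_gram, rule gram_contractive_of_polydisc_norm[OF e' _ F(1)])
        (use \<delta> F(2) in \<open>auto simp: point_eval_def\<close>)
  qed
  show ?thesis
    using ab ba bcd cb db by argo
qed

end
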